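(* Let $(\mathscr{E},\mathscr{L},\mathscr{B})$ be a normal labelled space with alphabet $\mathscr{A}$ and tight spectrum $\mathsf{T}$, let $\mathbb{F}$ be the free group on $\mathscr{A}$, let $\mathcal{G}$ be the groupoid of the partial action $\Phi$ of $\mathbb{F}$ on $\mathsf{T}$ and let $\Gamma$ be the groupoid of the labelled space, both as defined in the context. Every element of $\mathcal{G}$ has the form $(\xi^{\alpha\gamma},\alpha\beta^{-1},\eta^{\beta\gamma})$ with $\alpha,\beta\in\mathscr{L}^*$ and $\phi_{\beta^{-1}}(\eta^{\beta\gamma})=\phi_{\alpha^{-1}}(\xi^{\alpha\gamma})$, and the map $\Theta:\mathcal{G}\to\Gamma$ defined by $$\Theta\big((\xi^{\alpha\gamma},\alpha\beta^{-1},\eta^{\beta\gamma})\big)=(\xi^{\alpha\gamma},|\alpha|-|\beta|,\eta^{\beta\gamma})$$ is an isomorphism of topological groupoids.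
   Context: **Labelled spaces.** A (directed) graph $\mathscr{E}=(\mathscr{E}^0,\mathscr{E}^1,r,s)$ consists of non-empty sets of vertices and edges and range/source maps $r,s:\mathscr{E}^1\to\mathscr{E}^0$. A path is a finite or infinite sequence of edges $\lambda_1\lambda_2\ldots$ with $r(\lambda_i)=s(\lambda_{i+1})$. A labelled graph is a graph with a surjective labelling map $\mathscr{L}:\mathscr{E}^1\to\mathscr{A}$ onto a non-empty set $\mathscr{A}$ (the alphabet), extended letterwise to paths. $\mathscr{L}^{\geq 1}$ is the set of labels of finite paths of length $\geq 1$; $\mathscr{L}^*=\{\omega\}\cup\mathscr{L}^{\geq1}$ with $\omega$ the empty word; $\overline{\mathscr{L}^\infty}$ is the set of infinite words over $\mathscr{A}$ all of whose finite beginnings lie in $\mathscr{L}^*$; $\overline{\mathscr{L}^{\leq\infty}}=\mathscr{L}^*\cup\overline{\mathscr{L}^\infty}$. $|\alpha|$ is the length of $\alpha$; $\alpha_{i,j}=\alpha_i\cdots\alpha_j$, and $\alpha_{i,j}=\omega$ if $j<i$. For $A\subseteq\mathscr{E}^0$: $r(A,\alpha)=\{r(\lambda): \mathscr{L}(\lambda)=\alpha,\ s(\lambda)\in A\}$ for $\alpha\in\mathscr{L}^{\geq1}$, $r(A,\omega)=A$, and $r(\alpha)=r(\mathscr{E}^0,\alpha)$. A labelled space is a triple $(\mathscr{E},\mathscr{L},\mathscr{B})$ with $\mathscr{B}$ a family of subsets of $\mathscr{E}^0$ closed under finite intersections and finite unions, containing $r(\alpha)$ for all $\alpha\in\mathscr{L}^{\geq1}$,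 and with $r(A,\alpha)\in\mathscr{B}$ for $A\in\mathscr{B}$, $\alpha\in\mathscr{L}^*$. It is weakly left-resolving if $r(A\cap B,\alpha)=r(A,\alpha)\cap r(B,\alpha)$ for all $A,B\in\mathscr{B}$, $\alpha\in\mathscr{L}^{\geq 1}$; it is normal if it is weakly left-resolving and $\mathscr{B}$ is closed under relative complements. $\mathscr{B}_\alpha=\{A\in\mathscr{B}: A\subseteq r(\alpha)\}$ (so $\mathscr{B}_\omega=\mathscr{B}$). **Tight spectrum.** $E(S)=\{(\alpha,A,\alpha):\alpha\in\mathscr{L}^*,\ \emptyset\neq A\in\mathscr{B}_\alpha\}\cup\{0\}$ is a meet semilattice with zero, where for non-zero elements $(\alpha,A,\alpha)\leq(\beta,B,\beta)$ iff $\alpha=\beta\alpha'$ and $A\subseteq r(B,\alpha')$. A filter in $E(S)$ is a non-empty upward closed subset, closed under meets, not containing $0$; ultrafilters are maximal filters. Filters are identified with their characteristic functions, given the topology of pointwise convergence; the tight spectrum $\mathsf{T}$ is the closure of the set of ultrafilters; its elements are the tight filters. For $e\in E(S)$, $V_e=\{\xi\in\mathsf{T}:e\in\xi\}$; the sets $V_{e:e_1,\dots,e_n}=V_e\setminus(V_{e_1}\cup\dots\cup V_{e_n})$ form a basis of compact-open sets of the Hausdorff space $\mathsf{T}$. Each tight filter $\xi$ has an associated word $\alpha\in\overline{\mathscr{L}^{\leq\infty}}$ (write $\xi=\xi^\alpha$) and filters $\xi_n=\{A\in\mathscr{B}:(\alpha_{1,n},A,\alpha_{1,n})\in\xi\}$,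 $0\le n\le|\alpha|$ ($n<\infty$), where $\xi_0$ may be empty; $(\beta,A,\beta)\in\xi^\alpha$ iff $\beta$ is a beginning of $\alpha$ and $A\in\xi_{|\beta|}$, and $\xi$ is determined by $\alpha$ and the family $\{\xi_n\}$. $\mathsf{T}_\alpha$ denotes the tight filters with word $\alpha$. **Gluing and cutting maps.** For $\alpha\in\mathscr{L}^{\geq1}$ and $\beta\in\overline{\mathscr{L}^{\leq\infty}}$ with $\alpha\beta\in\overline{\mathscr{L}^{\leq\infty}}$, let $\mathsf{T}_{(\alpha)\beta}=\{\xi\in\mathsf{T}_\beta:\xi_0\text{ is an ultrafilter in }\mathscr{B}\text{ with }r(\alpha)\in\xi_0\}$. The map $G_{(\alpha)\beta}:\mathsf{T}_{(\alpha)\beta}\to\mathsf{T}_{\alpha\beta}$ sends $\xi$ to $\eta$, where: if $\beta=\omega$, $\eta_{|\alpha|}=\{C\cap r(\alpha):C\in\xi_0\}$ and $\eta_i=\{D\in\mathscr{B}_{\alpha_{1,i}}:r(D,\alpha_{i+1,|\alpha|})\in\eta_{|\alpha|}\}$ for $0\leq i<|\alpha|$; if $\beta\neq\omega$, $\eta_{|\alpha|+n}=\{C\cap r(\alpha\beta_{1,n}):C\in\xi_n\}$ for $1\leq n\leq|\beta|$ ($n<\infty$) and $\eta_i=\{D\in\mathscr{B}_{\alpha_{1,i}}:r(D,\alpha_{i+1,|\alpha|}\beta_1)\in\eta_{|\alpha|+1}\}$ for $0\le i\le|\alpha|$. Its inverse $H_{[\alpha]\beta}:\mathsf{T}_{\alpha\beta}\to\mathsf{T}_{(\alpha)\beta}$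 sends $\xi$ to $\eta$ with $\eta_n=\{C\in\mathscr{B}_{\beta_{1,n}}:D\subseteq C\text{ for some }D\in\xi_{n+|\alpha|}\}$, $0\le n\le|\beta|$ ($n<\infty$). For $\alpha=\omega$ both maps are the identity of $\mathsf{T}_\beta$. **Partial action.** Identify the identity of $\mathbb{F}$ with $\omega$ and words over $\mathscr{A}$ with elements of $\mathbb{F}$. Put $V_\omega=\mathsf{T}$, $\phi_\omega=\mathrm{id}$; for $a\in\mathscr{A}$, $V_a=V_{(a,r(a),a)}$ (the disjoint union of the $\mathsf{T}_{a\beta}$), $V_{a^{-1}}=V_{(\omega,r(a),\omega)}$ (the disjoint union of the $\mathsf{T}_{(a)\beta}$), $\phi_a:V_{a^{-1}}\to V_a$ with $\phi_a|_{\mathsf{T}_{(a)\beta}}=G_{(a)\beta}$, and $\phi_{a^{-1}}=\phi_a^{-1}$. For $t=a_n\cdots a_1$ reduced, $a_i\in\mathscr{A}\cup\mathscr{A}^{-1}$, $n\geq2$, inductively $V_{t^{-1}}=\phi_{a_{n-1}\cdots a_1}^{-1}(V_{a_n^{-1}})$ and $\phi_t=\phi_{a_n}\circ\phi_{a_{n-1}\cdots a_1}$ on $V_{t^{-1}}$, so $\phi_t:V_{t^{-1}}\to V_t$. This defines a partial action $\Phi$ of $\mathbb{F}$ on $\mathsf{T}$. **The groupoid $\mathcal{G}$.** $\mathcal{G}=\{(\xi,t,\eta)\in\mathsf{T}\times\mathbb{F}\times\mathsf{T}:\eta\in V_{t^{-1}},\ \xi=\phi_t(\eta)\}$ with $(\xi,s,\eta)(\eta,t,\rho)=(\xi,st,\rho)$,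 $(\xi,t,\eta)^{-1}=(\eta,t^{-1},\xi)$, and the topology inherited from the product topology ($\mathbb{F}$ discrete). **The groupoid $\Gamma$.** $\Gamma=\{(\xi^{\alpha\gamma},|\alpha|-|\beta|,\eta^{\beta\gamma})\in\mathsf{T}\times\mathbb{Z}\times\mathsf{T}: H_{[\alpha]\gamma}(\xi^{\alpha\gamma})=H_{[\beta]\gamma}(\eta^{\beta\gamma})\}$ (with $\alpha,\beta\in\mathscr{L}^*$, $\gamma\in\overline{\mathscr{L}^{\leq\infty}}$), with $(\xi,m,\eta)(\eta,n,\rho)=(\xi,m+n,\rho)$, $(\xi,m,\eta)^{-1}=(\eta,-m,\xi)$. Its topology has as a basis the sets $Z_{s,e:e_1,\ldots,e_n}=\{(\eta^{\alpha\gamma},|\alpha|-|\beta|,\xi^{\beta\gamma})\in\Gamma:\xi\in V_{e:e_1,\dots,e_n},\ H_{[\alpha]\gamma}(\eta)=H_{[\beta]\gamma}(\xi)\}$, where $s=(\alpha,A,\beta)$ with $\alpha,\beta\in\mathscr{L}^*$, $\emptyset\neq A\in\mathscr{B}_\alpha\cap\mathscr{B}_\beta$, and $e,e_1,\dots,e_n\in E(S)$. *)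

theory Defs
  imports
    "HOL-Analysis.Analysis"
    "HOL-Algebra.Group"
    "HOL-Library.Stream"
    "Graph_Theory.Arc_Walk"
begin

section \<open>Topological groupoids\<close>

record 'g tgroupoid =
  arrows :: "'g set"
  composable :: "('g \<times> 'g) set"
  gmult :: "'g \<Rightarrow> 'g \<Rightarrow> 'g"
  ginv :: "'g \<Rightarrow> 'g"
  gtop :: "'g topology"

locale groupoid =
  fixes X :: "'g tgroupoid"
  assumes composable_arrows: "composable X \<subseteq> arrows X \<times> arrows X"
    and mult_closed: "\<And>x y. (x, y) \<in> composable X \<Longrightarrow> gmult X x y \<in> arrows X"
    and inv_closed: "\<And>x. x \<in> arrows X \<Longrightarrow> ginv X x \<in> arrows X"
    and inv_inv: "\<And>x. x \<in> arrows X \<Longrightarrow> ginv X (ginv X x) = x"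
    and composable_mult:
      "\<And>x y z. (x, y) \<in> composable X \<Longrightarrow> (y, z) \<in> composable X \<Longrightarrow>
        (gmult X x y, z) \<in> composable X \<and> (x, gmult X y z) \<in> composable X"
    and mult_assoc:
      "\<And>x y z. (x, y) \<in> composable X \<Longrightarrow> (y, z) \<in> composable X \<Longrightarrow>
        gmult X (gmult X x y) z = gmult X x (gmult X y z)"
    and composable_inv:
      "\<And>x. x \<in> arrows X \<Longrightarrow> (ginv X x, x) \<in> composable X \<and> (x, ginv X x) \<in> composable X"
    and left_cancel: "\<And>x y. (x, y) \<in> composable X \<Longrightarrow> gmult X (ginv X x) (gmult X x y) = y"
    and right_cancel: "\<And>x y. (x, y) \<in> composable X \<Longrightarrow> gmult X (gmult X x y) (ginv X y) = x"

locale topological_groupoid = groupoid +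
  assumes topspace_arrows: "topspace (gtop X) = arrows X"
    and continuous_mult:
      "continuous_map (subtopology (prod_topology (gtop X) (gtop X)) (composable X)) (gtop X)
        (\<lambda>(x, y). gmult X x y)"
    and continuous_inv: "continuous_map (gtop X) (gtop X) (ginv X)"

definition topological_groupoid_iso :: "'g tgroupoid \<Rightarrow> 'h tgroupoid \<Rightarrow> ('g \<Rightarrow> 'h) \<Rightarrow> bool" where
  "topological_groupoid_iso X Y f \<longleftrightarrow>
     topological_groupoid X \<and> topological_groupoid Y \<and>
     homeomorphic_map (gtop X) (gtop Y) f \<and>
     (\<forall>x\<in>arrows X. \<forall>y\<in>arrows X.
        (x, y) \<in> composable X \<longleftrightarrow> (f x, f y) \<in> composable Y) \<and>
     (\<forall>(x, y)\<in>composable X. f (gmult X x y) = gmult Y (f x) (f y)) \<and>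
     (\<forall>x\<in>arrows X. f (ginv X x) = ginv Y (f x))"


section \<open>The free group on a set\<close>

datatype 'a letter = Gen 'a | GenInv 'a

primrec letter_inv :: "'a letter \<Rightarrow> 'a letter" where
  "letter_inv (Gen a) = GenInv a"
| "letter_inv (GenInv a) = Gen a"

primrec generator :: "'a letter \<Rightarrow> 'a" where
  "generator (Gen a) = a"
| "generator (GenInv a) = a"

definition reduced :: "'a letter list \<Rightarrow> bool" where
  "reduced = successively (\<lambda>x y. y \<noteq> letter_inv x)"

definition push :: "'a letter \<Rightarrow> 'a letter list \<Rightarrow> 'a letter list" where
  "push x w = (case w of [] \<Rightarrow> [x] | y # ys \<Rightarrow> if y = letter_inv x then ys else x # w)"

definition free_reduce :: "'a letter list \<Rightarrow> 'a letter list" where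
  "free_reduce w = foldr push w []"

definition free_group :: "'a set \<Rightarrow> 'a letter list monoid" where
  "free_group A =
     \<lparr>carrier = {w. reduced w \<and> generator ` set w \<subseteq> A},
      mult = (\<lambda>u v. free_reduce (u @ v)),
      one = []\<rparr>"

lemma letter_inv_inv [simp]: "letter_inv (letter_inv x) = x"
  by (cases x) auto

lemma letter_inv_eq_iff [simp]: "letter_inv x = letter_inv y \<longleftrightarrow> x = y"
  by (metis letter_inv_inv)

lemma generator_letter_inv [simp]: "generator (letter_inv x) = generator x"
  by (cases x) auto

lemma reduced_simps [simp]:
  "reduced []" "reduced [x]"
  "reduced (x # y # w) \<longleftrightarrow> y \<noteq> letter_inv x \<and> reduced (y # w)"
  by (auto simp: reduced_def)

lemma reduced_tl: "reduced (x # w) \<Longrightarrow> reduced w"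
  by (cases w) auto

lemma reduced_push: "reduced w \<Longrightarrow> reduced (push x w)"
  by (cases w) (auto simp: push_def dest: reduced_tl)

lemma set_push: "set (push x w) \<subseteq> insert x (set w)"
  by (cases w) (auto simp: push_def)

lemma reduced_foldr_push: "reduced w \<Longrightarrow> reduced (foldr push u w)"
  by (induction u) (auto intro: reduced_push)

lemma set_foldr_push: "set (foldr push u w) \<subseteq> set u \<union> set w"
proof (induction u)
  case (Cons x u)
  then show ?case using set_push[of x "foldr push u w"] by auto
qed simp

lemma push_cancel: "reduced w \<Longrightarrow> push x (push (letter_inv x) w) = w"
  by (cases w; cases "tl w") (auto simp: push_def)

lemma push_cancel': "reduced w \<Longrightarrow> push (letter_inv x) (push x w) = w"
  using push_cancel[of w "letter_inv x"] by simp

lemma push_reduced: "reduced (x # w) \<Longrightarrow> push x w = x # w"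
  by (cases w) (auto simp: push_def)

lemma free_reduce_reduced: "reduced w \<Longrightarrow> free_reduce w = w"
proof (induction w)
  case (Cons x w)
  then show ?case
    using reduced_tl[OF Cons.prems] push_reduced[OF Cons.prems] by (simp add: free_reduce_def)
qed (simp add: free_reduce_def)

lemma foldr_push_push:
  assumes "reduced z"
  shows "foldr push (push x w) z = push x (foldr push w z)"
proof (cases w)
  case (Cons y ys)
  then show ?thesis
    using push_cancel[OF reduced_foldr_push[OF assms], of x ys] by (auto simp: push_def)
qed (simp add: push_def)

lemma foldr_push_free_reduce: "reduced z \<Longrightarrow> foldr push (free_reduce w) z = foldr push w z"
  by (induction w) (auto simp: free_reduce_def foldr_push_push)

lemma free_reduce_append_left: "free_reduce (free_reduce u @ v) = free_reduce (u @ v)"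
  using foldr_push_free_reduce[of "foldr push v []" u] reduced_foldr_push[of "[]" v]
  by (simp add: free_reduce_def)

lemma free_reduce_append_right: "free_reduce (u @ free_reduce v) = free_reduce (u @ v)"
  using free_reduce_reduced[of "foldr push v []"] reduced_foldr_push[of "[]" v]
  by (simp add: free_reduce_def)

lemma free_reduce_inverse: "free_reduce (rev (map letter_inv w) @ w) = []"
proof -
  have "foldr push (rev (map letter_inv w)) (foldr push w z) = z" if "reduced z" for z
    using that by (induction w) (auto simp: push_cancel' reduced_foldr_push)
  from this[of "[]"] show ?thesis by (simp add: free_reduce_def)
qed

lemma reduced_inverse: "reduced w \<Longrightarrow> reduced (rev (map letter_inv w))"
  unfolding reduced_def successively_rev successively_map
  by (erule successively_mono) auto

lemma group_free_group: "group (free_group A)"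
proof (rule groupI)
  show "x \<otimes>\<^bsub>free_group A\<^esub> y \<in> carrier (free_group A)"
    if "x \<in> carrier (free_group A)" "y \<in> carrier (free_group A)" for x y
    using that set_foldr_push[of "x @ y" "[]"] reduced_foldr_push[of "[]" "x @ y"]
    by (fastforce simp: free_group_def free_reduce_def)
  show "\<exists>y\<in>carrier (free_group A). y \<otimes>\<^bsub>free_group A\<^esub> x = \<one>\<^bsub>free_group A\<^esub>"
    if "x \<in> carrier (free_group A)" for x
    using that reduced_inverse free_reduce_inverse
    by (intro bexI[of _ "rev (map letter_inv x)"]) (auto simp: free_group_def image_image)
qed (auto simp: free_group_def free_reduce_append_left free_reduce_append_right free_reduce_reduced)


section \<open>Finite and infinite words\<close>

datatype 'a fiword = Fin "'a list" | Inf "'a stream"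

primrec wlen :: "'a fiword \<Rightarrow> enat" where
  "wlen (Fin u) = enat (length u)"
| "wlen (Inf x) = \<infinity>"

text \<open>\<open>wtake n \<gamma>\<close> is the beginning \<open>\<gamma>\<^sub>1 \<dots> \<gamma>\<^sub>n\<close>; it is only meaningful for \<open>enat n \<le> wlen \<gamma>\<close>.\<close>

primrec wtake :: "nat \<Rightarrow> 'a fiword \<Rightarrow> 'a list" where
  "wtake n (Fin u) = take n u"
| "wtake n (Inf x) = stake n x"

primrec wapp :: "'a list \<Rightarrow> 'a fiword \<Rightarrow> 'a fiword" (infixr \<open>\<cdot>\<^sub>w\<close> 65) where
  "u \<cdot>\<^sub>w Fin v = Fin (u @ v)"
| "u \<cdot>\<^sub>w Inf x = Inf (u @- x)"


section \<open>Labelled spaces\<close>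

text \<open>In the underlying digraph, \<open>tail\<close> is the source map and \<open>head\<close> the range map.\<close>

record ('v, 'e, 'a) lspace =
  graph :: "('v, 'e) pre_digraph"
  alphabet :: "'a set"
  label :: "'e \<Rightarrow> 'a"
  family :: "'v set set"

definition labels1 :: "('v, 'e, 'a) lspace \<Rightarrow> 'a list set" where
  "labels1 S = {map (label S) p | u p v. p \<noteq> [] \<and> pre_digraph.awalk (graph S) u p v}"

definition labels :: "('v, 'e, 'a) lspace \<Rightarrow> 'a list set" where
  "labels S = {[]} \<union> labels1 S"

definition labels_inf :: "('v, 'e, 'a) lspace \<Rightarrow> 'a stream set" where
  "labels_inf S = {x. sset x \<subseteq> alphabet S \<and> (\<forall>n. stake n x \<in> labels S)}"

definition fiwords :: "('v, 'e, 'a) lspace \<Rightarrow> 'a fiword set" where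
  "fiwords S = Fin ` labels S \<union> Inf ` labels_inf S"

definition rel_range :: "('v, 'e, 'a) lspace \<Rightarrow> 'v set \<Rightarrow> 'a list \<Rightarrow> 'v set" where
  "rel_range S A \<alpha> =
     (if \<alpha> = [] then A
      else {v. \<exists>u\<in>A. \<exists>p. pre_digraph.awalk (graph S) u p v \<and> map (label S) p = \<alpha>})"

definition word_range :: "('v, 'e, 'a) lspace \<Rightarrow> 'a list \<Rightarrow> 'v set" where
  "word_range S \<alpha> = rel_range S (verts (graph S)) \<alpha>"

locale labelled_space = wf_digraph "graph S" for S :: "('v, 'e, 'a) lspace" +
  assumes verts_nonempty: "verts (graph S) \<noteq> {}"
    and arcs_nonempty: "arcs (graph S) \<noteq> {}"
    and label_surj: "label S ` arcs (graph S) = alphabet S"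
    and family_subset: "\<And>A. A \<in> family S \<Longrightarrow> A \<subseteq> verts (graph S)"
    and family_Int: "\<And>A B. A \<in> family S \<Longrightarrow> B \<in> family S \<Longrightarrow> A \<inter> B \<in> family S"
    and family_Un: "\<And>A B. A \<in> family S \<Longrightarrow> B \<in> family S \<Longrightarrow> A \<union> B \<in> family S"
    and family_range: "\<And>\<alpha>. \<alpha> \<in> labels1 S \<Longrightarrow> word_range S \<alpha> \<in> family S"
    and family_rel_range:
      "\<And>A \<alpha>. A \<in> family S \<Longrightarrow> \<alpha> \<in> labels S \<Longrightarrow> rel_range S A \<alpha> \<in> family S"

locale weakly_left_resolving = labelled_space +
  assumes rel_range_Int:
    "\<And>A B \<alpha>. A \<in> family S \<Longrightarrow> B \<in> family S \<Longrightarrow> \<alpha> \<in> labels1 S \<Longrightarrow>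
       rel_range S (A \<inter> B) \<alpha> = rel_range S A \<alpha> \<inter> rel_range S B \<alpha>"

locale normal_labelled_space = weakly_left_resolving +
  assumes family_Diff: "\<And>A B. A \<in> family S \<Longrightarrow> B \<in> family S \<Longrightarrow> A - B \<in> family S"

definition family_at :: "('v, 'e, 'a) lspace \<Rightarrow> 'a list \<Rightarrow> 'v set set" where
  "family_at S \<alpha> = {A \<in> family S. A \<subseteq> word_range S \<alpha>}"


section \<open>The tight spectrum\<close>

text \<open>The idempotent \<open>(\<alpha>, A, \<alpha>)\<close> is encoded as \<open>Some (\<alpha>, A)\<close>, and \<open>0\<close> as \<open>None\<close>.\<close>

type_synonym ('v, 'a) idem = "('a list \<times> 'v set) option"

fun idem_le :: "('v, 'e, 'a) lspace \<Rightarrow> ('v, 'a) idem \<Rightarrow> ('v, 'a) idem \<Rightarrow> bool" where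
  "idem_le S None f = True"
| "idem_le S (Some e) None = False"
| "idem_le S (Some (\<alpha>, A)) (Some (\<beta>, B)) = (\<exists>\<alpha>'. \<alpha> = \<beta> @ \<alpha>' \<and> A \<subseteq> rel_range S B \<alpha>')"

definition idems :: "('v, 'e, 'a) lspace \<Rightarrow> ('v, 'a) idem gorder" where
  "idems S =
     \<lparr>carrier = {Some (\<alpha>, A) | \<alpha> A. \<alpha> \<in> labels S \<and> A \<noteq> {} \<and> A \<in> family_at S \<alpha>} \<union> {None},
      eq = (=),
      le = idem_le S\<rparr>"

definition idem_filter :: "('v, 'e, 'a) lspace \<Rightarrow> ('v, 'a) idem set \<Rightarrow> bool" where
  "idem_filter S \<xi> \<longleftrightarrow>
     \<xi> \<noteq> {} \<and> \<xi> \<subseteq> carrier (idems S) \<and> None \<notin> \<xi> \<and>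
     (\<forall>e\<in>\<xi>. \<forall>f\<in>carrier (idems S). e \<sqsubseteq>\<^bsub>idems S\<^esub> f \<longrightarrow> f \<in> \<xi>) \<and>
     (\<forall>e\<in>\<xi>. \<forall>f\<in>\<xi>. e \<sqinter>\<^bsub>idems S\<^esub> f \<in> \<xi>)"

definition idem_ultrafilter :: "('v, 'e, 'a) lspace \<Rightarrow> ('v, 'a) idem set \<Rightarrow> bool" where
  "idem_ultrafilter S \<xi> \<longleftrightarrow>
     idem_filter S \<xi> \<and> (\<forall>\<eta>. idem_filter S \<eta> \<and> \<xi> \<subseteq> \<eta> \<longrightarrow> \<eta> = \<xi>)"

definition filter_space :: "('v, 'e, 'a) lspace \<Rightarrow> ('v, 'a) idem set topology" where
  "filter_space S =
     pullback_topology {\<xi>. idem_filter S \<xi>} (\<lambda>\<xi>. \<lambda>e\<in>carrier (idems S). e \<in> \<xi>)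
       (product_topology (\<lambda>_. discrete_topology (UNIV :: bool set)) (carrier (idems S)))"

definition tight :: "('v, 'e, 'a) lspace \<Rightarrow> ('v, 'a) idem set set" where
  "tight S = filter_space S closure_of {\<xi>. idem_ultrafilter S \<xi>}"

definition tight_space :: "('v, 'e, 'a) lspace \<Rightarrow> ('v, 'a) idem set topology" where
  "tight_space S = subtopology (filter_space S) (tight S)"

definition V_idem :: "('v, 'e, 'a) lspace \<Rightarrow> ('v, 'a) idem \<Rightarrow> ('v, 'a) idem set set" where
  "V_idem S e = {\<xi> \<in> tight S. e \<in> \<xi>}"

definition V_basic ::
  "('v, 'e, 'a) lspace \<Rightarrow> ('v, 'a) idem \<Rightarrow> ('v, 'a) idem set \<Rightarrow> ('v, 'a) idem set set" where
  "V_basic S e D = V_idem S e - (\<Union>d\<in>D. V_idem S d)"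

text \<open>\<open>component S \<alpha> \<xi> n\<close> is \<open>\<xi>\<^sub>n\<close> for a filter \<open>\<xi>\<close> with word \<open>\<alpha>\<close> and \<open>n \<le> |\<alpha>|\<close>.\<close>

definition component ::
  "('v, 'e, 'a) lspace \<Rightarrow> 'a fiword \<Rightarrow> ('v, 'a) idem set \<Rightarrow> nat \<Rightarrow> 'v set set" where
  "component S \<alpha> \<xi> n = {A \<in> family S. Some (wtake n \<alpha>, A) \<in> \<xi>}"

text \<open>The word of a filter is the word whose beginnings are the words occurring in the filter.
  The empty beginning is exempt from having to occur, since \<open>\<xi>\<^sub>0\<close> may be empty.\<close>

definition has_word :: "('v, 'e, 'a) lspace \<Rightarrow> ('v, 'a) idem set \<Rightarrow> 'a fiword \<Rightarrow> bool" where
  "has_word S \<xi> \<alpha> \<longleftrightarrow>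
     \<alpha> \<in> fiwords S \<and>
     (\<forall>\<beta> A. Some (\<beta>, A) \<in> \<xi> \<longrightarrow> (\<exists>n. enat n \<le> wlen \<alpha> \<and> \<beta> = wtake n \<alpha>)) \<and>
     (\<forall>n\<ge>1. enat n \<le> wlen \<alpha> \<longrightarrow> component S \<alpha> \<xi> n \<noteq> {})"

definition filter_word :: "('v, 'e, 'a) lspace \<Rightarrow> ('v, 'a) idem set \<Rightarrow> 'a fiword" where
  "filter_word S \<xi> = (THE \<alpha>. has_word S \<xi> \<alpha>)"

definition tight_at :: "('v, 'e, 'a) lspace \<Rightarrow> 'a fiword \<Rightarrow> ('v, 'a) idem set set" where
  "tight_at S \<alpha> = {\<xi> \<in> tight S. has_word S \<xi> \<alpha>}"

definition filter_of :: "'a fiword \<Rightarrow> (nat \<Rightarrow> 'v set set) \<Rightarrow> ('v, 'a) idem set" where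
  "filter_of \<alpha> F = {Some (wtake n \<alpha>, A) | n A. enat n \<le> wlen \<alpha> \<and> A \<in> F n}"


section \<open>Gluing and cutting\<close>

text \<open>The value \<open>drop i \<alpha>\<close> is \<open>\<alpha>\<^sub>i\<^sub>+\<^sub>1 \<dots> \<alpha>\<^sub>|\<^sub>\<alpha>\<^sub>|\<close>, and \<open>wtake 1 \<beta>\<close> is \<open>\<beta>\<^sub>1\<close> as a one-letter word.\<close>

definition glue_family_empty ::
  "('v, 'e, 'a) lspace \<Rightarrow> 'a list \<Rightarrow> ('v, 'a) idem set \<Rightarrow> nat \<Rightarrow> 'v set set" where
  "glue_family_empty S \<alpha> \<xi> i =
     (let last = {C \<inter> word_range S \<alpha> | C. C \<in> component S (Fin []) \<xi> 0}
      in if i = length \<alpha> then last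
         else {D \<in> family_at S (take i \<alpha>). rel_range S D (drop i \<alpha>) \<in> last})"

definition glue_family ::
  "('v, 'e, 'a) lspace \<Rightarrow> 'a list \<Rightarrow> 'a fiword \<Rightarrow> ('v, 'a) idem set \<Rightarrow> nat \<Rightarrow> 'v set set" where
  "glue_family S \<alpha> \<beta> \<xi> i =
     (let later = (\<lambda>n. {C \<inter> word_range S (\<alpha> @ wtake n \<beta>) | C. C \<in> component S \<beta> \<xi> n})
      in if i > length \<alpha> then later (i - length \<alpha>)
         else {D \<in> family_at S (take i \<alpha>). rel_range S D (drop i \<alpha> @ wtake 1 \<beta>) \<in> later 1})"

definition glue ::
  "('v, 'e, 'a) lspace \<Rightarrow> 'a list \<Rightarrow> 'a fiword \<Rightarrow> ('v, 'a) idem set \<Rightarrow> ('v, 'a) idem set" where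
  "glue S \<alpha> \<beta> \<xi> =
     (if \<alpha> = [] then \<xi>
      else filter_of (\<alpha> \<cdot>\<^sub>w \<beta>)
        (if \<beta> = Fin [] then glue_family_empty S \<alpha> \<xi> else glue_family S \<alpha> \<beta> \<xi>))"

definition cut ::
  "('v, 'e, 'a) lspace \<Rightarrow> 'a list \<Rightarrow> 'a fiword \<Rightarrow> ('v, 'a) idem set \<Rightarrow> ('v, 'a) idem set" where
  "cut S \<alpha> \<beta> \<xi> =
     (if \<alpha> = [] then \<xi>
      else filter_of \<beta>
        (\<lambda>n. {C \<in> family_at S (wtake n \<beta>).
               \<exists>D\<in>component S (\<alpha> \<cdot>\<^sub>w \<beta>) \<xi> (n + length \<alpha>). D \<subseteq> C}))"


section \<open>The partial action of the free group\<close>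

abbreviation free :: "('v, 'e, 'a) lspace \<Rightarrow> 'a letter list monoid" where
  "free S \<equiv> free_group (alphabet S)"

primrec V_letter :: "('v, 'e, 'a) lspace \<Rightarrow> 'a letter \<Rightarrow> ('v, 'a) idem set set" where
  "V_letter S (Gen a) = V_idem S (Some ([a], word_range S [a]))"
| "V_letter S (GenInv a) = V_idem S (Some ([], word_range S [a]))"

definition phi_gen :: "('v, 'e, 'a) lspace \<Rightarrow> 'a \<Rightarrow> ('v, 'a) idem set \<Rightarrow> ('v, 'a) idem set" where
  "phi_gen S a \<xi> = glue S [a] (filter_word S \<xi>) \<xi>"

primrec phi_letter ::
  "('v, 'e, 'a) lspace \<Rightarrow> 'a letter \<Rightarrow> ('v, 'a) idem set \<Rightarrow> ('v, 'a) idem set" where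
  "phi_letter S (Gen a) = phi_gen S a"
| "phi_letter S (GenInv a) = inv_into (V_letter S (GenInv a)) (phi_gen S a)"

primrec phi ::
  "('v, 'e, 'a) lspace \<Rightarrow> 'a letter list \<Rightarrow> ('v, 'a) idem set \<Rightarrow> ('v, 'a) idem set" where
  "phi S [] = id"
| "phi S (x # t) = phi_letter S x \<circ> phi S t"

text \<open>\<open>phi_dom S t\<close> is \<open>V\<^bsub>t\<inverse>\<^esub>\<close>, the domain of \<open>\<phi>\<^bsub>t\<^esub>\<close>.\<close>

primrec phi_dom :: "('v, 'e, 'a) lspace \<Rightarrow> 'a letter list \<Rightarrow> ('v, 'a) idem set set" where
  "phi_dom S [] = tight S"
| "phi_dom S (x # t) = {\<xi> \<in> phi_dom S t. phi S t \<xi> \<in> V_letter S (letter_inv x)}"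


section \<open>The two groupoids\<close>

definition action_groupoid ::
  "('v, 'e, 'a) lspace \<Rightarrow>
     (('v, 'a) idem set \<times> 'a letter list \<times> ('v, 'a) idem set) tgroupoid" where
  "action_groupoid S =
     (let X = {(\<xi>, t, \<eta>). \<xi> \<in> tight S \<and> t \<in> carrier (free S) \<and> \<eta> \<in> phi_dom S t \<and> \<xi> = phi S t \<eta>}
      in \<lparr>arrows = X,
          composable = {((\<xi>, s, \<eta>), (\<eta>', t, \<rho>)) | \<xi> s \<eta> \<eta>' t \<rho>.
            (\<xi>, s, \<eta>) \<in> X \<and> (\<eta>', t, \<rho>) \<in> X \<and> \<eta> = \<eta>'},
          gmult = (\<lambda>(\<xi>, s, \<eta>) (\<eta>', t, \<rho>). (\<xi>, s \<otimes>\<^bsub>free S\<^esub> t, \<rho>)),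
          ginv = (\<lambda>(\<xi>, t, \<eta>). (\<eta>, inv\<^bsub>free S\<^esub> t, \<xi>)),
          gtop = subtopology
            (prod_topology (tight_space S)
              (prod_topology (discrete_topology (carrier (free S))) (tight_space S))) X\<rparr>)"

text \<open>The basic set \<open>Z\<^bsub>s,e:e\<^sub>1,\<dots>,e\<^sub>n\<^esub>\<close>, with \<open>D = {e\<^sub>1, \<dots>, e\<^sub>n}\<close>, depends on \<open>s = (\<alpha>, A, \<beta>)\<close>
  only through \<open>\<alpha>\<close> and \<open>\<beta>\<close>; the set \<open>A\<close> matters only for which pairs \<open>\<alpha>, \<beta>\<close> are admitted.\<close>

definition Z_basic ::
  "('v, 'e, 'a) lspace \<Rightarrow> 'a list \<Rightarrow> 'a list \<Rightarrow> ('v, 'a) idem \<Rightarrow> ('v, 'a) idem set \<Rightarrow>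
     (('v, 'a) idem set \<times> int \<times> ('v, 'a) idem set) set" where
  "Z_basic S \<alpha> \<beta> e D =
     {(\<eta>, int (length \<alpha>) - int (length \<beta>), \<xi>) | \<eta> \<xi> \<gamma>.
        \<gamma> \<in> fiwords S \<and> \<eta> \<in> tight_at S (\<alpha> \<cdot>\<^sub>w \<gamma>) \<and> \<xi> \<in> tight_at S (\<beta> \<cdot>\<^sub>w \<gamma>) \<and>
        \<xi> \<in> V_basic S e D \<and> cut S \<alpha> \<gamma> \<eta> = cut S \<beta> \<gamma> \<xi>}"

definition Z_basis ::
  "('v, 'e, 'a) lspace \<Rightarrow> (('v, 'a) idem set \<times> int \<times> ('v, 'a) idem set) set set" where
  "Z_basis S =
     {Z_basic S \<alpha> \<beta> e D | \<alpha> A \<beta> e D.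
        \<alpha> \<in> labels S \<and> \<beta> \<in> labels S \<and> A \<noteq> {} \<and> A \<in> family_at S \<alpha> \<inter> family_at S \<beta> \<and>
        e \<in> carrier (idems S) \<and> finite D \<and> D \<subseteq> carrier (idems S)}"

definition labelled_groupoid ::
  "('v, 'e, 'a) lspace \<Rightarrow> (('v, 'a) idem set \<times> int \<times> ('v, 'a) idem set) tgroupoid" where
  "labelled_groupoid S =
     (let X = {(\<xi>, int (length \<alpha>) - int (length \<beta>), \<eta>) | \<xi> \<eta> \<alpha> \<beta> \<gamma>.
            \<alpha> \<in> labels S \<and> \<beta> \<in> labels S \<and> \<gamma> \<in> fiwords S \<and>
            \<xi> \<in> tight_at S (\<alpha> \<cdot>\<^sub>w \<gamma>) \<and> \<eta> \<in> tight_at S (\<beta> \<cdot>\<^sub>w \<gamma>) \<and>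
            cut S \<alpha> \<gamma> \<xi> = cut S \<beta> \<gamma> \<eta>}
      in \<lparr>arrows = X,
          composable = {((\<xi>, m, \<eta>), (\<eta>', n, \<rho>)) | \<xi> m \<eta> \<eta>' n \<rho>.
            (\<xi>, m, \<eta>) \<in> X \<and> (\<eta>', n, \<rho>) \<in> X \<and> \<eta> = \<eta>'},
          gmult = (\<lambda>(\<xi>, m, \<eta>) (\<eta>', n, \<rho>). (\<xi>, m + n, \<rho>)),
          ginv = (\<lambda>(\<xi>, m, \<eta>). (\<eta>, - m, \<xi>)),
          gtop = topology (arbitrary union_of (\<lambda>U. U \<in> Z_basis S))\<rparr>)"

text \<open>The element \<open>\<alpha>\<beta>\<inverse>\<close> of the free group; the product need not be cancellation-free.\<close>

definition quot_word :: "('v, 'e, 'a) lspace \<Rightarrow> 'a list \<Rightarrow> 'a list \<Rightarrow> 'a letter list" where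
  "quot_word S \<alpha> \<beta> = map Gen \<alpha> \<otimes>\<^bsub>free S\<^esub> inv\<^bsub>free S\<^esub> (map Gen \<beta>)"

definition standard_form ::
  "('v, 'e, 'a) lspace \<Rightarrow> 'a list \<Rightarrow> 'a list \<Rightarrow> 'a fiword \<Rightarrow>
     ('v, 'a) idem set \<Rightarrow> ('v, 'a) idem set \<Rightarrow> bool" where
  "standard_form S \<alpha> \<beta> \<gamma> \<xi> \<eta> \<longleftrightarrow>
     \<alpha> \<in> labels S \<and> \<beta> \<in> labels S \<and> \<gamma> \<in> fiwords S \<and>
     \<xi> \<in> tight_at S (\<alpha> \<cdot>\<^sub>w \<gamma>) \<and> \<eta> \<in> tight_at S (\<beta> \<cdot>\<^sub>w \<gamma>) \<and>
     \<xi> \<in> phi_dom S (inv\<^bsub>free S\<^esub> (map Gen \<alpha>)) \<and> \<eta> \<in> phi_dom S (inv\<^bsub>free S\<^esub> (map Gen \<beta>)) \<and>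
     phi S (inv\<^bsub>free S\<^esub> (map Gen \<beta>)) \<eta> = phi S (inv\<^bsub>free S\<^esub> (map Gen \<alpha>)) \<xi>"

end

theory Submission
  imports Defs
begin

text \<open>Prepending a letter \<open>a\<close> to a filter and removing it again can be described for arbitrary filters,
  without reference to words: the first sends \<open>\<xi>\<close> to
  \<open>{(a\<nu>, A) : A \<subseteq> r(a\<nu>), (\<nu>, A) \<in> \<xi>} \<union> {(\<omega>, A) : (\<omega>, r(A, a)) \<in> \<xi>}\<close>, the second to
  \<open>{(\<nu>, C) : (a\<nu>, C \<inter> r(a\<nu>)) \<in> \<xi>}\<close>. These are mutually inverse monotone homeomorphisms between the
  clopen sets of filters containing \<open>(\<omega>, r(a))\<close> and \<open>(a, r(a))\<close>, so they preserve ultrafilters and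
  hence tight filters, and no characterisation of tight filters is needed. They agree with gluing and
  cutting, so \<open>H\<close> for \<open>\<alpha>\<close> is \<open>\<phi>\<close> for \<open>\<alpha>\<inverse>\<close>. The map \<open>\<Theta>\<close> replaces an element of the free group by its exponent
  sum; it is injective because a filter determines its word. Sets \<open>Z\<close> correspond to the open sets of arrows
  with fixed group element \<open>\<alpha>\<beta>\<inverse>\<close> and source in a basic set, and by continuity of \<open>\<phi>\<close> these form a basis.
  The groupoid axioms for \<open>\<Gamma>\<close> are transported along \<open>\<Theta>\<close>.\<close>

section \<open>Ranges and filters\<close>

text \<open>The maps \<phi> are attached to reduced words, but \<alpha>\<beta>\<inverse> may contain
  cancellation. Composing along the unreduced word gives a restriction of the map of the reduced
  word, in general to a smaller set of filters: it also demands that the source begins with \<beta>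
  and the target with \<alpha>. A set Z therefore prescribes more than a group element and a basic
  set of sources; that the domains of unreduced words are open as well is what turns this extra
  demand into an open condition. The other obstacle is the empty word. The vertex set r(\<omega>)
  need not belong to the family, and a filter need not have a member at level \<omega>, so \<omega>
  cannot be treated like a non-empty beginning. This is the source of most case
  distinctions.\<close>

context labelled_space
begin

lemma word_range_Nil [simp]: "word_range S [] = verts (graph S)"
  by (simp add: word_range_def rel_range_def)

lemma rel_range_Nil [simp]: "rel_range S A [] = A"
  by (simp add: rel_range_def)

lemma rel_range_mono: "A \<subseteq> B \<Longrightarrow> rel_range S A \<alpha> \<subseteq> rel_range S B \<alpha>"
  by (auto simp: rel_range_def)

lemma rel_range_empty [simp]: "rel_range S {} \<alpha> = {}"
  by (simp add: rel_range_def)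

text \<open>A walk labelled \<alpha>\<beta> splits at the vertex reached after its first |\<alpha>|
  edges. Empty words stand apart because \<open>rel_range\<close> returns A for them by convention,
  even where A has points that are not vertices.\<close>

lemma rel_range_append: "rel_range S A (\<alpha> @ \<beta>) = rel_range S (rel_range S A \<alpha>) \<beta>"
proof (cases "\<alpha> = [] \<or> \<beta> = []")
  case False
  have "v \<in> rel_range S A (\<alpha> @ \<beta>) \<longleftrightarrow> v \<in> rel_range S (rel_range S A \<alpha>) \<beta>" for v
  proof
    assume "v \<in> rel_range S A (\<alpha> @ \<beta>)"
    with False obtain u p where u: "u \<in> A" "awalk u p v" "map (label S) p = \<alpha> @ \<beta>"
      by (auto simp: rel_range_def)
    then obtain q r where p: "p = q @ r" "map (label S) q = \<alpha>" "map (label S) r = \<beta>"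
      by (auto simp: map_eq_append_conv)
    then have "awlast u q \<in> rel_range S A \<alpha>" "awalk (awlast u q) r v"
      using False u by (auto simp: rel_range_def)
    then show "v \<in> rel_range S (rel_range S A \<alpha>) \<beta>"
      using False p unfolding rel_range_def[of S _ \<beta>] by auto
  next
    assume "v \<in> rel_range S (rel_range S A \<alpha>) \<beta>"
    with False obtain u p w q where w: "u \<in> A" "awalk u p w" "map (label S) p = \<alpha>"
      "awalk w q v" "map (label S) q = \<beta>"
      by (auto simp: rel_range_def)
    moreover have "awlast u p = w"
      using w(2) by auto
    ultimately have "awalk u (p @ q) v" "map (label S) (p @ q) = \<alpha> @ \<beta>"
      by auto
    then have "\<exists>p. awalk u p v \<and> map (label S) p = \<alpha> @ \<beta>"
      by blast
    then show "v \<in> rel_range S A (\<alpha> @ \<beta>)"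
      using w False by (auto simp: rel_range_def simp del: map_append)
  qed
  then show ?thesis by blast
qed (auto simp: rel_range_def)

lemma rel_range_Cons: "rel_range S A (a # \<beta>) = rel_range S (rel_range S A [a]) \<beta>"
  using rel_range_append[of A "[a]" \<beta>] by simp

lemma word_range_append: "word_range S (\<alpha> @ \<beta>) = rel_range S (word_range S \<alpha>) \<beta>"
  by (simp add: word_range_def rel_range_append)

lemma word_range_Cons: "word_range S (a # \<beta>) = rel_range S (word_range S [a]) \<beta>"
  using word_range_append[of "[a]" \<beta>] by simp

lemma word_range_subset_verts: "word_range S \<alpha> \<subseteq> verts (graph S)"
  by (auto simp: word_range_def rel_range_def)

text \<open>The end of a walk labelled \<alpha>\<beta> is a walk labelled \<beta>. This lets a set
  over a longer word be reused after the beginning of the word has been cut off.\<close>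

lemma word_range_suffix: "word_range S (\<alpha> @ \<beta>) \<subseteq> word_range S \<beta>"
  unfolding word_range_append
  using rel_range_mono[OF word_range_subset_verts, of \<alpha> \<beta>] by (simp add: word_range_def)

text \<open>Expresses membership in \<open>labels S\<close> by a non-empty range, so that closure
  under beginnings and endings becomes a computation with ranges.\<close>

lemma word_range_nonempty_iff: "word_range S \<alpha> \<noteq> {} \<longleftrightarrow> \<alpha> \<in> labels S"
proof (cases "\<alpha> = []")
  case False
  have "word_range S \<alpha> \<noteq> {} \<longleftrightarrow>
      (\<exists>v. \<exists>u\<in>verts (graph S). \<exists>p. awalk u p v \<and> map (label S) p = \<alpha>)"
    using False by (simp add: word_range_def rel_range_def)
  also have "\<dots> \<longleftrightarrow> (\<exists>p u v. awalk u p v \<and> map (label S) p = \<alpha>)"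
    by (auto dest: awalk_hd_in_verts)
  also have "\<dots> \<longleftrightarrow> \<alpha> \<in> labels S"
    using False unfolding labels_def labels1_def by blast
  finally show ?thesis .
qed (simp add: verts_nonempty labels_def)

lemma labels_appendD2: "\<alpha> @ \<beta> \<in> labels S \<Longrightarrow> \<beta> \<in> labels S"
  using word_range_suffix[of \<alpha> \<beta>] by (auto simp flip: word_range_nonempty_iff)

lemma labels_appendD1: "\<alpha> @ \<beta> \<in> labels S \<Longrightarrow> \<alpha> \<in> labels S"
  by (auto simp: word_range_append simp flip: word_range_nonempty_iff)

lemma Nil_in_labels [simp]: "[] \<in> labels S"
  by (simp add: labels_def)

lemma labels_alphabet:
  assumes "\<alpha> \<in> labels S" shows "set \<alpha> \<subseteq> alphabet S"
proof (cases "\<alpha> = []")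
  case False
  with assms obtain p u v where "awalk u p v" "\<alpha> = map (label S) p"
    by (auto simp: labels_def labels1_def)
  then show ?thesis
    using label_surj by (auto elim!: awalkE')
qed simp

lemma word_range_in_family: "\<alpha> \<in> labels S \<Longrightarrow> \<alpha> \<noteq> [] \<Longrightarrow> word_range S \<alpha> \<in> family S"
  using family_range by (auto simp: labels_def)

text \<open>The vertex set need not belong to the family, so closure under intersections does not
  cover the empty word; there the intersection is A itself.\<close>

lemma Int_word_range_in_family:
  assumes "A \<in> family S" "\<alpha> \<in> labels S" shows "A \<inter> word_range S \<alpha> \<in> family S"
proof (cases "\<alpha> = []")
  case True
  with family_subset[OF assms(1)] assms(1) show ?thesis by (simp add: inf_absorb1)
qed (simp add: assms family_Int word_range_in_family)

lemma family_at_Nil [simp]: "family_at S [] = family S"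
  using family_subset by (auto simp: family_at_def)

lemma family_at_suffix: "family_at S (\<alpha> @ \<beta>) \<subseteq> family_at S \<beta>"
  using word_range_suffix by (fastforce simp: family_at_def)

lemma family_at_suffixD: "A \<in> family_at S (\<alpha> @ \<beta>) \<Longrightarrow> A \<in> family_at S \<beta>"
  using family_at_suffix by blast

lemma family_at_Cons_D: "A \<in> family_at S (a # \<beta>) \<Longrightarrow> A \<in> family_at S \<beta>"
  using family_at_suffix[of "[a]" \<beta>] by auto

lemma family_atD: "A \<in> family_at S \<alpha> \<Longrightarrow> A \<in> family S"
  by (simp add: family_at_def)

lemma family_at_labels: "A \<in> family_at S \<alpha> \<Longrightarrow> A \<noteq> {} \<Longrightarrow> \<alpha> \<in> labels S"
  by (auto simp: family_at_def simp flip: word_range_nonempty_iff)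

lemma rel_range_family_at:
  assumes "A \<in> family_at S \<alpha>" "\<alpha>' \<in> labels S"
  shows "rel_range S A \<alpha>' \<in> family_at S (\<alpha> @ \<alpha>')"
  using assms family_rel_range rel_range_mono
  by (auto simp: family_at_def word_range_append)

section \<open>Order and meets in the semilattice \<open>E(S)\<close>\<close>

lemma Some_in_idems: "Some (\<alpha>, A) \<in> carrier (idems S) \<longleftrightarrow> A \<noteq> {} \<and> A \<in> family_at S \<alpha>"
  using family_at_labels by (auto simp: idems_def)

lemma le_idems: "e \<sqsubseteq>\<^bsub>idems S\<^esub> f \<longleftrightarrow> idem_le S e f"
  by (simp add: idems_def)

lemma idem_le_antisym: "idem_le S e f \<Longrightarrow> idem_le S f e \<Longrightarrow> e = f"
  by (cases e; cases f) auto

lemma idem_le_Some_D: "idem_le S e (Some (\<alpha>, A)) \<Longrightarrow>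
    e = None \<or> (\<exists>\<alpha>' C. e = Some (\<alpha> @ \<alpha>', C) \<and> C \<subseteq> rel_range S A \<alpha>')"
  by (cases e) auto

text \<open>\<open>meet\<close> chooses among greatest lower bounds. Antisymmetry makes the choice
  unique, so exhibiting one greatest lower bound determines it.\<close>

lemma meet_idems_eqI:
  assumes "greatest (idems S) m (Lower (idems S) {e, f})"
  shows "e \<sqinter>\<^bsub>idems S\<^esub> f = m"
  unfolding meet_def inf_def
proof (rule some_equality)
  fix n assume "greatest (idems S) n (Lower (idems S) {e, f})"
  with assms show "n = m"
    by (intro idem_le_antisym) (auto simp: greatest_def le_idems)
qed (fact assms)

lemma meet_idems_commute: "e \<sqinter>\<^bsub>idems S\<^esub> f = f \<sqinter>\<^bsub>idems S\<^esub> e"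
  by (simp add: meet_def insert_commute)

text \<open>The word of a common non-zero lower bound would extend both \<alpha> and \<beta>, and
  two beginnings of one word are comparable.\<close>

lemma meet_idems_incomparable:
  assumes "Some (\<alpha>, A) \<in> carrier (idems S)" "Some (\<beta>, B) \<in> carrier (idems S)"
    and "\<nexists>\<alpha>'. \<beta> = \<alpha> @ \<alpha>'" "\<nexists>\<beta>'. \<alpha> = \<beta> @ \<beta>'"
  shows "Some (\<alpha>, A) \<sqinter>\<^bsub>idems S\<^esub> Some (\<beta>, B) = None"
proof (rule meet_idems_eqI)
  have "Lower (idems S) {Some (\<alpha>, A), Some (\<beta>, B)} = {None}"
  proof
    show "{None} \<subseteq> Lower (idems S) {Some (\<alpha>, A), Some (\<beta>, B)}"
      by (auto simp: Lower_def le_idems) (simp add: idems_def)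
    show "Lower (idems S) {Some (\<alpha>, A), Some (\<beta>, B)} \<subseteq> {None}"
    proof
      fix e assume "e \<in> Lower (idems S) {Some (\<alpha>, A), Some (\<beta>, B)}"
      with assms(1,2) have "idem_le S e (Some (\<alpha>, A))" "idem_le S e (Some (\<beta>, B))"
        by (auto simp: Lower_def le_idems)
      with assms(3,4) show "e \<in> {None}"
        by (cases e) (auto simp: append_eq_append_conv2)
    qed
  qed
  then show "greatest (idems S) None (Lower (idems S) {Some (\<alpha>, A), Some (\<beta>, B)})"
    by (simp add: greatest_def le_idems) (simp add: idems_def)
qed

end

context weakly_left_resolving
begin

lemma rel_range_Int':
  "A \<in> family S \<Longrightarrow> B \<in> family S \<Longrightarrow> \<alpha> \<in> labels S \<Longrightarrow>
    rel_range S (A \<inter> B) \<alpha> = rel_range S A \<alpha> \<inter> rel_range S B \<alpha>"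
  using rel_range_Int by (auto simp: labels_def)

text \<open>Weak left-resolution is what makes this lower bound the greatest: a lower bound with
  word \<alpha>\<alpha>'\<delta> lies in r(A,\<alpha>'\<delta>) and in r(B,\<delta>), whose
  intersection is r(r(A,\<alpha>') \<inter> B, \<delta>).\<close>

lemma meet_idems_append:
  assumes "Some (\<alpha>, A) \<in> carrier (idems S)" "Some (\<alpha> @ \<alpha>', B) \<in> carrier (idems S)"
  shows "Some (\<alpha>, A) \<sqinter>\<^bsub>idems S\<^esub> Some (\<alpha> @ \<alpha>', B) =
    (if rel_range S A \<alpha>' \<inter> B = {} then None else Some (\<alpha> @ \<alpha>', rel_range S A \<alpha>' \<inter> B))"
    (is "_ = ?m")
proof (rule meet_idems_eqI)
  from assms have A: "A \<in> family_at S \<alpha>" and B: "B \<in> family_at S (\<alpha> @ \<alpha>')" "B \<noteq> {}"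
    by (auto simp: Some_in_idems)
  then have labs: "\<alpha>' \<in> labels S"
    using family_at_labels labels_appendD2 by blast
  have AB: "rel_range S A \<alpha>' \<inter> B \<in> family_at S (\<alpha> @ \<alpha>')"
    using rel_range_family_at[OF A labs] B by (auto simp: family_at_def family_Int)
  have m_carrier: "?m \<in> carrier (idems S)"
    using AB by (auto simp: Some_in_idems) (simp add: idems_def)
  have m_lower: "?m \<in> Lower (idems S) {Some (\<alpha>, A), Some (\<alpha> @ \<alpha>', B)}"
    using m_carrier by (auto simp: Lower_def le_idems)
  have "idem_le S e ?m" if "e \<in> Lower (idems S) {Some (\<alpha>, A), Some (\<alpha> @ \<alpha>', B)}" for e
  proof (cases e)
    case (Some p)
    from that assms have "idem_le S e (Some (\<alpha>, A))" "idem_le S e (Some (\<alpha> @ \<alpha>', B))"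
      and e: "e \<in> carrier (idems S)"
      by (auto simp: Lower_def le_idems)
    with Some obtain \<delta> C where C: "e = Some (\<alpha> @ \<alpha>' @ \<delta>, C)"
      "C \<subseteq> rel_range S A (\<alpha>' @ \<delta>)" "C \<subseteq> rel_range S B \<delta>"
      by (auto dest!: idem_le_Some_D)
    with e have ne: "C \<noteq> {}" and "\<alpha> @ \<alpha>' @ \<delta> \<in> labels S"
      using family_at_labels by (auto simp: Some_in_idems)
    then have "\<delta> \<in> labels S"
      using labels_appendD2 by metis
    then have "C \<subseteq> rel_range S (rel_range S A \<alpha>' \<inter> B) \<delta>"
      using C A B labs by (simp add: rel_range_Int' family_rel_range family_at_def rel_range_append)
    with C ne show ?thesis by auto
  qed simp
  then show "greatest (idems S) ?m (Lower (idems S) {Some (\<alpha>, A), Some (\<alpha> @ \<alpha>', B)})"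
    using m_lower by (auto simp: greatest_def le_idems Lower_def)
qed

section \<open>Filters described by words and sets\<close>

lemma filter_in_family:
  assumes "idem_filter S \<xi>" "Some (\<alpha>, A) \<in> \<xi>"
  shows "A \<noteq> {}" "A \<in> family_at S \<alpha>" "\<alpha> \<in> labels S" "A \<in> family S"
proof -
  have "Some (\<alpha>, A) \<in> carrier (idems S)"
    using assms by (auto simp: idem_filter_def)
  then show "A \<noteq> {}" "A \<in> family_at S \<alpha>"
    by (simp_all add: Some_in_idems)
  then show "\<alpha> \<in> labels S" "A \<in> family S"
    by (simp_all add: family_at_labels family_atD)
qed

text \<open>A filter omits 0, which is the meet of two idempotents with incomparable words. This is
  why a filter can have a word at all.\<close>

lemma filter_comparable:
  assumes "idem_filter S \<xi>" "Some (\<alpha>, A) \<in> \<xi>" "Some (\<beta>, B) \<in> \<xi>"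
  shows "(\<exists>\<alpha>'. \<beta> = \<alpha> @ \<alpha>') \<or> (\<exists>\<beta>'. \<alpha> = \<beta> @ \<beta>')"
proof (rule ccontr)
  assume "\<not> ?thesis"
  then have "Some (\<alpha>, A) \<sqinter>\<^bsub>idems S\<^esub> Some (\<beta>, B) = None"
    using assms by (intro meet_idems_incomparable) (auto simp: idem_filter_def)
  with assms show False
    by (metis idem_filter_def)
qed

lemma filter_meet:
  assumes "idem_filter S \<xi>" "Some (\<alpha>, A) \<in> \<xi>" "Some (\<alpha> @ \<alpha>', B) \<in> \<xi>"
  shows "Some (\<alpha> @ \<alpha>', rel_range S A \<alpha>' \<inter> B) \<in> \<xi>"
proof -
  have "Some (\<alpha>, A) \<sqinter>\<^bsub>idems S\<^esub> Some (\<alpha> @ \<alpha>', B) \<in> \<xi>" "None \<notin> \<xi>"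
    using assms unfolding idem_filter_def by blast+
  moreover have "Some (\<alpha>, A) \<in> carrier (idems S)" "Some (\<alpha> @ \<alpha>', B) \<in> carrier (idems S)"
    using assms by (auto simp: idem_filter_def)
  ultimately show ?thesis
    by (auto simp: meet_idems_append split: if_splits)
qed

lemma filter_up:
  assumes "idem_filter S \<xi>" "Some (\<alpha> @ \<alpha>', B) \<in> \<xi>" "A \<in> family_at S \<alpha>" "B \<subseteq> rel_range S A \<alpha>'"
  shows "Some (\<alpha>, A) \<in> \<xi>"
proof -
  have "A \<noteq> {}"
    using filter_in_family(1)[OF assms(1,2)] assms(4) by auto
  with assms(3) have "Some (\<alpha>, A) \<in> carrier (idems S)"
    by (simp add: Some_in_idems)
  moreover have "idem_le S (Some (\<alpha> @ \<alpha>', B)) (Some (\<alpha>, A))"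
    using assms(4) by simp
  ultimately show ?thesis
    using assms(1,2) unfolding idem_filter_def le_idems by blast
qed

text \<open>Once the words of the members are comparable, every meet is of the kind computed by
  \<open>meet_idems_append\<close>. The filter conditions then concern only a word and a
  continuation of it.\<close>

lemma idem_filterI:
  assumes "\<xi> \<noteq> {}" "None \<notin> \<xi>"
    and mem: "\<And>\<alpha> A. Some (\<alpha>, A) \<in> \<xi> \<Longrightarrow> A \<noteq> {} \<and> A \<in> family_at S \<alpha>"
    and up: "\<And>\<alpha> \<alpha>' A B. Some (\<alpha> @ \<alpha>', B) \<in> \<xi> \<Longrightarrow> A \<in> family_at S \<alpha> \<Longrightarrow>
      B \<subseteq> rel_range S A \<alpha>' \<Longrightarrow> Some (\<alpha>, A) \<in> \<xi>"
    and comp: "\<And>\<alpha> \<beta> A B. Some (\<alpha>, A) \<in> \<xi> \<Longrightarrow> Some (\<beta>, B) \<in> \<xi> \<Longrightarrow>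
      (\<exists>\<alpha>'. \<beta> = \<alpha> @ \<alpha>') \<or> (\<exists>\<beta>'. \<alpha> = \<beta> @ \<beta>')"
    and meet: "\<And>\<alpha> \<alpha>' A B. Some (\<alpha>, A) \<in> \<xi> \<Longrightarrow> Some (\<alpha> @ \<alpha>', B) \<in> \<xi> \<Longrightarrow>
      Some (\<alpha> @ \<alpha>', rel_range S A \<alpha>' \<inter> B) \<in> \<xi>"
  shows "idem_filter S \<xi>"
proof -
  have sub: "\<xi> \<subseteq> carrier (idems S)"
  proof
    fix e assume "e \<in> \<xi>"
    with assms(2) mem show "e \<in> carrier (idems S)"
      by (cases e) (auto simp: Some_in_idems)
  qed
  \<comment> \<open>\<open>meet\<close> puts the intersection into \<xi> and \<open>mem\<close>
    makes it non-empty, so the meet is not 0.\<close>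
  have pre: "Some (\<alpha>, A) \<sqinter>\<^bsub>idems S\<^esub> Some (\<alpha> @ \<alpha>', B) \<in> \<xi>"
    if "Some (\<alpha>, A) \<in> \<xi>" "Some (\<alpha> @ \<alpha>', B) \<in> \<xi>" for \<alpha> \<alpha>' A B
    using meet[OF that] mem[OF meet[OF that]] sub that by (subst meet_idems_append) auto
  have "e \<sqinter>\<^bsub>idems S\<^esub> f \<in> \<xi>" if "e \<in> \<xi>" "f \<in> \<xi>" for e f
  proof -
    from that assms(2) obtain \<alpha> A \<beta> B where "e = Some (\<alpha>, A)" "f = Some (\<beta>, B)"
      by (metis option.exhaust surj_pair)
    with that comp[of \<alpha> A \<beta> B] pre[of \<alpha> A _ B] pre[of \<beta> B _ A] show ?thesis
      by (auto simp: meet_idems_commute[of "Some (\<alpha>, A)"])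
  qed
  moreover have "f \<in> \<xi>" if "e \<in> \<xi>" "f \<in> carrier (idems S)" "idem_le S e f" for e f
  proof (cases f)
    case None
    with that assms(2) show ?thesis by (cases e) auto
  next
    case (Some p)
    with that assms(2) show ?thesis
      by (cases p) (auto dest!: idem_le_Some_D simp: Some_in_idems intro: up)
  qed
  ultimately show ?thesis
    using assms(1,2) sub by (simp add: idem_filter_def le_idems)
qed

text \<open>Membership of A can be tested at any later level that the filter reaches: meeting with
  the given B there yields one direction, upward closure the other. The gluing formulas are tests of
  this kind.\<close>

lemma filter_range_iff:
  assumes "idem_filter S \<xi>" "Some (\<alpha> @ \<alpha>', B) \<in> \<xi>" "A \<in> family_at S \<alpha>"
  shows "Some (\<alpha> @ \<alpha>', rel_range S A \<alpha>') \<in> \<xi> \<longleftrightarrow> Some (\<alpha>, A) \<in> \<xi>"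
proof
  assume "Some (\<alpha>, A) \<in> \<xi>"
  note meet = filter_meet[OF assms(1) this assms(2)]
  have "\<alpha>' \<in> labels S"
    using filter_in_family(3)[OF assms(1,2)] labels_appendD2 by blast
  then have "rel_range S A \<alpha>' \<in> family_at S (\<alpha> @ \<alpha>')"
    using assms(3) rel_range_family_at by blast
  with meet show "Some (\<alpha> @ \<alpha>', rel_range S A \<alpha>') \<in> \<xi>"
    using filter_up[OF assms(1), of "\<alpha> @ \<alpha>'" "[]"] by simp
qed (use assms filter_up in blast)

lemma filter_mono:
  assumes "idem_filter S \<xi>" "Some (\<alpha>, B) \<in> \<xi>" "A \<in> family_at S \<alpha>" "B \<subseteq> A"
  shows "Some (\<alpha>, A) \<in> \<xi>"
  using filter_up[OF assms(1), of \<alpha> "[]" B A] assms by simp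

lemma filter_Int:
  assumes "idem_filter S \<xi>" "Some (\<alpha>, A) \<in> \<xi>" "Some (\<alpha>, B) \<in> \<xi>"
  shows "Some (\<alpha>, A \<inter> B) \<in> \<xi>"
  using filter_meet[OF assms(1), of \<alpha> A "[]" B] assms by simp

lemma filter_word_range:
  assumes "idem_filter S \<xi>" "Some (\<alpha> @ \<alpha>', A) \<in> \<xi>" "\<alpha> \<noteq> []"
  shows "Some (\<alpha>, word_range S \<alpha>) \<in> \<xi>"
proof (rule filter_up[OF assms(1,2)])
  have "\<alpha> \<in> labels S"
    using filter_in_family(3)[OF assms(1,2)] labels_appendD1 by blast
  with assms(3) show "word_range S \<alpha> \<in> family_at S \<alpha>"
    by (simp add: family_at_def word_range_in_family)
  show "A \<subseteq> rel_range S (word_range S \<alpha>) \<alpha>'"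
    using filter_in_family(2)[OF assms(1,2)] by (simp add: family_at_def word_range_append)
qed

end

section \<open>Removing a beginning and prepending a letter\<close>

text \<open>\<open>cut\<close> asks for some D below C. Such a D lies in r(\<alpha>\<nu>), so by
  upward closure the single candidate C \<inter> r(\<alpha>\<nu>) decides, and the word of the
  filter does not enter.\<close>

definition filter_drop ::
  "('v, 'e, 'a) lspace \<Rightarrow> 'a list \<Rightarrow> ('v, 'a) idem set \<Rightarrow> ('v, 'a) idem set" where
  "filter_drop S \<alpha> \<xi> =
     {Some (\<nu>, C) | \<nu> C. C \<in> family_at S \<nu> \<and> Some (\<alpha> @ \<nu>, C \<inter> word_range S (\<alpha> @ \<nu>)) \<in> \<xi>}"

text \<open>\<omega> is the only beginning of a\<gamma> that does not start with a, hence the second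
  clause. It covers level 0 of both gluing formulas, for empty and for non-empty \<beta>.\<close>

definition filter_cons ::
  "('v, 'e, 'a) lspace \<Rightarrow> 'a \<Rightarrow> ('v, 'a) idem set \<Rightarrow> ('v, 'a) idem set" where
  "filter_cons S a \<xi> =
     {Some (a # \<nu>, A) | \<nu> A. A \<in> family_at S (a # \<nu>) \<and> Some (\<nu>, A) \<in> \<xi>} \<union>
     {Some ([], A) | A. A \<in> family S \<and> Some ([], rel_range S A [a]) \<in> \<xi>}"

context weakly_left_resolving
begin

lemma in_filter_drop:
  "Some (\<nu>, C) \<in> filter_drop S \<alpha> \<xi> \<longleftrightarrow>
     C \<in> family_at S \<nu> \<and> Some (\<alpha> @ \<nu>, C \<inter> word_range S (\<alpha> @ \<nu>)) \<in> \<xi>"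
  "None \<notin> filter_drop S \<alpha> \<xi>"
  by (auto simp: filter_drop_def)

lemma in_filter_cons:
  "Some (a # \<nu>, A) \<in> filter_cons S b \<xi> \<longleftrightarrow> a = b \<and> A \<in> family_at S (a # \<nu>) \<and> Some (\<nu>, A) \<in> \<xi>"
  "Some ([], A) \<in> filter_cons S b \<xi> \<longleftrightarrow> A \<in> family S \<and> Some ([], rel_range S A [b]) \<in> \<xi>"
  "None \<notin> filter_cons S b \<xi>"
  by (auto simp: filter_cons_def)

lemma filter_drop_mono: "\<xi> \<subseteq> \<eta> \<Longrightarrow> filter_drop S \<alpha> \<xi> \<subseteq> filter_drop S \<alpha> \<eta>"
  by (auto simp: filter_drop_def)

lemma filter_cons_mono: "\<xi> \<subseteq> \<eta> \<Longrightarrow> filter_cons S a \<xi> \<subseteq> filter_cons S a \<eta>"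
  by (auto simp: filter_cons_def)

lemma filter_drop_Nil:
  assumes "idem_filter S \<xi>" shows "filter_drop S [] \<xi> = \<xi>"
proof (rule Set.set_eqI)
  fix e show "e \<in> filter_drop S [] \<xi> \<longleftrightarrow> e \<in> \<xi>"
  proof (cases e)
    case None then show ?thesis using assms by (simp add: in_filter_drop idem_filter_def)
  next
    case (Some p)
    obtain \<nu> C where "p = (\<nu>, C)" by fastforce
    moreover have "C \<inter> word_range S \<nu> = C" if "C \<in> family_at S \<nu>"
      using that by (auto simp: family_at_def)
    ultimately show ?thesis
      using Some filter_in_family(2)[OF assms] by (auto simp: in_filter_drop)
  qed
qed

text \<open>The intersection with r(\<beta>\<nu>) made in the second stage is absorbed, as
  r(\<alpha>\<beta>\<nu>) lies in r(\<beta>\<nu>).\<close>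

lemma filter_drop_append:
  assumes "idem_filter S \<xi>"
  shows "filter_drop S \<beta> (filter_drop S \<alpha> \<xi>) = filter_drop S (\<alpha> @ \<beta>) \<xi>"
proof -
  have "Some (\<beta> @ \<nu>, C \<inter> word_range S (\<beta> @ \<nu>)) \<in> filter_drop S \<alpha> \<xi> \<longleftrightarrow>
      Some (\<alpha> @ \<beta> @ \<nu>, C \<inter> word_range S (\<alpha> @ \<beta> @ \<nu>)) \<in> \<xi>" if C: "C \<in> family_at S \<nu>" for \<nu> C
  proof -
    have "C \<inter> word_range S (\<beta> @ \<nu>) \<in> family_at S (\<beta> @ \<nu>)"
      if "Some (\<alpha> @ \<beta> @ \<nu>, C \<inter> word_range S (\<alpha> @ \<beta> @ \<nu>)) \<in> \<xi>"
      using filter_in_family(3)[OF assms that] labels_appendD2 C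
      by (auto simp: family_at_def Int_word_range_in_family)
    moreover have "C \<inter> word_range S (\<beta> @ \<nu>) \<inter> word_range S (\<alpha> @ \<beta> @ \<nu>) = C \<inter> word_range S (\<alpha> @ \<beta> @ \<nu>)"
      using word_range_suffix[of \<alpha> "\<beta> @ \<nu>"] by blast
    ultimately show ?thesis by (auto simp: in_filter_drop)
  qed
  then show ?thesis
    by (auto simp: filter_drop_def[of S \<beta>] filter_drop_def[of S "\<alpha> @ \<beta>"])
qed

lemma idem_filter_drop:
  assumes \<xi>: "idem_filter S \<xi>" and \<alpha>: "Some (\<alpha>, word_range S \<alpha>) \<in> \<xi>"
  shows "idem_filter S (filter_drop S \<alpha> \<xi>)"
proof (rule idem_filterI)
  have "Some ([], word_range S \<alpha>) \<in> filter_drop S \<alpha> \<xi>"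
    using filter_in_family(4)[OF \<xi> \<alpha>] \<alpha> by (simp add: in_filter_drop)
  then show "filter_drop S \<alpha> \<xi> \<noteq> {}" by auto
next
  show "C \<noteq> {} \<and> C \<in> family_at S \<nu>" if "Some (\<nu>, C) \<in> filter_drop S \<alpha> \<xi>" for \<nu> C
    using that filter_in_family(1)[OF \<xi>] by (fastforce simp: in_filter_drop)
next
  fix \<nu> \<nu>' C D
  assume "Some (\<nu> @ \<nu>', D) \<in> filter_drop S \<alpha> \<xi>" and C: "C \<in> family_at S \<nu>" "D \<subseteq> rel_range S C \<nu>'"
  then have D: "Some ((\<alpha> @ \<nu>) @ \<nu>', D \<inter> word_range S (\<alpha> @ \<nu> @ \<nu>')) \<in> \<xi>"
    by (simp add: in_filter_drop)
  then have labs: "\<alpha> @ \<nu> \<in> labels S" "\<nu>' \<in> labels S"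
    using filter_in_family(3)[OF \<xi>] labels_appendD1 labels_appendD2 by blast+
  \<comment> \<open>Weak left-resolution gives r(C \<inter> r(\<alpha>\<nu>), \<nu>') = r(C,\<nu>')
    \<inter> r(\<alpha>\<nu>\<nu>') when r(\<alpha>\<nu>) is in the family. For empty \<alpha>\<nu>
    the intersection with all vertices changes nothing.\<close>
  have "D \<inter> word_range S ((\<alpha> @ \<nu>) @ \<nu>') \<subseteq> rel_range S (C \<inter> word_range S (\<alpha> @ \<nu>)) \<nu>'"
  proof (cases "\<alpha> @ \<nu> = []")
    case True
    have "C \<inter> word_range S (\<alpha> @ \<nu>) = C" using True C family_subset by (auto simp: family_at_def)
    with C show ?thesis by auto
  next
    case False
    then show ?thesis
      unfolding word_range_append[of "\<alpha> @ \<nu>" \<nu>']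
      using C labs word_range_in_family[of "\<alpha> @ \<nu>"]
      by (subst rel_range_Int') (auto simp: family_at_def)
  qed
  moreover have "C \<inter> word_range S (\<alpha> @ \<nu>) \<in> family_at S (\<alpha> @ \<nu>)"
    using C labs by (auto simp: family_at_def Int_word_range_in_family)
  ultimately have "Some (\<alpha> @ \<nu>, C \<inter> word_range S (\<alpha> @ \<nu>)) \<in> \<xi>"
    using filter_up[OF \<xi> D] by simp
  with C show "Some (\<nu>, C) \<in> filter_drop S \<alpha> \<xi>"
    by (simp add: in_filter_drop)
next
  fix \<mu> \<nu> C D
  assume "Some (\<mu>, C) \<in> filter_drop S \<alpha> \<xi>" "Some (\<nu>, D) \<in> filter_drop S \<alpha> \<xi>"
  then show "(\<exists>\<mu>'. \<nu> = \<mu> @ \<mu>') \<or> (\<exists>\<nu>'. \<mu> = \<nu> @ \<nu>')"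
    using filter_comparable[OF \<xi>, of "\<alpha> @ \<mu>" _ "\<alpha> @ \<nu>"] by (auto simp: in_filter_drop)
next
  fix \<nu> \<nu>' C D
  assume *: "Some (\<nu>, C) \<in> filter_drop S \<alpha> \<xi>" "Some (\<nu> @ \<nu>', D) \<in> filter_drop S \<alpha> \<xi>"
  then have C: "Some (\<alpha> @ \<nu>, C \<inter> word_range S (\<alpha> @ \<nu>)) \<in> \<xi>" "C \<in> family_at S \<nu>"
    and D: "Some ((\<alpha> @ \<nu>) @ \<nu>', D \<inter> word_range S (\<alpha> @ \<nu> @ \<nu>')) \<in> \<xi>" "D \<in> family_at S (\<nu> @ \<nu>')"
    by (auto simp: in_filter_drop)
  then have labs: "\<alpha> @ \<nu> @ \<nu>' \<in> labels S" "\<nu>' \<in> labels S"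
    using filter_in_family(3)[OF \<xi> D(1)] labels_appendD2[of "\<alpha> @ \<nu>" \<nu>'] by simp_all
  have CD: "rel_range S C \<nu>' \<inter> D \<in> family_at S (\<nu> @ \<nu>')"
    using C(2) D(2) labs by (auto simp: family_at_def family_Int family_rel_range)
  have "Some ((\<alpha> @ \<nu>) @ \<nu>', rel_range S (C \<inter> word_range S (\<alpha> @ \<nu>)) \<nu>' \<inter> (D \<inter> word_range S (\<alpha> @ \<nu> @ \<nu>'))) \<in> \<xi>"
    using filter_meet[OF \<xi> C(1) D(1)] .
  \<comment> \<open>Monotonicity of r is enough here, since a filter member may be replaced by a
    larger set.\<close>
  then have "Some ((\<alpha> @ \<nu>) @ \<nu>', (rel_range S C \<nu>' \<inter> D) \<inter> word_range S (\<alpha> @ \<nu> @ \<nu>')) \<in> \<xi>"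
    using filter_mono[OF \<xi>, of "(\<alpha> @ \<nu>) @ \<nu>'" _ "(rel_range S C \<nu>' \<inter> D) \<inter> word_range S (\<alpha> @ \<nu> @ \<nu>')"]
      rel_range_mono[of "C \<inter> word_range S (\<alpha> @ \<nu>)" C \<nu>'] CD labs
    by (fastforce simp: family_at_def Int_word_range_in_family)
  with CD show "Some (\<nu> @ \<nu>', rel_range S C \<nu>' \<inter> D) \<in> filter_drop S \<alpha> \<xi>"
    by (simp add: in_filter_drop)
qed (simp add: in_filter_drop)

lemma filter_cons_cases:
  assumes "Some (\<mu>, A) \<in> filter_cons S a \<xi>"
  obtains (Nil) "\<mu> = []" "A \<in> family S" "Some ([], rel_range S A [a]) \<in> \<xi>"
  | (Cons) \<nu> where "\<mu> = a # \<nu>" "A \<in> family_at S (a # \<nu>)" "Some (\<nu>, A) \<in> \<xi>"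
  using assms by (auto simp: filter_cons_def)

text \<open>The level \<omega> carries the content. Upward closure to it from a\<nu> uses
  r(A,a\<nu>) = r(r(A,a),\<nu>), and meets within it use r(A \<inter> B,a) = r(A,a) \<inter>
  r(B,a).\<close>

lemma idem_filter_cons:
  assumes \<xi>: "idem_filter S \<xi>" and a: "Some ([], word_range S [a]) \<in> \<xi>"
  shows "idem_filter S (filter_cons S a \<xi>)"
proof (rule idem_filterI)
  have a_labels: "[a] \<in> labels S"
    using filter_in_family(1)[OF \<xi> a] word_range_nonempty_iff by auto
  have "Some ([a], word_range S [a]) \<in> filter_cons S a \<xi>"
    using filter_in_family(4)[OF \<xi> a] a by (simp add: in_filter_cons family_at_def)
  then show "filter_cons S a \<xi> \<noteq> {}" by auto
  show "A \<noteq> {} \<and> A \<in> family_at S \<mu>" if "Some (\<mu>, A) \<in> filter_cons S a \<xi>" for \<mu> A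
    using that by (cases rule: filter_cons_cases) (use filter_in_family(1)[OF \<xi>] in fastforce)+
  show "Some (\<mu>, A) \<in> filter_cons S a \<xi>"
    if *: "Some (\<mu> @ \<mu>', B) \<in> filter_cons S a \<xi>" "A \<in> family_at S \<mu>" "B \<subseteq> rel_range S A \<mu>'" for \<mu> \<mu>' A B
    using that(1)
  proof (cases rule: filter_cons_cases)
    case Nil
    then have "rel_range S B [a] \<subseteq> rel_range S A [a]" "rel_range S A [a] \<in> family S"
      using * a_labels rel_range_mono[of B A] by (auto intro: family_rel_range)
    with Nil have "Some ([], rel_range S A [a]) \<in> \<xi>"
      using filter_mono[OF \<xi>] by fastforce
    with Nil * show ?thesis by (simp add: in_filter_cons)
  next
    case (Cons \<nu>)
    show ?thesis
    proof (cases \<mu>)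
      case Nil
      with Cons * have "B \<subseteq> rel_range S (rel_range S A [a]) \<nu>" "rel_range S A [a] \<in> family S"
        using a_labels by (auto simp: rel_range_Cons[of A a \<nu>] intro: family_rel_range)
      with Cons have "Some ([], rel_range S A [a]) \<in> \<xi>"
        using filter_up[OF \<xi>, of "[]" \<nu>] by simp
      with Nil * show ?thesis by (simp add: in_filter_cons)
    next
      case (Cons b \<mu>1)
      with \<open>\<mu> @ \<mu>' = a # \<nu>\<close> have "b = a" "\<nu> = \<mu>1 @ \<mu>'" by auto
      with \<open>Some (\<nu>, B) \<in> \<xi>\<close> * Cons have "Some (\<mu>1, A) \<in> \<xi>"
        using filter_up[OF \<xi>, of \<mu>1 \<mu>' B A] family_at_Cons_D by blast
      with Cons * \<open>b = a\<close> show ?thesis by (simp add: in_filter_cons)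
    qed
  qed
  show "(\<exists>\<mu>'. \<nu> = \<mu> @ \<mu>') \<or> (\<exists>\<nu>'. \<mu> = \<nu> @ \<nu>')"
    if "Some (\<mu>, A) \<in> filter_cons S a \<xi>" "Some (\<nu>, B) \<in> filter_cons S a \<xi>" for \<mu> \<nu> A B
    using that(1)
  proof (cases rule: filter_cons_cases)
    case \<mu>: (Cons \<mu>')
    from that(2) show ?thesis
    proof (cases rule: filter_cons_cases)
      case (Cons \<nu>')
      with \<mu> filter_comparable[OF \<xi> \<mu>(3) Cons(3)] show ?thesis by auto
    qed simp
  qed simp
  show "Some (\<mu> @ \<mu>', rel_range S A \<mu>' \<inter> B) \<in> filter_cons S a \<xi>"
    if A: "Some (\<mu>, A) \<in> filter_cons S a \<xi>" and B: "Some (\<mu> @ \<mu>', B) \<in> filter_cons S a \<xi>" for \<mu> \<mu>' A B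
    using A
  proof (cases rule: filter_cons_cases)
    case Nil
    note A' = this
    from B show ?thesis
    proof (cases rule: filter_cons_cases)
      case Nil
      then show ?thesis
        using A' filter_Int[OF \<xi> A'(3) Nil(3)] a_labels
        by (simp add: in_filter_cons rel_range_Int' family_Int)
    next
      case (Cons \<nu>)
      then have "Some (\<nu>, rel_range S (rel_range S A [a]) \<nu> \<inter> B) \<in> \<xi>"
        using A' filter_meet[OF \<xi>, of "[]" _ \<nu>] by simp
      then have "Some (\<nu>, rel_range S A (a # \<nu>) \<inter> B) \<in> \<xi>"
        by (simp add: rel_range_Cons[of A a \<nu>])
      with A' Cons filter_in_family(4)[OF \<xi> this] show ?thesis
        by (auto simp: in_filter_cons family_at_def)
    qed
  next
    case (Cons \<nu>)
    with B have "B \<in> family_at S (a # \<nu> @ \<mu>')" "Some (\<nu> @ \<mu>', B) \<in> \<xi>"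
      by (auto simp: in_filter_cons)
    with Cons have "Some (\<nu> @ \<mu>', rel_range S A \<mu>' \<inter> B) \<in> \<xi>"
      using filter_meet[OF \<xi>] by blast
    with Cons \<open>B \<in> family_at S (a # \<nu> @ \<mu>')\<close> filter_in_family(4)[OF \<xi> this] show ?thesis
      by (auto simp: in_filter_cons family_at_def)
  qed
qed (simp add: in_filter_cons)

lemma filter_cons_contains:
  assumes "idem_filter S \<xi>" "Some ([], word_range S [a]) \<in> \<xi>"
  shows "Some ([a], word_range S [a]) \<in> filter_cons S a \<xi>"
  using filter_in_family(4)[OF assms] assms(2) by (simp add: in_filter_cons family_at_def)

lemma filter_drop_contains:
  assumes "idem_filter S \<xi>" "Some (\<alpha>, word_range S \<alpha>) \<in> \<xi>"
  shows "Some ([], word_range S \<alpha>) \<in> filter_drop S \<alpha> \<xi>"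
  using filter_in_family(4)[OF assms] assms(2) by (simp add: in_filter_drop)

text \<open>Restriction to r(a\<nu>) loses nothing: meeting (\<nu>,C) with (\<omega>,r(a)) yields
  (\<nu>, C \<inter> r(a\<nu>)), and upward closure leads back.\<close>

lemma drop_cons:
  assumes \<xi>: "idem_filter S \<xi>" and a: "Some ([], word_range S [a]) \<in> \<xi>"
  shows "filter_drop S [a] (filter_cons S a \<xi>) = \<xi>"
proof (rule Set.set_eqI)
  fix e show "e \<in> filter_drop S [a] (filter_cons S a \<xi>) \<longleftrightarrow> e \<in> \<xi>"
  proof (cases e)
    case None then show ?thesis using \<xi> by (simp add: in_filter_drop idem_filter_def)
  next
    case (Some p)
    obtain \<nu> C where p: "p = (\<nu>, C)" by fastforce
    have "Some (\<nu>, C \<inter> word_range S (a # \<nu>)) \<in> \<xi> \<and> C \<inter> word_range S (a # \<nu>) \<in> family_at S (a # \<nu>)"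
      if "Some (\<nu>, C) \<in> \<xi>"
      using filter_meet[OF \<xi> a, of \<nu> C] that filter_in_family(4)[OF \<xi>, of \<nu> "C \<inter> word_range S (a # \<nu>)"]
      by (simp add: Int_commute family_at_def flip: word_range_Cons[of a \<nu>])
    moreover have "Some (\<nu>, C) \<in> \<xi>"
      if "C \<in> family_at S \<nu>" "Some (\<nu>, C \<inter> word_range S (a # \<nu>)) \<in> \<xi>"
      using filter_mono[OF \<xi> that(2,1)] by simp
    ultimately show ?thesis
      using Some p filter_in_family(2)[OF \<xi>, of \<nu> C]
      by (auto simp: in_filter_drop in_filter_cons)
  qed
qed

text \<open>At level \<omega> the member (a,r(a)) makes \<open>filter_range_iff\<close> applicable,
  so A at level \<omega> and r(A,a) at level a occur together. At the other levels comparability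
  with a forces the first letter.\<close>

lemma cons_drop:
  assumes \<xi>: "idem_filter S \<xi>" and a: "Some ([a], word_range S [a]) \<in> \<xi>"
  shows "filter_cons S a (filter_drop S [a] \<xi>) = \<xi>"
proof (rule Set.set_eqI)
  have a_labels: "[a] \<in> labels S"
    using filter_in_family(3)[OF \<xi> a] .
  fix e show "e \<in> filter_cons S a (filter_drop S [a] \<xi>) \<longleftrightarrow> e \<in> \<xi>"
  proof (cases e)
    case None then show ?thesis using \<xi> by (simp add: in_filter_cons idem_filter_def)
  next
    case (Some p)
    obtain \<mu> A where p: "p = (\<mu>, A)" by fastforce
    show ?thesis
    proof (cases \<mu>)
      case Nil
      have "rel_range S A [a] \<inter> word_range S [a] = rel_range S A [a]" if "A \<in> family S"
        using rel_range_mono[OF family_subset[OF that], of "[a]"] by (auto simp: word_range_def)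
      then show ?thesis
        using Some p Nil filter_in_family(4)[OF \<xi>] a_labels family_rel_range
          filter_range_iff[OF \<xi>, of "[]" "[a]" "word_range S [a]" A] a
        by (auto simp: in_filter_drop in_filter_cons)
    next
      case (Cons b \<nu>)
      have "b = a" if "e \<in> \<xi>"
        using filter_comparable[OF \<xi> a, of \<mu> A] that Some p Cons by (auto simp: Cons_eq_append_conv)
      moreover have "A \<inter> word_range S (a # \<nu>) = A" "A \<in> family_at S \<nu>" if "A \<in> family_at S (a # \<nu>)"
        using that family_at_Cons_D[OF that] by (auto simp: family_at_def)
      ultimately show ?thesis
        using Some p Cons filter_in_family(2)[OF \<xi>]
        by (auto simp: in_filter_drop in_filter_cons)
    qed
  qed
qed

end

section \<open>The topology of the filter space\<close>

lemma topspace_filter_space: "topspace (filter_space S) = {\<xi>. idem_filter S \<xi>}"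
  by (auto simp: filter_space_def topspace_pullback_topology)

text \<open>The truth value b treats membership and its negation together, which makes these sets
  clopen. For e outside the semilattice the condition is constant on filters.\<close>

lemma openin_filter_space_mem:
  fixes S :: "('v, 'e, 'a) lspace"
  shows "openin (filter_space S) {\<xi>. idem_filter S \<xi> \<and> (e \<in> \<xi> \<longleftrightarrow> b)}"
proof (cases "e \<in> carrier (idems S)")
  case True
  let ?P = "product_topology (\<lambda>_. discrete_topology (UNIV :: bool set)) (carrier (idems S))"
  have "openin ?P {f \<in> topspace ?P. f e \<in> {b}}"
    using True by (intro openin_continuous_map_preimage[OF continuous_map_product_projection]) auto
  moreover have "{\<xi>. idem_filter S \<xi> \<and> (e \<in> \<xi> \<longleftrightarrow> b)} =
      (\<lambda>\<xi>. \<lambda>e\<in>carrier (idems S). e \<in> \<xi>) -` {f \<in> topspace ?P. f e \<in> {b}} \<inter> {\<xi>. idem_filter S \<xi>}"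
    using True by auto
  ultimately show ?thesis
    unfolding filter_space_def openin_pullback_topology by blast
next
  case False
  then have "e \<notin> \<xi>" if "idem_filter S \<xi>" for \<xi>
    using that by (auto simp: idem_filter_def)
  then have "{\<xi>. idem_filter S \<xi> \<and> (e \<in> \<xi> \<longleftrightarrow> b)} = (if b then {} else topspace (filter_space S))"
    by (auto simp: topspace_filter_space)
  then show ?thesis
    by (simp only: openin_empty openin_topspace simp_thms split: if_split)
qed

text \<open>For each e, membership is a map into a two-point discrete space, so its continuity
  reduces to openness of the two fibres.\<close>

lemma continuous_map_filter_space:
  assumes "\<And>x. x \<in> topspace X \<Longrightarrow> idem_filter S (f x)"
    and mem: "\<And>e b. openin X {x \<in> topspace X. e \<in> f x \<longleftrightarrow> b}"
  shows "continuous_map X (filter_space S) f"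
  unfolding filter_space_def
proof (rule continuous_map_pullback')
  have "continuous_map X (discrete_topology UNIV) (\<lambda>x. e \<in> f x)" for e
  proof -
    have "openin X {x \<in> topspace X. (e \<in> f x) \<in> U}" for U
    proof -
      have "{x \<in> topspace X. (e \<in> f x) \<in> U} = (\<Union>b\<in>U. {x \<in> topspace X. e \<in> f x \<longleftrightarrow> b})"
        by auto
      then show ?thesis using mem by auto
    qed
    then show ?thesis by (simp add: continuous_map_def)
  qed
  then show "continuous_map X
     (product_topology (\<lambda>_. discrete_topology (UNIV :: bool set)) (carrier (idems S)))
     ((\<lambda>\<xi>. \<lambda>e\<in>carrier (idems S). e \<in> \<xi>) \<circ> f)"
    by (auto simp: continuous_map_componentwise)
qed (use assms in auto)

lemma tight_filter: "\<xi> \<in> tight S \<Longrightarrow> idem_filter S \<xi>"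
  using closure_of_subset_topspace[of "filter_space S"] by (auto simp: tight_def topspace_filter_space)

lemma topspace_tight_space [simp]: "topspace (tight_space S) = tight S"
  using tight_filter by (auto simp: tight_space_def topspace_filter_space)

lemma openin_tight_space_mem: "openin (tight_space S) {\<xi> \<in> tight S. e \<in> \<xi> \<longleftrightarrow> b}"
proof -
  have "{\<xi> \<in> tight S. e \<in> \<xi> \<longleftrightarrow> b} = {\<xi>. idem_filter S \<xi> \<and> (e \<in> \<xi> \<longleftrightarrow> b)} \<inter> tight S"
    using tight_filter by auto
  then show ?thesis
    unfolding tight_space_def by (simp only: openin_subtopology_Int openin_filter_space_mem)
qed

lemma openin_V_idem: "openin (tight_space S) (V_idem S e)"
  using openin_tight_space_mem[of S e True] by (simp add: V_idem_def)

lemma openin_V_basic: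
  assumes "finite D" shows "openin (tight_space S) (V_basic S e D)"
  using assms
proof (induction D rule: finite_induct)
  case empty
  show ?case by (simp add: V_basic_def openin_V_idem)
next
  case (insert d D)
  have "V_basic S e (insert d D) = V_basic S e D \<inter> {\<xi> \<in> tight S. d \<in> \<xi> \<longleftrightarrow> False}"
    by (auto simp: V_basic_def V_idem_def)
  then show ?case
    using insert.IH openin_tight_space_mem[of S d False] by (simp only: openin_Int)
qed

text \<open>A monotone bijection between two basic clopen sets of filters preserves ultrafilters, because
  these sets are upward closed; if it is continuous, then it also preserves limits of ultrafilters.\<close>

lemma tight_image:
  assumes cont: "continuous_map (subtopology (filter_space S) {\<xi>. d \<in> \<xi>}) (filter_space S) f"
    and f: "\<And>\<xi>. idem_filter S \<xi> \<Longrightarrow> d \<in> \<xi> \<Longrightarrow> e \<in> f \<xi> \<and> idem_filter S (f \<xi>) \<and> g (f \<xi>) = \<xi>"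
    and g: "\<And>\<xi>. idem_filter S \<xi> \<Longrightarrow> e \<in> \<xi> \<Longrightarrow> idem_filter S (g \<xi>) \<and> f (g \<xi>) = \<xi>"
    and mono: "\<And>\<xi> \<eta>. \<xi> \<subseteq> \<eta> \<Longrightarrow> g \<xi> \<subseteq> g \<eta>"
    and \<xi>: "\<xi> \<in> tight S" "d \<in> \<xi>"
  shows "f \<xi> \<in> tight S"
proof -
  define U where "U = {\<xi>. idem_ultrafilter S \<xi>}"
  have ultra: "f \<eta> \<in> U" if "\<eta> \<in> U" "d \<in> \<eta>" for \<eta>
  proof -
    have \<eta>: "idem_filter S \<eta>" "\<And>\<zeta>. idem_filter S \<zeta> \<Longrightarrow> \<eta> \<subseteq> \<zeta> \<Longrightarrow> \<zeta> = \<eta>"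
      using that by (auto simp: U_def idem_ultrafilter_def)
    note f\<eta> = f[OF \<eta>(1) that(2)]
    \<comment> \<open>\<zeta> contains e because f \<eta> does, so g \<zeta> is a filter above g (f
      \<eta>) = \<eta>. Maximality of \<eta> gives g \<zeta> = \<eta>, and applying f returns
      \<zeta> = f \<eta>.\<close>
    have "\<zeta> = f \<eta>" if "idem_filter S \<zeta>" "f \<eta> \<subseteq> \<zeta>" for \<zeta>
      using \<eta>(2)[of "g \<zeta>"] g[OF that(1)] mono[OF that(2)] f\<eta> that(2) by auto
    then show ?thesis
      using f\<eta> by (auto simp: U_def idem_ultrafilter_def)
  qed
  let ?X = "filter_space S" and ?V = "{\<xi>. d \<in> \<xi>}"
  have "openin ?X (topspace ?X \<inter> ?V)"
    using openin_filter_space_mem[of S d True] by (simp add: topspace_filter_space Int_def)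
  \<comment> \<open>Containing d is an open condition, so \<xi> is already a limit of ultrafilters
    that contain d, and on these f is continuous.\<close>
  from openin_Int_closure_of_subset[OF this, of U]
  have "\<xi> \<in> ?X closure_of (topspace ?X \<inter> ?V \<inter> U)"
    using \<xi> tight_filter[OF \<xi>(1)] by (auto simp: tight_def topspace_filter_space U_def)
  then have "\<xi> \<in> ?X closure_of (?V \<inter> U)"
    by (rule closure_of_mono[THEN subsetD, rotated]) auto
  then have "\<xi> \<in> subtopology ?X ?V closure_of U"
    using \<xi>(2) by (simp add: closure_of_subtopology)
  then have "\<xi> \<in> subtopology ?X ?V closure_of (U \<inter> ?V)"
    using closure_of_subtopology by (metis (no_types, lifting) Int_left_absorb inf_commute)
  then have "f \<xi> \<in> ?X closure_of (f ` (U \<inter> ?V))"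
    using continuous_map_image_closure_subset[OF cont] by blast
  moreover have "f ` (U \<inter> ?V) \<subseteq> U"
    using ultra by auto
  ultimately show ?thesis
    unfolding tight_def U_def using closure_of_mono by blast
qed

context weakly_left_resolving
begin

text \<open>Collapses finitely many positive conditions on a filter into one, as a basic set V has a
  single e. The lower bound is described by its effect on all filters, which avoids naming iterated
  meets.\<close>

lemma filter_finite_lower_bound:
  assumes \<xi>: "idem_filter S \<xi>" and "finite F" "F \<subseteq> \<xi>"
  shows "\<exists>e\<in>\<xi>. \<forall>\<eta>. idem_filter S \<eta> \<and> e \<in> \<eta> \<longrightarrow> F \<subseteq> \<eta>"
  using assms(2,3)
proof (induction F rule: finite_induct)
  case empty
  then show ?case using \<xi> by (auto simp: idem_filter_def)
next
  case (insert f F)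
  then obtain e where e: "e \<in> \<xi>" "\<And>\<eta>. idem_filter S \<eta> \<Longrightarrow> e \<in> \<eta> \<Longrightarrow> F \<subseteq> \<eta>" by auto
  have *: "\<exists>m\<in>\<xi>. \<forall>\<eta>. idem_filter S \<eta> \<and> m \<in> \<eta> \<longrightarrow> Some (\<alpha>, A) \<in> \<eta> \<and> Some (\<alpha> @ \<alpha>', B) \<in> \<eta>"
    if "Some (\<alpha>, A) \<in> \<xi>" "Some (\<alpha> @ \<alpha>', B) \<in> \<xi>" for \<alpha> A \<alpha>' B
  proof (intro bexI allI impI conjI)
    let ?m = "Some (\<alpha> @ \<alpha>', rel_range S A \<alpha>' \<inter> B)"
    show "?m \<in> \<xi>" using filter_meet[OF \<xi> that] .
    fix \<eta> assume "idem_filter S \<eta> \<and> ?m \<in> \<eta>"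
    then have \<eta>: "idem_filter S \<eta>" "?m \<in> \<eta>" by auto
    show "Some (\<alpha>, A) \<in> \<eta>"
      using filter_up[OF \<eta> filter_in_family(2)[OF \<xi> that(1)]] by simp
    show "Some (\<alpha> @ \<alpha>', B) \<in> \<eta>"
      using filter_mono[OF \<eta> filter_in_family(2)[OF \<xi> that(2)]] by simp
  qed
  have "None \<notin> \<xi>" "f \<in> \<xi>"
    using \<xi> insert.prems by (simp_all add: idem_filter_def)
  then have "e \<noteq> None" "f \<noteq> None"
    using e(1) by metis+
  then obtain \<alpha> A \<beta> B where ef: "e = Some (\<alpha>, A)" "f = Some (\<beta>, B)" by auto
  have "\<exists>m\<in>\<xi>. \<forall>\<eta>. idem_filter S \<eta> \<and> m \<in> \<eta> \<longrightarrow> e \<in> \<eta> \<and> f \<in> \<eta>"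
  proof -
    have mem: "Some (\<alpha>, A) \<in> \<xi>" "Some (\<beta>, B) \<in> \<xi>"
      using ef e(1) \<open>f \<in> \<xi>\<close> by auto
    from filter_comparable[OF \<xi> mem] show ?thesis
    proof
      assume "\<exists>\<alpha>'. \<beta> = \<alpha> @ \<alpha>'"
      then obtain \<alpha>' where "\<beta> = \<alpha> @ \<alpha>'" ..
      then show ?thesis using *[of \<alpha> A \<alpha>' B] mem ef by simp
    next
      assume "\<exists>\<beta>'. \<alpha> = \<beta> @ \<beta>'"
      then obtain \<beta>' where "\<alpha> = \<beta> @ \<beta>'" ..
      then show ?thesis using *[of \<beta> B \<beta>' A] mem ef by (simp add: conj_commute)
    qed
  qed
  then show ?case using e(2) by blast
qed

lemma filter_space_basis:
  assumes U: "openin (filter_space S) U" "\<xi> \<in> U"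
  obtains e D where "e \<in> \<xi>" "finite D" "D \<subseteq> carrier (idems S)" "\<xi> \<inter> D = {}"
    "\<And>\<eta>. idem_filter S \<eta> \<Longrightarrow> e \<in> \<eta> \<Longrightarrow> \<eta> \<inter> D = {} \<Longrightarrow> \<eta> \<in> U"
proof -
  let ?C = "carrier (idems S)"
  let ?P = "product_topology (\<lambda>_. discrete_topology (UNIV :: bool set)) ?C"
  let ?f = "\<lambda>\<xi>. \<lambda>e\<in>?C. e \<in> \<xi>"
  from U obtain W where W: "openin ?P W" "U = ?f -` W \<inter> {\<xi>. idem_filter S \<xi>}"
    by (auto simp: filter_space_def openin_pullback_topology)
  with U(2) have \<xi>: "idem_filter S \<xi>" "?f \<xi> \<in> W" by auto
  then obtain N where N: "finite {i \<in> ?C. N i \<noteq> UNIV}" "?f \<xi> \<in> Pi\<^sub>E ?C N" "Pi\<^sub>E ?C N \<subseteq> W"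
    using W(1) by (force simp: openin_product_topology_alt)
  \<comment> \<open>Only the coordinates in F are constrained. Those in \<xi> follow from the single
    e; the others become the exclusions \<open>F - \<xi>\<close>.\<close>
  define F where "F = {i \<in> ?C. N i \<noteq> UNIV}"
  obtain e where e: "e \<in> \<xi>" "\<And>\<eta>. idem_filter S \<eta> \<Longrightarrow> e \<in> \<eta> \<Longrightarrow> F \<inter> \<xi> \<subseteq> \<eta>"
    using filter_finite_lower_bound[OF \<xi>(1), of "F \<inter> \<xi>"] N(1) by (auto simp: F_def)
  show ?thesis
  proof (rule that[of e "F - \<xi>"])
    fix \<eta> assume \<eta>: "idem_filter S \<eta>" "e \<in> \<eta>" "\<eta> \<inter> (F - \<xi>) = {}"
    have "(i \<in> \<eta>) \<in> N i" if "i \<in> ?C" for i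
    proof (cases "i \<in> F")
      case True
      then have "i \<in> \<eta> \<longleftrightarrow> i \<in> \<xi>" using e(2)[OF \<eta>(1,2)] \<eta>(3) by blast
      then show ?thesis using N(2) that by (auto simp: PiE_iff)
    next
      case False then show ?thesis using that by (auto simp: F_def)
    qed
    then have "?f \<eta> \<in> W" using N(3) by (auto simp: PiE_iff subset_iff)
    then show "\<eta> \<in> U" using W(2) \<eta>(1) by auto
  qed (use e N in \<open>auto simp: F_def\<close>)
qed

lemma tight_space_basis:
  assumes U: "openin (tight_space S) U" "\<xi> \<in> U"
  obtains e D where "e \<in> carrier (idems S)" "finite D" "D \<subseteq> carrier (idems S)"
    "\<xi> \<in> V_basic S e D" "V_basic S e D \<subseteq> U"
proof -
  from U obtain W where W: "openin (filter_space S) W" "U = W \<inter> tight S"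
    by (auto simp: tight_space_def openin_subtopology)
  with U(2) obtain e D where D: "e \<in> \<xi>" "finite D" "D \<subseteq> carrier (idems S)" "\<xi> \<inter> D = {}"
    "\<And>\<eta>. idem_filter S \<eta> \<Longrightarrow> e \<in> \<eta> \<Longrightarrow> \<eta> \<inter> D = {} \<Longrightarrow> \<eta> \<in> W"
    by (auto elim: filter_space_basis)
  show ?thesis
  proof (rule that[of e D])
    show "e \<in> carrier (idems S)"
      using tight_filter[of \<xi> S] U W D(1) by (auto simp: idem_filter_def)
    show "V_basic S e D \<subseteq> U"
      using D(5) W tight_filter by (fastforce simp: V_basic_def V_idem_def)
    show "\<xi> \<in> V_basic S e D"
      using U W D by (auto simp: V_basic_def V_idem_def)
  qed (use D in auto)
qed

text \<open>Membership of (\<nu>,C) after the cut is membership of one fixed idempotent before it,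
  hence a clopen condition.\<close>

lemma continuous_filter_drop:
  "continuous_map (subtopology (filter_space S) {\<xi>. Some (\<alpha>, word_range S \<alpha>) \<in> \<xi>}) (filter_space S)
    (filter_drop S \<alpha>)" (is "continuous_map ?X _ _")
proof (rule continuous_map_filter_space)
  fix e b
  have mem: "openin ?X {\<xi> \<in> topspace ?X. d \<in> \<xi> \<longleftrightarrow> c}" for d c
  proof -
    have "{\<xi> \<in> topspace ?X. d \<in> \<xi> \<longleftrightarrow> c} =
        {\<xi>. idem_filter S \<xi> \<and> (d \<in> \<xi> \<longleftrightarrow> c)} \<inter> {\<xi>. Some (\<alpha>, word_range S \<alpha>) \<in> \<xi>}"
      by (auto simp: topspace_filter_space)
    then show ?thesis
      by (simp only: openin_subtopology_Int openin_filter_space_mem)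
  qed
  show "openin ?X {\<xi> \<in> topspace ?X. e \<in> filter_drop S \<alpha> \<xi> \<longleftrightarrow> b}"
  proof (cases "\<exists>\<nu> C. e = Some (\<nu>, C) \<and> C \<in> family_at S \<nu>")
    case True
    then show ?thesis using mem by (auto simp: in_filter_drop)
  next
    case False
    then have "e \<notin> filter_drop S \<alpha> \<xi>" for \<xi>
      by (auto simp: filter_drop_def)
    then have "{\<xi> \<in> topspace ?X. e \<in> filter_drop S \<alpha> \<xi> \<longleftrightarrow> b} = (if b then {} else topspace ?X)"
      by auto
    then show ?thesis
      by (simp only: openin_empty openin_topspace simp_thms split: if_split)
  qed
qed (simp add: topspace_filter_space idem_filter_drop)

lemma continuous_filter_cons:
  "continuous_map (subtopology (filter_space S) {\<xi>. Some ([], word_range S [a]) \<in> \<xi>}) (filter_space S)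
    (filter_cons S a)" (is "continuous_map ?X _ _")
proof (rule continuous_map_filter_space)
  fix e b
  have mem: "openin ?X {\<xi> \<in> topspace ?X. d \<in> \<xi> \<longleftrightarrow> c}" for d c
  proof -
    have "{\<xi> \<in> topspace ?X. d \<in> \<xi> \<longleftrightarrow> c} =
        {\<xi>. idem_filter S \<xi> \<and> (d \<in> \<xi> \<longleftrightarrow> c)} \<inter> {\<xi>. Some ([], word_range S [a]) \<in> \<xi>}"
      by (auto simp: topspace_filter_space)
    then show ?thesis
      by (simp only: openin_subtopology_Int openin_filter_space_mem)
  qed
  show "openin ?X {\<xi> \<in> topspace ?X. e \<in> filter_cons S a \<xi> \<longleftrightarrow> b}"
  proof (cases "(\<exists>\<nu> A. e = Some (a # \<nu>, A) \<and> A \<in> family_at S (a # \<nu>)) \<or>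
      (\<exists>A. e = Some ([], A) \<and> A \<in> family S)")
    case True
    then show ?thesis using mem by (auto simp: in_filter_cons)
  next
    case False
    then have "e \<notin> filter_cons S a \<xi>" for \<xi>
      by (auto simp: filter_cons_def)
    then have "{\<xi> \<in> topspace ?X. e \<in> filter_cons S a \<xi> \<longleftrightarrow> b} = (if b then {} else topspace ?X)"
      by auto
    then show ?thesis
      by (simp only: openin_empty openin_topspace simp_thms split: if_split)
  qed
qed (simp add: topspace_filter_space idem_filter_cons)

lemma tight_filter_cons:
  assumes "\<xi> \<in> tight S" "Some ([], word_range S [a]) \<in> \<xi>"
  shows "filter_cons S a \<xi> \<in> tight S"
  by (rule tight_image[where e = "Some ([a], word_range S [a])", OF continuous_filter_cons _ _ filter_drop_mono[of _ _ "[a]"] assms])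
    (auto simp: filter_cons_contains idem_filter_cons drop_cons idem_filter_drop cons_drop)

lemma tight_filter_drop:
  assumes "\<xi> \<in> tight S" "Some ([a], word_range S [a]) \<in> \<xi>"
  shows "filter_drop S [a] \<xi> \<in> tight S"
  by (rule tight_image[where e = "Some ([], word_range S [a])", OF continuous_filter_drop _ _ filter_cons_mono[of _ _ a] assms])
    (auto simp: filter_drop_contains idem_filter_cons drop_cons idem_filter_drop cons_drop)

end

section \<open>The word of a filter\<close>

lemma wtake_0 [simp]: "wtake 0 \<gamma> = []"
  by (cases \<gamma>) simp_all

lemma wtake_wapp: "wtake n (u \<cdot>\<^sub>w \<gamma>) = take n u @ wtake (n - length u) \<gamma>"
  by (cases \<gamma>) (simp_all add: stake_shift)

lemma wlen_wapp: "enat n \<le> wlen (u \<cdot>\<^sub>w \<gamma>) \<longleftrightarrow> enat (n - length u) \<le> wlen \<gamma>"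
  by (cases \<gamma>) auto

lemma length_wtake: "enat n \<le> wlen \<gamma> \<Longrightarrow> length (wtake n \<gamma>) = n"
  by (cases \<gamma>) auto

lemma wapp_Nil [simp]: "[] \<cdot>\<^sub>w \<gamma> = \<gamma>"
  by (cases \<gamma>) auto

lemma wtake_wapp_ex: "enat n \<le> wlen \<delta> \<Longrightarrow> \<exists>\<gamma>. \<delta> = wtake n \<delta> \<cdot>\<^sub>w \<gamma>"
proof (cases \<delta>)
  case (Fin u)
  then have "\<delta> = wtake n \<delta> \<cdot>\<^sub>w Fin (drop n u)" by simp
  then show ?thesis ..
next
  case (Inf x)
  then have "\<delta> = wtake n \<delta> \<cdot>\<^sub>w Inf (sdrop n x)" by (simp add: stake_sdrop)
  then show ?thesis ..
qed

text \<open>Agreement on the beginnings of \<gamma> alone would allow \<gamma> to be a proper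
  beginning of \<delta>, hence the condition on lengths.\<close>

lemma fiword_eqI:
  assumes "\<And>n. enat n \<le> wlen \<gamma> \<longleftrightarrow> enat n \<le> wlen \<delta>"
    and "\<And>n. enat n \<le> wlen \<gamma> \<Longrightarrow> wtake n \<gamma> = wtake n \<delta>"
  shows "\<gamma> = \<delta>"
proof (cases \<gamma>)
  case u: (Fin u)
  show ?thesis
  proof (cases \<delta>)
    case (Fin v)
    have "length u \<le> length v" "length v \<le> length u"
      using assms(1)[of "length u"] assms(1)[of "length v"] u Fin by auto
    then show ?thesis using assms(2)[of "length u"] u Fin by auto
  next
    case (Inf x)
    then show ?thesis using assms(1)[of "Suc (length u)"] u by auto
  qed
next
  case x: (Inf x)
  show ?thesis
  proof (cases \<delta>)
    case (Fin v)
    then show ?thesis using assms(1)[of "Suc (length v)"] x by auto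
  next
    case (Inf y)
    have "x !! n = y !! n" for n
      using assms(2)[of "Suc n"] x Inf by (metis enat_ord_simps(3) lessI stake_nth wlen.simps(2) wtake.simps(2))
    then show ?thesis using x Inf by (metis ext stream_smap_nats)
  qed
qed

context labelled_space
begin

lemma fiwords_wapp: "\<alpha> \<cdot>\<^sub>w \<gamma> \<in> fiwords S \<Longrightarrow> \<alpha> \<in> labels S \<and> \<gamma> \<in> fiwords S"
proof (cases \<gamma>)
  case (Fin u)
  then show "\<alpha> \<cdot>\<^sub>w \<gamma> \<in> fiwords S \<Longrightarrow> ?thesis"
    using labels_appendD1[of \<alpha> u] labels_appendD2[of \<alpha> u] by (auto simp: fiwords_def)
next
  case (Inf x)
  assume "\<alpha> \<cdot>\<^sub>w \<gamma> \<in> fiwords S"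
  with Inf have *: "sset x \<subseteq> alphabet S" "\<And>n. stake n (\<alpha> @- x) \<in> labels S"
    by (auto simp: fiwords_def labels_inf_def)
  have "\<alpha> @ stake n x \<in> labels S" for n
    using *(2)[of "length \<alpha> + n"] by (simp add: stake_shift)
  then have "\<alpha> \<in> labels S" "stake n x \<in> labels S" for n
    using labels_appendD1 labels_appendD2 by blast+
  with * Inf show ?thesis by (auto simp: fiwords_def labels_inf_def)
qed

end

context weakly_left_resolving
begin

lemma has_word_mem:
  assumes "has_word S \<xi> \<gamma>" "Some (\<beta>, A) \<in> \<xi>"
  shows "enat (length \<beta>) \<le> wlen \<gamma>" "\<beta> = wtake (length \<beta>) \<gamma>"
proof -
  from assms obtain n where "enat n \<le> wlen \<gamma>" "\<beta> = wtake n \<gamma>"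
    unfolding has_word_def by blast
  then show "enat (length \<beta>) \<le> wlen \<gamma>" "\<beta> = wtake (length \<beta>) \<gamma>"
    by (simp_all add: length_wtake)
qed

lemma has_word_mem_wapp:
  assumes "has_word S \<xi> (\<alpha> \<cdot>\<^sub>w \<gamma>)" "Some (\<alpha> @ \<nu>, A) \<in> \<xi>"
  shows "enat (length \<nu>) \<le> wlen \<gamma>" "\<nu> = wtake (length \<nu>) \<gamma>"
  using has_word_mem[OF assms] by (auto simp: wtake_wapp wlen_wapp)

lemma has_word_component:
  assumes "has_word S \<xi> \<gamma>" "n \<ge> 1" "enat n \<le> wlen \<gamma>"
  obtains A where "Some (wtake n \<gamma>, A) \<in> \<xi>"
  using assms unfolding has_word_def component_def by blast

lemma has_word_unique:
  assumes "has_word S \<xi> \<gamma>" "has_word S \<xi> \<delta>" shows "\<gamma> = \<delta>"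
proof (rule fiword_eqI)
  have *: "enat n \<le> wlen \<delta> \<and> wtake n \<gamma> = wtake n \<delta>"
    if "has_word S \<xi> \<gamma>" "has_word S \<xi> \<delta>" "enat n \<le> wlen \<gamma>" for n \<gamma> \<delta>
  proof (cases "n \<ge> 1")
    case True
    with that obtain A where "Some (wtake n \<gamma>, A) \<in> \<xi>" by (auto elim: has_word_component)
    then show ?thesis using has_word_mem[OF that(2)] length_wtake[OF that(3)] by metis
  next
    \<comment> \<open>At level 0 the filter may have no member, but all words share the empty
      beginning.\<close>
    case False
    then have "n = 0" by simp
    then show ?thesis by (simp add: zero_enat_def[symmetric])
  qed
  show "enat n \<le> wlen \<gamma> \<longleftrightarrow> enat n \<le> wlen \<delta>" for n
    using *[OF assms] *[OF assms(2,1)] by blast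
  show "wtake n \<gamma> = wtake n \<delta>" if "enat n \<le> wlen \<gamma>" for n
    using *[OF assms that] by blast
qed

lemma has_word_filter_word: "has_word S \<xi> \<gamma> \<Longrightarrow> filter_word S \<xi> = \<gamma>"
  unfolding filter_word_def using has_word_unique by blast

lemma has_word_prefix:
  assumes "has_word S \<xi> \<delta>" "Some (\<alpha>, A) \<in> \<xi>"
  obtains \<gamma> where "\<delta> = \<alpha> \<cdot>\<^sub>w \<gamma>"
  using has_word_mem[OF assms] wtake_wapp_ex by metis

text \<open>The words occurring in a filter form a chain of beginnings. If their lengths are
  bounded, the longest is the word of the filter; otherwise their common letters form an infinite
  word.\<close>

lemma filter_has_word:
  assumes \<xi>: "idem_filter S \<xi>"
  obtains \<gamma> where "has_word S \<xi> \<gamma>"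
proof -
  define L where "L = {\<beta>. \<exists>A. Some (\<beta>, A) \<in> \<xi>}"
  \<comment> \<open>n = 0 is excluded, since nothing guarantees a member at level \<omega>.\<close>
  have L_take: "take n \<beta> \<in> L" if "\<beta> \<in> L" "n \<ge> 1" for n \<beta>
  proof (cases "\<beta> = []")
    case True
    with that show ?thesis by simp
  next
    case False
    from that obtain A where "Some (take n \<beta> @ drop n \<beta>, A) \<in> \<xi>" by (auto simp: L_def)
    from filter_word_range[OF \<xi> this] show ?thesis using that False by (auto simp: L_def)
  qed
  have L_chain: "take n \<beta> = take n \<beta>'" if "\<beta> \<in> L" "\<beta>' \<in> L" "n \<le> length \<beta>" "n \<le> length \<beta>'" for n \<beta> \<beta>'
    using that filter_comparable[OF \<xi>] by (fastforce simp: L_def)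
  have L_labels: "L \<subseteq> labels S"
    using filter_in_family(3)[OF \<xi>] by (auto simp: L_def)
  have L_comp: "component S \<gamma> \<xi> n \<noteq> {}" if "wtake n \<gamma> \<in> L" for \<gamma> n
    using that filter_in_family(4)[OF \<xi>] by (auto simp: L_def component_def)
  have "L \<noteq> {}"
  proof -
    from \<xi> obtain e where "e \<in> \<xi>" "None \<notin> \<xi>" by (auto simp: idem_filter_def)
    then obtain \<beta> A where "Some (\<beta>, A) \<in> \<xi>" by (metis option.exhaust surj_pair)
    then show ?thesis by (auto simp: L_def)
  qed
  show ?thesis
  proof (cases "\<exists>m. \<forall>\<beta>\<in>L. length \<beta> \<le> m")
    case True
    then obtain \<beta> where \<beta>: "\<beta> \<in> L" "\<And>\<beta>'. \<beta>' \<in> L \<Longrightarrow> length \<beta>' \<le> length \<beta>"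
      using \<open>L \<noteq> {}\<close> ex_has_greatest_nat[of "\<lambda>\<beta>. \<beta> \<in> L" _ length]
      by (metis all_not_in_conv less_Suc_eq_le)
    have "has_word S \<xi> (Fin \<beta>)"
      unfolding has_word_def
    proof (intro conjI allI impI)
      show "Fin \<beta> \<in> fiwords S" using \<beta> L_labels by (auto simp: fiwords_def)
      fix \<beta>' A assume "Some (\<beta>', A) \<in> \<xi>"
      then have "\<beta>' \<in> L" by (auto simp: L_def)
      with \<beta> L_chain[of \<beta>' \<beta> "length \<beta>'"]
      show "\<exists>n. enat n \<le> wlen (Fin \<beta>) \<and> \<beta>' = wtake n (Fin \<beta>)"
        by (intro exI[of _ "length \<beta>'"]) auto
    next
      fix n :: nat assume "n \<ge> 1" "enat n \<le> wlen (Fin \<beta>)"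
      then show "component S (Fin \<beta>) \<xi> n \<noteq> {}"
        using L_take \<beta> by (intro L_comp) auto
    qed
    then show ?thesis by (rule that)
  next
    case False
    then have "\<forall>n. \<exists>\<beta>. \<beta> \<in> L \<and> length \<beta> > n" by (meson not_le)
    then obtain w where w: "\<And>n. w n \<in> L" "\<And>n. length (w n) > n" by metis
    \<comment> \<open>Any word of L longer than n could provide the letter at position n, because
      words of L agree wherever both are defined.\<close>
    define x where "x = smap (\<lambda>n. w n ! n) nats"
    have x: "stake n x = take n \<beta>" if "\<beta> \<in> L" "n \<le> length \<beta>" for n \<beta>
    proof (rule nth_equalityI)
      fix i assume "i < length (stake n x)"
      then have i: "i < n" by simp
      have "take (Suc i) (w i) = take (Suc i) \<beta>"
        using L_chain[OF w(1) that(1)] w(2)[of i] that(2) i by simp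
      then have "w i ! i = \<beta> ! i" by (metis lessI nth_take)
      then show "stake n x ! i = take n \<beta> ! i" using i by (simp add: x_def stake_nth)
    qed (use that in simp)
    have x_L: "stake n x \<in> L" if "n \<ge> 1" for n
      using x[OF w(1)[of n]] w(2)[of n] L_take[OF w(1)[of n] that] by simp
    have x_labels: "stake n x \<in> labels S" for n
      using x_L[of n] L_labels by (cases "n = 0") auto
    have "has_word S \<xi> (Inf x)"
      unfolding has_word_def
    proof (intro conjI allI impI)
      have "x !! n \<in> alphabet S" for n
        using labels_alphabet[OF x_labels[of "Suc n"]] nth_mem[of n "stake (Suc n) x"]
        by (simp del: stake.simps)  auto
      then show "Inf x \<in> fiwords S"
        using x_labels by (auto simp: fiwords_def labels_inf_def sset_range)
      fix \<beta> A assume "Some (\<beta>, A) \<in> \<xi>"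
      then have "\<beta> \<in> L" by (auto simp: L_def)
      with x[of \<beta> "length \<beta>"] show "\<exists>n. enat n \<le> wlen (Inf x) \<and> \<beta> = wtake n (Inf x)"
        by (intro exI[of _ "length \<beta>"]) auto
    next
      fix n :: nat assume "n \<ge> 1"
      then show "component S (Inf x) \<xi> n \<noteq> {}"
        using x_L by (intro L_comp) auto
    qed
    then show ?thesis by (rule that)
  qed
qed

lemma has_word_contains:
  assumes "idem_filter S \<xi>" "has_word S \<xi> (\<alpha> \<cdot>\<^sub>w \<gamma>)" "\<alpha> \<noteq> []"
  shows "Some (\<alpha>, word_range S \<alpha>) \<in> \<xi>"
proof -
  have "length \<alpha> \<ge> 1" "enat (length \<alpha>) \<le> wlen (\<alpha> \<cdot>\<^sub>w \<gamma>)"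
    using assms(3) by (auto simp: wlen_wapp Suc_le_eq zero_enat_def[symmetric])
  with assms(2) obtain A where "Some (wtake (length \<alpha>) (\<alpha> \<cdot>\<^sub>w \<gamma>), A) \<in> \<xi>"
    by (auto elim: has_word_component)
  moreover have "wtake (length \<alpha>) (\<alpha> \<cdot>\<^sub>w \<gamma>) = \<alpha>"
    by (cases \<gamma>) (auto simp: stake_shift)
  ultimately show ?thesis
    using filter_word_range[OF assms(1), of \<alpha> "[]" A] assms(3) by simp
qed

lemma has_word_filter_drop:
  assumes \<xi>: "idem_filter S \<xi>" and word: "has_word S \<xi> (\<alpha> \<cdot>\<^sub>w \<gamma>)"
  shows "has_word S (filter_drop S \<alpha> \<xi>) \<gamma>"
  unfolding has_word_def
proof (intro conjI allI impI)
  show "\<gamma> \<in> fiwords S"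
    using word fiwords_wapp by (auto simp: has_word_def)
  show "\<exists>n. enat n \<le> wlen \<gamma> \<and> \<nu> = wtake n \<gamma>" if "Some (\<nu>, C) \<in> filter_drop S \<alpha> \<xi>" for \<nu> C
    using that has_word_mem_wapp[OF word, of \<nu>] by (auto simp: in_filter_drop)
  fix n :: nat assume n: "n \<ge> 1" "enat n \<le> wlen \<gamma>"
  then have "length \<alpha> + n \<ge> 1" "enat (length \<alpha> + n) \<le> wlen (\<alpha> \<cdot>\<^sub>w \<gamma>)"
    by (simp_all add: wlen_wapp)
  then obtain A where "Some (wtake (length \<alpha> + n) (\<alpha> \<cdot>\<^sub>w \<gamma>), A) \<in> \<xi>"
    by (rule has_word_component[OF word])
  then have A: "Some (\<alpha> @ wtake n \<gamma>, A) \<in> \<xi>" by (simp add: wtake_wapp)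
  note fam = filter_in_family[OF \<xi> A]
  have "A \<inter> word_range S (\<alpha> @ wtake n \<gamma>) = A" using fam by (auto simp: family_at_def)
  then have "Some (wtake n \<gamma>, A) \<in> filter_drop S \<alpha> \<xi>"
    using A fam family_at_suffixD by (auto simp: in_filter_drop)
  then show "component S \<gamma> (filter_drop S \<alpha> \<xi>) n \<noteq> {}"
    using fam by (auto simp: component_def)
qed

section \<open>Agreement with the cutting and gluing maps\<close>

lemma Some_in_filter_of:
  "Some (\<beta>, A) \<in> filter_of \<alpha> F \<longleftrightarrow> (\<exists>n. enat n \<le> wlen \<alpha> \<and> \<beta> = wtake n \<alpha> \<and> A \<in> F n)"
  "None \<notin> filter_of \<alpha> F"
  by (auto simp: filter_of_def)

lemma cut_eq_filter_drop:
  assumes \<xi>: "idem_filter S \<xi>" and word: "has_word S \<xi> (\<alpha> \<cdot>\<^sub>w \<gamma>)"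
  shows "cut S \<alpha> \<gamma> \<xi> = filter_drop S \<alpha> \<xi>"
proof (cases "\<alpha> = []")
  case False
  have "Some (\<nu>, C) \<in> cut S \<alpha> \<gamma> \<xi> \<longleftrightarrow> Some (\<nu>, C) \<in> filter_drop S \<alpha> \<xi>" for \<nu> C
  proof
    assume "Some (\<nu>, C) \<in> cut S \<alpha> \<gamma> \<xi>"
    then obtain n D where "enat n \<le> wlen \<gamma>" "\<nu> = wtake n \<gamma>" and C: "C \<in> family_at S \<nu>"
      and "D \<subseteq> C" "Some (wtake (n + length \<alpha>) (\<alpha> \<cdot>\<^sub>w \<gamma>), D) \<in> \<xi>"
      using False by (auto simp: cut_def Some_in_filter_of component_def)
    then have D: "Some (\<alpha> @ \<nu>, D) \<in> \<xi>" by (simp add: wtake_wapp)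
    then have "D \<subseteq> C \<inter> word_range S (\<alpha> @ \<nu>)" "C \<inter> word_range S (\<alpha> @ \<nu>) \<in> family_at S (\<alpha> @ \<nu>)"
      using filter_in_family[OF \<xi> D] \<open>D \<subseteq> C\<close> C
      by (auto simp: family_at_def Int_word_range_in_family)
    with filter_mono[OF \<xi> D] C show "Some (\<nu>, C) \<in> filter_drop S \<alpha> \<xi>"
      by (simp add: in_filter_drop)
  next
    assume "Some (\<nu>, C) \<in> filter_drop S \<alpha> \<xi>"
    then have C: "C \<in> family_at S \<nu>" "Some (\<alpha> @ \<nu>, C \<inter> word_range S (\<alpha> @ \<nu>)) \<in> \<xi>"
      by (auto simp: in_filter_drop)
    \<comment> \<open>The word of \<xi> identifies \<nu> as the beginning of \<gamma> of length
      |\<nu>|, which supplies the level that \<open>cut\<close> asks for.\<close>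
    note n = has_word_mem_wapp[OF word C(2)]
    have "wtake (length \<nu> + length \<alpha>) (\<alpha> \<cdot>\<^sub>w \<gamma>) = \<alpha> @ \<nu>"
      using n by (simp add: wtake_wapp)
    with C have "C \<inter> word_range S (\<alpha> @ \<nu>) \<in> component S (\<alpha> \<cdot>\<^sub>w \<gamma>) \<xi> (length \<nu> + length \<alpha>)"
      using filter_in_family(4)[OF \<xi> C(2)] by (simp add: component_def)
    with C n have "\<exists>n. enat n \<le> wlen \<gamma> \<and> \<nu> = wtake n \<gamma> \<and> C \<in> family_at S (wtake n \<gamma>) \<and>
        (\<exists>D\<in>component S (\<alpha> \<cdot>\<^sub>w \<gamma>) \<xi> (n + length \<alpha>). D \<subseteq> C)"
      by (intro exI[of _ "length \<nu>"]) auto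
    with False show "Some (\<nu>, C) \<in> cut S \<alpha> \<gamma> \<xi>"
      by (simp add: cut_def Some_in_filter_of)
  qed
  moreover have "None \<notin> cut S \<alpha> \<gamma> \<xi>" "None \<notin> filter_drop S \<alpha> \<xi>"
    using False by (auto simp: cut_def Some_in_filter_of in_filter_drop)
  ultimately have "e \<in> cut S \<alpha> \<gamma> \<xi> \<longleftrightarrow> e \<in> filter_drop S \<alpha> \<xi>" for e
    by (cases e) auto
  then show ?thesis by blast
qed (simp add: cut_def filter_drop_Nil \<xi>)

text \<open>The sets C \<inter> r(a\<nu>) of the gluing formula stay in the filter, by a meet with
  (\<omega>,r(a)). Restricting thus only selects the members contained in r(a\<nu>).\<close>

lemma restricted_component_iff:
  assumes \<xi>: "idem_filter S \<xi>" and a: "Some ([], word_range S [a]) \<in> \<xi>"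
  shows "A \<in> {C \<inter> word_range S (a # \<nu>) | C. C \<in> family S \<and> Some (\<nu>, C) \<in> \<xi>} \<longleftrightarrow>
    A \<in> family_at S (a # \<nu>) \<and> Some (\<nu>, A) \<in> \<xi>"
proof
  assume "A \<in> {C \<inter> word_range S (a # \<nu>) | C. C \<in> family S \<and> Some (\<nu>, C) \<in> \<xi>}"
  then obtain C where C: "A = C \<inter> word_range S (a # \<nu>)" "Some (\<nu>, C) \<in> \<xi>" by auto
  then have "Some (\<nu>, A) \<in> \<xi>"
    using filter_meet[OF \<xi> a, of \<nu> C] by (simp add: Int_commute word_range_Cons[of a \<nu>])
  with C filter_in_family(4)[OF \<xi> this] show "A \<in> family_at S (a # \<nu>) \<and> Some (\<nu>, A) \<in> \<xi>"
    by (auto simp: family_at_def)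
next
  assume "A \<in> family_at S (a # \<nu>) \<and> Some (\<nu>, A) \<in> \<xi>"
  then show "A \<in> {C \<inter> word_range S (a # \<nu>) | C. C \<in> family S \<and> Some (\<nu>, C) \<in> \<xi>}"
    by (auto simp: family_at_def intro!: exI[of _ A])
qed

lemma glue_eq_filter_cons:
  assumes \<xi>: "idem_filter S \<xi>" and word: "has_word S \<xi> \<gamma>" and a: "Some ([], word_range S [a]) \<in> \<xi>"
  shows "glue S [a] \<gamma> \<xi> = filter_cons S a \<xi>"
proof -
  define F where "F = (if \<gamma> = Fin [] then glue_family_empty S [a] \<xi> else glue_family S [a] \<gamma> \<xi>)"
  have a_labels: "[a] \<in> labels S"
    using filter_in_family(1)[OF \<xi> a] word_range_nonempty_iff by auto
  note restrict = restricted_component_iff[OF \<xi> a]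
  \<comment> \<open>Level n + 1 of the glued filter is read off level n of \<xi>, as one letter has
    been prepended. Level 0 alone has the other form.\<close>
  have F_Suc: "A \<in> F (Suc n) \<longleftrightarrow> A \<in> family_at S (a # wtake n \<gamma>) \<and> Some (wtake n \<gamma>, A) \<in> \<xi>"
    and F_0: "A \<in> F 0 \<longleftrightarrow> A \<in> family S \<and> Some ([], rel_range S A [a]) \<in> \<xi>"
    if n: "enat n \<le> wlen \<gamma>" for A n
  proof (atomize (full), cases "\<gamma> = Fin []")
    case True
    have "n = 0" using True n by (simp add: enat_0_iff)
    have "rel_range S A [a] \<in> family_at S [a]" if "A \<in> family S"
      using rel_range_family_at[of A "[]" "[a]"] that a_labels by simp
    with True \<open>n = 0\<close> show "(A \<in> F (Suc n) \<longleftrightarrow> A \<in> family_at S (a # wtake n \<gamma>) \<and> Some (wtake n \<gamma>, A) \<in> \<xi>) \<and>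
      (A \<in> F 0 \<longleftrightarrow> A \<in> family S \<and> Some ([], rel_range S A [a]) \<in> \<xi>)"
      using restrict[of _ "[]"]
      by (auto simp: F_def glue_family_empty_def component_def)
  next
    case False
    then have "enat 1 \<le> wlen \<gamma>"
      by (cases \<gamma>) (auto simp: Suc_le_eq)
    with word obtain B where B: "Some (wtake 1 \<gamma>, B) \<in> \<xi>"
      by (auto elim: has_word_component)
    have 1: "wtake 1 \<gamma> \<in> labels S"
      using filter_in_family(3)[OF \<xi> B] .
    let ?later = "\<lambda>n. {C \<inter> word_range S (a # wtake n \<gamma>) | C. C \<in> component S \<gamma> \<xi> n}"
    have later: "A \<in> ?later n \<longleftrightarrow> A \<in> family_at S (a # wtake n \<gamma>) \<and> Some (wtake n \<gamma>, A) \<in> \<xi>" for A n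
      using restrict[of A "wtake n \<gamma>"] by (simp add: component_def)
    have F: "F i = (if i > 1 then ?later (i - 1) else
       {D \<in> family_at S (take i [a]). rel_range S D (drop i [a] @ wtake 1 \<gamma>) \<in> ?later 1})" for i
      using False by (simp add: F_def glue_family_def Let_def)
    \<comment> \<open>For non-empty \<gamma>, levels 0 and 1 are defined through level 2 by way of
      the first letter of \<gamma>. \<open>filter_range_iff\<close> brings the test back to level 0
      of \<xi>, where the case of empty \<gamma> also arrives.\<close>
    have one: "rel_range S A (wtake 1 \<gamma>) \<in> ?later 1 \<longleftrightarrow> Some ([], A) \<in> \<xi>" if "A \<in> family_at S [a]" for A
    proof -
      have "rel_range S A (wtake 1 \<gamma>) \<in> ?later 1 \<longleftrightarrow> Some (wtake 1 \<gamma>, rel_range S A (wtake 1 \<gamma>)) \<in> \<xi>"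
        using later rel_range_family_at[OF that 1] by auto
      also have "\<dots> \<longleftrightarrow> Some ([], A) \<in> \<xi>"
        using filter_range_iff[OF \<xi>, of "[]" "wtake 1 \<gamma>" B A] B family_atD[OF that] by simp
      finally show ?thesis .
    qed
    show "(A \<in> F (Suc n) \<longleftrightarrow> A \<in> family_at S (a # wtake n \<gamma>) \<and> Some (wtake n \<gamma>, A) \<in> \<xi>) \<and>
      (A \<in> F 0 \<longleftrightarrow> A \<in> family S \<and> Some ([], rel_range S A [a]) \<in> \<xi>)"
    proof
      show "A \<in> F (Suc n) \<longleftrightarrow> A \<in> family_at S (a # wtake n \<gamma>) \<and> Some (wtake n \<gamma>, A) \<in> \<xi>"
      proof (cases n)
        case 0
        with one[of A] show ?thesis by (cases "A \<in> family_at S [a]") (simp_all add: F)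
      next
        case (Suc m)
        then show ?thesis using later[of A n] by (simp add: F)
      qed
      show "A \<in> F 0 \<longleftrightarrow> A \<in> family S \<and> Some ([], rel_range S A [a]) \<in> \<xi>"
        using one[of "rel_range S A [a]"] rel_range_family_at[of A "[]" "[a]"] a_labels
        by (auto simp: F rel_range_Cons[of A a "wtake 1 \<gamma>"] simp del: One_nat_def)
    qed
  qed
  have "Some (\<mu>, A) \<in> filter_of ([a] \<cdot>\<^sub>w \<gamma>) F \<longleftrightarrow> Some (\<mu>, A) \<in> filter_cons S a \<xi>" for \<mu> A
  proof (cases \<mu>)
    case Nil
    have "Some ([], A) \<in> filter_of ([a] \<cdot>\<^sub>w \<gamma>) F \<longleftrightarrow> A \<in> F 0"
    proof
      show "A \<in> F 0" if "Some ([], A) \<in> filter_of ([a] \<cdot>\<^sub>w \<gamma>) F"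
      proof -
        from that obtain n where "[] = wtake n ([a] \<cdot>\<^sub>w \<gamma>)" "A \<in> F n"
          by (auto simp: Some_in_filter_of)
        then show ?thesis by (cases n) (auto simp: wtake_wapp)
      qed
      show "Some ([], A) \<in> filter_of ([a] \<cdot>\<^sub>w \<gamma>) F" if "A \<in> F 0"
        unfolding Some_in_filter_of
        using that by (intro exI[of _ 0]) (cases \<gamma>; auto simp: zero_enat_def[symmetric])
    qed
    then show ?thesis
      using Nil F_0[of 0] by (simp add: in_filter_cons zero_enat_def[symmetric])
  next
    case (Cons b \<nu>)
    show ?thesis
    proof
      assume "Some (\<mu>, A) \<in> filter_of ([a] \<cdot>\<^sub>w \<gamma>) F"
      then obtain m where m: "enat m \<le> wlen ([a] \<cdot>\<^sub>w \<gamma>)" "b # \<nu> = wtake m ([a] \<cdot>\<^sub>w \<gamma>)" "A \<in> F m"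
        using Cons by (auto simp: Some_in_filter_of)
      have "m \<noteq> 0"
        using m(2) wtake_0 by (metis list.discI)
      then obtain n where "m = Suc n" by (cases m) auto
      with m have "enat n \<le> wlen \<gamma>" "b = a" "\<nu> = wtake n \<gamma>"
        by (auto simp: wtake_wapp wlen_wapp)
      with F_Suc[of n A] m(3) \<open>m = Suc n\<close> Cons show "Some (\<mu>, A) \<in> filter_cons S a \<xi>"
        by (simp add: in_filter_cons)
    next
      assume "Some (\<mu>, A) \<in> filter_cons S a \<xi>"
      with Cons have *: "b = a" "A \<in> family_at S (a # \<nu>)" "Some (\<nu>, A) \<in> \<xi>"
        by (auto simp: in_filter_cons)
      note n = has_word_mem[OF word *(3)]
      have "A \<in> F (Suc (length \<nu>))"
        using F_Suc[OF n(1), of A] n(2) * by auto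
      then show "Some (\<mu>, A) \<in> filter_of ([a] \<cdot>\<^sub>w \<gamma>) F"
        unfolding Some_in_filter_of
        using Cons * n by (intro exI[of _ "Suc (length \<nu>)"]) (auto simp: wtake_wapp wlen_wapp)
    qed
  qed
  moreover have "None \<notin> filter_of ([a] \<cdot>\<^sub>w \<gamma>) F"
    by (simp add: Some_in_filter_of)
  ultimately have "e \<in> filter_of ([a] \<cdot>\<^sub>w \<gamma>) F \<longleftrightarrow> e \<in> filter_cons S a \<xi>" for e
    by (cases e) (auto simp: in_filter_cons)
  then have "filter_of ([a] \<cdot>\<^sub>w \<gamma>) F = filter_cons S a \<xi>" by blast
  then show ?thesis by (simp add: glue_def F_def)
qed

end

section \<open>The free group\<close>

lemma inv_free_group:
  assumes "w \<in> carrier (free_group A)"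
  shows "inv\<^bsub>free_group A\<^esub> w = rev (map letter_inv w)"
proof (rule group.inv_equality[OF group_free_group])
  show "rev (map letter_inv w) \<otimes>\<^bsub>free_group A\<^esub> w = \<one>\<^bsub>free_group A\<^esub>"
    by (simp add: free_group_def free_reduce_inverse)
  show "rev (map letter_inv w) \<in> carrier (free_group A)"
    using assms reduced_inverse by (auto simp: free_group_def image_image)
qed fact

lemma reduced_map_Gen: "reduced (map Gen \<alpha>)"
  by (induction \<alpha> rule: induct_list012) auto

lemma map_Gen_free_group: "set \<alpha> \<subseteq> A \<Longrightarrow> map Gen \<alpha> \<in> carrier (free_group A)"
  by (auto simp: free_group_def reduced_map_Gen)

lemma letter_inv_Gen: "letter_inv \<circ> Gen = GenInv" "letter_inv \<circ> GenInv = Gen"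
  by auto

text \<open>The homomorphism to the integers that sends every generator to 1. At
  \<alpha>\<beta>\<inverse> its value is |\<alpha>| - |\<beta>|, whichever \<alpha>, \<beta>
  represent the group element.\<close>

definition exponent_sum :: "'a letter list \<Rightarrow> int" where
  "exponent_sum w = (\<Sum>x\<leftarrow>w. case x of Gen a \<Rightarrow> 1 | GenInv a \<Rightarrow> - 1)"

text \<open>A cancelled pair contributes 1 and -1, so reduction does not affect the sum.\<close>

lemma exponent_sum_push: "exponent_sum (push x w) = exponent_sum (x # w)"
  by (cases w; cases x) (auto simp: push_def exponent_sum_def)

lemma exponent_sum_free_reduce: "exponent_sum (free_reduce w) = exponent_sum w"
proof (induction w)
  case (Cons x w)
  have "exponent_sum (free_reduce (x # w)) = exponent_sum (x # free_reduce w)"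
    by (simp add: free_reduce_def exponent_sum_push)
  then show ?case using Cons.IH by (simp add: exponent_sum_def)
qed (simp add: free_reduce_def)

lemma exponent_sum_append: "exponent_sum (u @ v) = exponent_sum u + exponent_sum v"
  by (simp add: exponent_sum_def)

lemma exponent_sum_Gen: "exponent_sum (map Gen \<alpha>) = int (length \<alpha>)"
  by (induction \<alpha>) (auto simp: exponent_sum_def)

lemma exponent_sum_inverse: "exponent_sum (rev (map letter_inv w)) = - exponent_sum w"
proof (induction w)
  case (Cons x w)
  then show ?case
    by (cases x) (simp_all add: exponent_sum_append, simp_all add: exponent_sum_def)
qed (simp add: exponent_sum_def)

section \<open>The partial action\<close>

lemma phi_append: "phi S (s @ t) = phi S s \<circ> phi S t"
  by (induction s) auto

lemma phi_dom_subset_tight: "phi_dom S t \<subseteq> tight S"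
  by (induction t) auto

context weakly_left_resolving
begin

section \<open>The maps of single letters\<close>

lemma phi_gen_eq:
  assumes "\<xi> \<in> V_letter S (GenInv a)" shows "phi_gen S a \<xi> = filter_cons S a \<xi>"
proof -
  from assms have \<xi>: "idem_filter S \<xi>" "Some ([], word_range S [a]) \<in> \<xi>"
    using tight_filter by (auto simp: V_idem_def)
  obtain \<gamma> where "has_word S \<xi> \<gamma>"
    using filter_has_word[OF \<xi>(1)] .
  then show ?thesis
    using glue_eq_filter_cons[OF \<xi>(1) _ \<xi>(2)] has_word_filter_word by (simp add: phi_gen_def)
qed

lemma filter_cons_V_letter:
  assumes "\<xi> \<in> V_letter S (GenInv a)"
  shows "filter_cons S a \<xi> \<in> V_letter S (Gen a)" "filter_drop S [a] (filter_cons S a \<xi>) = \<xi>"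
proof -
  from assms have \<xi>: "\<xi> \<in> tight S" "Some ([], word_range S [a]) \<in> \<xi>" "idem_filter S \<xi>"
    using tight_filter by (auto simp: V_idem_def)
  then show "filter_cons S a \<xi> \<in> V_letter S (Gen a)"
    by (simp add: V_idem_def tight_filter_cons filter_cons_contains)
  show "filter_drop S [a] (filter_cons S a \<xi>) = \<xi>"
    using \<xi> by (simp add: drop_cons)
qed

lemma filter_drop_V_letter:
  assumes "\<xi> \<in> V_letter S (Gen a)"
  shows "filter_drop S [a] \<xi> \<in> V_letter S (GenInv a)" "filter_cons S a (filter_drop S [a] \<xi>) = \<xi>"
proof -
  from assms have \<xi>: "\<xi> \<in> tight S" "Some ([a], word_range S [a]) \<in> \<xi>" "idem_filter S \<xi>"
    using tight_filter by (auto simp: V_idem_def)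
  then show "filter_drop S [a] \<xi> \<in> V_letter S (GenInv a)"
    by (simp add: V_idem_def tight_filter_drop filter_drop_contains)
  show "filter_cons S a (filter_drop S [a] \<xi>) = \<xi>"
    using \<xi> by (simp add: cons_drop)
qed

lemma phi_letter_Gen:
  "\<xi> \<in> V_letter S (GenInv a) \<Longrightarrow> phi_letter S (Gen a) \<xi> = filter_cons S a \<xi>"
  by (simp add: phi_gen_eq)

text \<open>The map of an inverse letter is a chosen preimage under \<open>phi_gen\<close>. Its left
  inverse \<open>filter_drop\<close> makes \<open>phi_gen\<close> injective on its domain, which
  forces the choice.\<close>

lemma phi_letter_GenInv:
  assumes "\<xi> \<in> V_letter S (Gen a)" shows "phi_letter S (GenInv a) \<xi> = filter_drop S [a] \<xi>"
proof -
  have "inj_on (phi_gen S a) (V_letter S (GenInv a))"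
    by (rule inj_on_inverseI[of _ "filter_drop S [a]"])
      (simp add: phi_gen_eq filter_cons_V_letter(2) del: V_letter.simps)
  then have "inv_into (V_letter S (GenInv a)) (phi_gen S a) \<xi> = filter_drop S [a] \<xi>"
    using filter_drop_V_letter[OF assms] phi_gen_eq by (intro inv_into_f_eq) (simp_all del: V_letter.simps)
  then show ?thesis by simp
qed

lemma phi_letter_inverse:
  assumes "\<xi> \<in> V_letter S (letter_inv x)"
  shows "phi_letter S x \<xi> \<in> V_letter S x" "phi_letter S (letter_inv x) (phi_letter S x \<xi>) = \<xi>"
  by (atomize (full), use assms in \<open>cases x\<close>)
    (simp_all add: phi_letter_Gen phi_letter_GenInv filter_cons_V_letter filter_drop_V_letter
      del: V_letter.simps phi_letter.simps)

lemma V_letter_subset_tight: "V_letter S x \<subseteq> tight S"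
  by (cases x) (auto simp: V_idem_def)

section \<open>Composition along words and free reduction\<close>

lemma phi_tight: "\<xi> \<in> phi_dom S t \<Longrightarrow> phi S t \<xi> \<in> tight S"
proof (cases t)
  case (Cons x s)
  then show "\<xi> \<in> phi_dom S t \<Longrightarrow> ?thesis"
    using phi_letter_inverse(1) V_letter_subset_tight by auto
qed simp

text \<open>Without reduction the domain of a concatenation is exactly that of the composite. After
  reduction only an inclusion remains, see \<open>phi_free_reduce\<close>.\<close>

lemma phi_dom_append: "\<xi> \<in> phi_dom S (s @ t) \<longleftrightarrow> \<xi> \<in> phi_dom S t \<and> phi S t \<xi> \<in> phi_dom S s"
  by (induction s) (use phi_tight in \<open>auto simp: phi_append\<close>)

lemma phi_inverse:
  assumes "\<xi> \<in> phi_dom S t"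
  shows "phi S t \<xi> \<in> phi_dom S (rev (map letter_inv t)) \<and>
    phi S (rev (map letter_inv t)) (phi S t \<xi>) = \<xi>"
  using assms
proof (induction t)
  case (Cons x t)
  then have "phi S t \<xi> \<in> V_letter S (letter_inv x)" by simp
  note inverse = phi_letter_inverse[OF this]
  moreover have "\<xi> \<in> phi_dom S t" using Cons.prems by simp
  ultimately show ?case
    using Cons.IH V_letter_subset_tight by (auto simp: phi_append phi_dom_append)
qed simp

text \<open>Cancelling x against its inverse removes a detour that is the identity where it is
  defined. The shorter word may have a larger domain, hence only one implication.\<close>

lemma phi_push:
  assumes "\<xi> \<in> phi_dom S (x # t)"
  shows "\<xi> \<in> phi_dom S (push x t) \<and> phi S (push x t) \<xi> = phi S (x # t) \<xi>"
proof (cases "\<exists>s. t = letter_inv x # s")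
  case True
  then obtain s where s: "t = letter_inv x # s" ..
  with assms have "\<xi> \<in> phi_dom S s" "phi S s \<xi> \<in> V_letter S (letter_inv (letter_inv x))"
    by auto
  then show ?thesis
    using phi_letter_inverse(2)[of "phi S s \<xi>" "letter_inv x"] s by (simp add: push_def)
next
  case False
  then have "push x t = x # t" by (auto simp: push_def split: list.split)
  then show ?thesis using assms by simp
qed

text \<open>For a concatenation of two words this is the law of a partial action: the composite of
  the maps of two group elements is a restriction of the map of their product.\<close>

lemma phi_free_reduce:
  assumes "\<xi> \<in> phi_dom S t"
  shows "\<xi> \<in> phi_dom S (free_reduce t) \<and> phi S (free_reduce t) \<xi> = phi S t \<xi>"
  using assms
proof (induction t)
  case (Cons x t)
  then have "\<xi> \<in> phi_dom S (x # free_reduce t)" "phi S (x # free_reduce t) \<xi> = phi S (x # t) \<xi>"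
    by auto
  then show ?case using phi_push[of \<xi> x "free_reduce t"] by (simp add: free_reduce_def)
qed (simp add: free_reduce_def)

text \<open>As (a\<alpha>)\<inverse> = \<alpha>\<inverse>a\<inverse>, the first letter is removed
  first. One membership guarantees all removals: testing for r(\<alpha>) after removing a means
  testing for r(\<alpha>) \<inter> r(a\<alpha>) = r(a\<alpha>) before.\<close>

lemma phi_inverse_word:
  assumes "\<xi> \<in> tight S" "\<alpha> \<noteq> [] \<Longrightarrow> Some (\<alpha>, word_range S \<alpha>) \<in> \<xi>"
  shows "\<xi> \<in> phi_dom S (rev (map GenInv \<alpha>)) \<and> phi S (rev (map GenInv \<alpha>)) \<xi> = filter_drop S \<alpha> \<xi>"
  using assms
proof (induction \<alpha> arbitrary: \<xi>)
  case Nil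
  then show ?case by (simp add: filter_drop_Nil tight_filter)
next
  case (Cons a \<alpha>)
  have \<xi>: "idem_filter S \<xi>" and mem: "Some ([a] @ \<alpha>, word_range S ([a] @ \<alpha>)) \<in> \<xi>"
    using Cons.prems tight_filter by auto
  then have a: "\<xi> \<in> V_letter S (Gen a)"
    using filter_word_range[OF \<xi> mem] Cons.prems by (simp add: V_idem_def)
  let ?\<eta> = "filter_drop S [a] \<xi>"
  have "?\<eta> \<in> tight S"
    using filter_drop_V_letter(1)[OF a] V_letter_subset_tight by blast
  moreover have "Some (\<alpha>, word_range S \<alpha>) \<in> ?\<eta>" if "\<alpha> \<noteq> []"
  proof -
    have "\<alpha> \<in> labels S"
      using filter_in_family(3)[OF \<xi> mem] labels_appendD2 by blast
    moreover have "word_range S \<alpha> \<inter> word_range S ([a] @ \<alpha>) = word_range S ([a] @ \<alpha>)"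
      using word_range_suffix by blast
    ultimately show ?thesis
      using mem that by (simp add: in_filter_drop family_at_def word_range_in_family)
  qed
  ultimately have "?\<eta> \<in> phi_dom S (rev (map GenInv \<alpha>)) \<and>
      phi S (rev (map GenInv \<alpha>)) ?\<eta> = filter_drop S \<alpha> ?\<eta>"
    by (rule Cons.IH)
  then show ?case
    using a Cons.prems(1) phi_letter_GenInv[OF a] filter_drop_append[OF \<xi>, of \<alpha> "[a]"]
    by (simp add: phi_append phi_dom_append del: V_letter.simps phi_letter.simps)
qed

lemma phi_dom_inverse_word:
  assumes "\<xi> \<in> phi_dom S (rev (map GenInv \<alpha>))" "\<alpha> \<noteq> []"
  shows "Some (\<alpha>, word_range S \<alpha>) \<in> \<xi>"
  using assms
proof (induction \<alpha> arbitrary: \<xi>)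
  case (Cons a \<alpha>)
  then have a: "\<xi> \<in> V_letter S (Gen a)" and "phi_letter S (GenInv a) \<xi> \<in> phi_dom S (rev (map GenInv \<alpha>))"
    by (auto simp: phi_dom_append simp del: phi_letter.simps)
  then have drop: "filter_drop S [a] \<xi> \<in> phi_dom S (rev (map GenInv \<alpha>))"
    by (simp add: phi_letter_GenInv del: phi_letter.simps V_letter.simps)
  show ?case
  proof (cases "\<alpha> = []")
    case True
    then show ?thesis using a by (simp add: V_idem_def)
  next
    case False
    have "word_range S \<alpha> \<inter> word_range S ([a] @ \<alpha>) = word_range S ([a] @ \<alpha>)"
      using word_range_suffix by blast
    then show ?thesis
      using Cons.IH[OF drop False] by (simp add: in_filter_drop)
  qed
qed simp

text \<open>Since \<open>V\<^sub>a\<close> and \<open>V\<^sub>b\<close> are disjoint for \<open>a \<noteq> b\<close>, a reduced word with non-empty domain contains no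
  factor \<open>a\<inverse>b\<close>.\<close>

lemma phi_dom_reduced_word:
  assumes "reduced t" "\<xi> \<in> phi_dom S t"
  obtains \<alpha> \<beta> where "t = map Gen \<alpha> @ rev (map GenInv \<beta>)"
  using assms
proof (induction t arbitrary: thesis)
  case Nil
  then show ?case by (metis append_Nil list.map(1) rev.simps(1))
next
  case (Cons x t)
  then obtain \<alpha> \<beta> where t: "t = map Gen \<alpha> @ rev (map GenInv \<beta>)"
    using reduced_tl by (metis (no_types, lifting) mem_Collect_eq phi_dom.simps(2))
  show ?case
  proof (cases x)
    case (Gen a)
    then show ?thesis using Cons.prems(1)[of "a # \<alpha>" \<beta>] t by simp
  next
    case x: (GenInv a)
    show ?thesis
    proof (cases \<alpha>)
      case Nil
      \<comment> \<open>Here a\<inverse>\<beta>\<inverse> = (\<beta>a)\<inverse>, so the new letter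
        goes to the end of \<beta>.\<close>
      then show ?thesis using Cons.prems(1)[of "[]" "\<beta> @ [a]"] t x by simp
    next
      case (Cons b \<alpha>')
      let ?s = "map Gen \<alpha>' @ rev (map GenInv \<beta>)"
      let ?\<eta> = "phi S (Gen b # ?s) \<xi>"
      have t': "t = Gen b # ?s" using t Cons by simp
      have "b \<noteq> a" using \<open>reduced (x # t)\<close> x t' by auto
      have "phi S ?s \<xi> \<in> V_letter S (letter_inv (Gen b))" "?\<eta> \<in> V_letter S (Gen a)"
        using \<open>\<xi> \<in> phi_dom S (x # t)\<close> x t' by simp_all
      then have "?\<eta> \<in> V_letter S (Gen b)" "?\<eta> \<in> V_letter S (Gen a)"
        using phi_letter_inverse(1)[of "phi S ?s \<xi>" "Gen b"] by simp_all
      then have "Some ([b], word_range S [b]) \<in> ?\<eta>" "Some ([a], word_range S [a]) \<in> ?\<eta>" "idem_filter S ?\<eta>"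
        using tight_filter by (auto simp: V_idem_def)
      then show ?thesis
        using filter_comparable[of ?\<eta> "[b]" _ "[a]"] \<open>b \<noteq> a\<close> by fastforce
    qed
  qed
qed

section \<open>Open domains and continuity\<close>

lemma continuous_phi_letter:
  "continuous_map (subtopology (tight_space S) (V_letter S (letter_inv x))) (tight_space S)
    (phi_letter S x)"
proof -
  let ?X = "subtopology (tight_space S) (V_letter S (letter_inv x))"
  have top: "topspace ?X = V_letter S (letter_inv x)"
    using V_letter_subset_tight by auto
  have X: "?X = subtopology (filter_space S) (V_letter S (letter_inv x))"
    using V_letter_subset_tight[of "letter_inv x"]
    by (simp add: tight_space_def subtopology_subtopology Int_absorb1)
  have "continuous_map ?X (filter_space S) (phi_letter S x)"
  proof (cases x)
    case (Gen a)
    have "continuous_map ?X (filter_space S) (filter_cons S a)"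
      unfolding X by (rule continuous_map_from_subtopology_mono[OF continuous_filter_cons])
        (auto simp: Gen V_idem_def)
    then show ?thesis
      by (rule continuous_map_eq) (use top in \<open>simp add: Gen phi_gen_eq\<close>)
  next
    case (GenInv a)
    have "continuous_map ?X (filter_space S) (filter_drop S [a])"
      unfolding X by (rule continuous_map_from_subtopology_mono[OF continuous_filter_drop])
        (auto simp: GenInv V_idem_def)
    then show ?thesis
      by (rule continuous_map_eq)
        (use top phi_letter_GenInv[of _ a] in \<open>simp add: GenInv del: V_letter.simps\<close>)
  qed
  moreover have "phi_letter S x \<in> topspace ?X \<rightarrow> tight S"
    unfolding top using phi_letter_inverse(1) V_letter_subset_tight by blast
  ultimately have "continuous_map ?X (subtopology (filter_space S) (tight S)) (phi_letter S x)"
    by (rule continuous_map_into_subtopology)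
  then show ?thesis by (simp add: tight_space_def)
qed

lemma openin_V_letter: "openin (tight_space S) (V_letter S x)"
  by (cases x) (simp_all add: openin_V_idem)

text \<open>The two claims are proved together because the domain for \<open>x # t\<close> is a
  preimage under \<open>phi S t\<close>, open by continuity of that map on an open set.\<close>

lemma phi_open_continuous:
  "openin (tight_space S) (phi_dom S t) \<and>
   continuous_map (subtopology (tight_space S) (phi_dom S t)) (tight_space S) (phi S t)"
proof (induction t)
  case Nil
  show ?case by (metis continuous_map_from_subtopology continuous_map_id openin_topspace
        phi.simps(1) phi_dom.simps(1) topspace_tight_space)
next
  case (Cons x t)
  let ?T = "tight_space S" and ?V = "V_letter S (letter_inv x)"
  have dom: "phi_dom S (x # t) = {\<xi> \<in> topspace (subtopology ?T (phi_dom S t)). phi S t \<xi> \<in> ?V}"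
    using phi_dom_subset_tight by auto
  have "openin (subtopology ?T (phi_dom S t)) (phi_dom S (x # t))"
    unfolding dom using Cons by (intro openin_continuous_map_preimage[OF _ openin_V_letter]) simp
  then have "openin ?T (phi_dom S (x # t))"
    using Cons openin_trans_full by blast
  moreover have "continuous_map (subtopology ?T (phi_dom S (x # t))) (subtopology ?T ?V) (phi S t)"
  proof (rule continuous_map_into_subtopology)
    show "continuous_map (subtopology ?T (phi_dom S (x # t))) ?T (phi S t)"
      using Cons by (elim conjE continuous_map_from_subtopology_mono) auto
  qed auto
  then have "continuous_map (subtopology ?T (phi_dom S (x # t))) ?T (phi S (x # t))"
    using continuous_map_compose[OF _ continuous_phi_letter[of x]] by simp
  ultimately show ?case ..
qed

lemmas openin_phi_dom = phi_open_continuous[THEN conjunct1]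
  and continuous_phi = phi_open_continuous[THEN conjunct2]

end

section \<open>Transport of topological groupoids\<close>

text \<open>Composability is assumed as an equality of sets, not merely as preservation: a
  composable pair of Y must lift to X before an axiom can be pulled back.\<close>

lemma topological_groupoid_iso_transport:
  assumes X: "topological_groupoid X"
    and homeo: "homeomorphic_map (gtop X) (gtop Y) f"
    and arrows: "arrows Y = f ` arrows X"
    and composable: "composable Y = map_prod f f ` composable X"
    and mult: "\<And>x y. (x, y) \<in> composable X \<Longrightarrow> f (gmult X x y) = gmult Y (f x) (f y)"
    and inv: "\<And>x. x \<in> arrows X \<Longrightarrow> f (ginv X x) = ginv Y (f x)"
  shows "topological_groupoid_iso X Y f"
proof -
  interpret X: topological_groupoid X by (fact X)
  from homeo obtain g where g: "homeomorphic_maps (gtop X) (gtop Y) f g"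
    by (auto simp: homeomorphic_map_maps)
  have gf: "g (f x) = x" if "x \<in> arrows X" for x
    using g that X.topspace_arrows by (simp add: homeomorphic_maps_def)
  have f_cont: "continuous_map (gtop X) (gtop Y) f" and g_cont: "continuous_map (gtop Y) (gtop X) g"
    using g by (simp_all add: homeomorphic_maps_def)
  have top: "topspace (gtop Y) = arrows Y"
    using homeomorphic_imp_surjective_map[OF homeo] X.topspace_arrows arrows by simp
  have comp_arrows: "x \<in> arrows X" "y \<in> arrows X" if "(x, y) \<in> composable X" for x y
    using X.composable_arrows that by auto
  have comp_iff: "(f x, f y) \<in> composable Y \<longleftrightarrow> (x, y) \<in> composable X"
    if xy: "x \<in> arrows X" "y \<in> arrows X" for x y
  proof
    assume "(f x, f y) \<in> composable Y"
    then obtain x' y' where "f x = f x'" "f y = f y'" "(x', y') \<in> composable X"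
      unfolding composable by auto
    with gf xy comp_arrows show "(x, y) \<in> composable X" by metis
  next
    assume "(x, y) \<in> composable X"
    then have "map_prod f f (x, y) \<in> composable Y" unfolding composable by (rule imageI)
    then show "(f x, f y) \<in> composable Y" by simp
  qed
  have comp_E: "\<exists>x y. u = f x \<and> v = f y \<and> (x, y) \<in> composable X" if "(u, v) \<in> composable Y" for u v
    using that composable by auto
  \<comment> \<open>The lifts of the two pairs agree on the middle arrow because f is injective on
    arrows.\<close>
  have comp_E3: "\<exists>x y z. u = f x \<and> v = f y \<and> w = f z \<and> (x, y) \<in> composable X \<and> (y, z) \<in> composable X"
    if "(u, v) \<in> composable Y" "(v, w) \<in> composable Y" for u v w
  proof -
    from comp_E[OF that(1)] comp_E[OF that(2)] obtain x y y' z where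
      *: "u = f x" "v = f y" "(x, y) \<in> composable X" "v = f y'" "w = f z" "(y', z) \<in> composable X" by blast
    then have "y = y'" using gf comp_arrows by metis
    with * show ?thesis by blast
  qed
  note mult_sym = mult[symmetric] and inv_sym = inv[symmetric]
  have grpd: "groupoid Y"
  proof
    show "composable Y \<subseteq> arrows Y \<times> arrows Y"
      using X.composable_arrows by (auto simp: composable arrows)
    show "gmult Y u v \<in> arrows Y" if "(u, v) \<in> composable Y" for u v
      using comp_E[OF that] X.mult_closed by (auto simp: mult_sym arrows)
    show "ginv Y u \<in> arrows Y" if "u \<in> arrows Y" for u
      using that X.inv_closed by (auto simp: arrows inv_sym)
    show "ginv Y (ginv Y u) = u" if "u \<in> arrows Y" for u
      using that X.inv_closed X.inv_inv by (auto simp: arrows inv_sym)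
    show "(gmult Y u v, w) \<in> composable Y \<and> (u, gmult Y v w) \<in> composable Y"
      if "(u, v) \<in> composable Y" "(v, w) \<in> composable Y" for u v w
      using comp_E3[OF that] X.composable_mult X.mult_closed comp_arrows
      by (auto simp: mult_sym comp_iff)
    show "gmult Y (gmult Y u v) w = gmult Y u (gmult Y v w)"
      if "(u, v) \<in> composable Y" "(v, w) \<in> composable Y" for u v w
      using comp_E3[OF that] X.composable_mult X.mult_assoc by (auto simp: mult_sym)
    show "(ginv Y u, u) \<in> composable Y \<and> (u, ginv Y u) \<in> composable Y" if "u \<in> arrows Y" for u
      using that X.composable_inv X.inv_closed by (auto simp: arrows inv_sym comp_iff)
    show "gmult Y (ginv Y u) (gmult Y u v) = v" if uv: "(u, v) \<in> composable Y" for u v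
    proof -
      from comp_E[OF uv] obtain x y where xy: "u = f x" "v = f y" "(x, y) \<in> composable X" by blast
      have "(ginv X x, gmult X x y) \<in> composable X"
        using X.composable_mult[of "ginv X x" x y] X.composable_inv[of x] comp_arrows xy by blast
      then show ?thesis
        using xy comp_arrows X.left_cancel by (simp add: mult_sym inv_sym)
    qed
    show "gmult Y (gmult Y u v) (ginv Y v) = u" if uv: "(u, v) \<in> composable Y" for u v
    proof -
      from comp_E[OF uv] obtain x y where xy: "u = f x" "v = f y" "(x, y) \<in> composable X" by blast
      have "(gmult X x y, ginv X y) \<in> composable X"
        using X.composable_mult[of x y "ginv X y"] X.composable_inv[of y] comp_arrows xy by blast
      then show ?thesis
        using xy comp_arrows X.right_cancel by (simp add: mult_sym inv_sym)
    qed
  qed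
  let ?PY = "prod_topology (gtop Y) (gtop Y)" and ?PX = "prod_topology (gtop X) (gtop X)"
  have "continuous_map ?PY ?PX (\<lambda>p. (g (fst p), g (snd p)))"
    using continuous_map_compose[OF continuous_map_fst g_cont]
      continuous_map_compose[OF continuous_map_snd g_cont]
    by (intro continuous_map_pairedI) (simp_all add: o_def)
  then have "continuous_map (subtopology ?PY (composable Y)) (subtopology ?PX (composable X))
      (\<lambda>p. (g (fst p), g (snd p)))"
    by (intro continuous_map_into_subtopology continuous_map_from_subtopology)
      (auto dest!: comp_E simp: gf comp_arrows)
  \<comment> \<open>On composable pairs the multiplication of Y is the inverse g on both factors,
    followed by the multiplication of X and by f.\<close>
  from continuous_map_compose[OF continuous_map_compose[OF this X.continuous_mult] f_cont]
  have "continuous_map (subtopology ?PY (composable Y)) (gtop Y) (\<lambda>(u, v). gmult Y u v)"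
  proof (rule continuous_map_eq)
    fix p assume "p \<in> topspace (subtopology ?PY (composable Y))"
    then have "(fst p, snd p) \<in> composable Y" by simp
    from comp_E[OF this]
    show "(f \<circ> ((\<lambda>(x, y). gmult X x y) \<circ> (\<lambda>p. (g (fst p), g (snd p))))) p = (\<lambda>(u, v). gmult Y u v) p"
      by (auto simp: gf comp_arrows mult split_beta)
  qed
  moreover have "continuous_map (gtop Y) (gtop Y) (ginv Y)"
  proof (rule continuous_map_eq)
    show "continuous_map (gtop Y) (gtop Y) (f \<circ> (ginv X \<circ> g))"
      by (intro continuous_map_compose[OF _ f_cont] continuous_map_compose[OF g_cont X.continuous_inv])
    show "(f \<circ> (ginv X \<circ> g)) u = ginv Y u" if "u \<in> topspace (gtop Y)" for u
      using that by (auto simp: top arrows gf inv)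
  qed
  ultimately have "topological_groupoid Y"
    using grpd top by (simp add: topological_groupoid_def topological_groupoid_axioms_def)
  then show ?thesis
    unfolding topological_groupoid_iso_def using X homeo mult inv comp_iff by auto
qed

text \<open>\<open>topology P\<close> has the open sets given by P only if P satisfies the axioms of
  a topology. Injectivity supplies the intersections; in the application this shows that unions of
  sets Z are closed under finite intersections.\<close>

lemma homeomorphic_map_image_topology:
  assumes inj: "inj_on f (topspace X)" and P: "\<And>W. P W \<longleftrightarrow> (\<exists>U. openin X U \<and> W = f ` U)"
  shows "homeomorphic_map X (topology P) f"
proof -
  have "istopology P"
    unfolding istopology_def
  proof (intro conjI allI impI)
    fix S T assume "P S" "P T"
    then obtain U V where UV: "openin X U" "S = f ` U" "openin X V" "T = f ` V"
      using P by auto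
    then have "S \<inter> T = f ` (U \<inter> V)"
      by (simp add: inj_on_image_Int[OF inj openin_subset[OF UV(1)] openin_subset[OF UV(3)]])
    moreover have "openin X (U \<inter> V)" using UV by blast
    ultimately show "P (S \<inter> T)" unfolding P by blast
  next
    fix K assume K: "\<forall>S\<in>K. P S"
    \<comment> \<open>Uniting all open sets with image in K avoids choosing a preimage for each
      member of K.\<close>
    let ?U = "\<Union>{U. openin X U \<and> f ` U \<in> K}"
    have "\<Union>K = f ` ?U"
    proof
      show "\<Union>K \<subseteq> f ` ?U"
      proof
        fix x assume "x \<in> \<Union>K"
        then obtain S where "S \<in> K" "x \<in> S" by blast
        moreover from this K obtain U where "openin X U" "S = f ` U" unfolding P by blast
        ultimately show "x \<in> f ` ?U" by blast
      qed
    qed auto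
    moreover have "openin X ?U" by auto
    ultimately show "P (\<Union>K)" unfolding P by blast
  qed
  then have open_iff: "openin (topology P) W \<longleftrightarrow> (\<exists>U. openin X U \<and> W = f ` U)" for W
    by (simp add: P)
  have top: "topspace (topology P) = f ` topspace X"
  proof
    show "topspace (topology P) \<subseteq> f ` topspace X"
      using open_iff[of "topspace (topology P)"] openin_subset by force
    show "f ` topspace X \<subseteq> topspace (topology P)"
      using open_iff by (intro openin_subset) blast
  qed
  have "continuous_map X (topology P) f"
    unfolding continuous_map_def
  proof (intro conjI allI impI)
    fix W assume "openin (topology P) W"
    then obtain U where U: "openin X U" "W = f ` U" using open_iff by auto
    then have "{x \<in> topspace X. f x \<in> W} = U"
      using inj openin_subset[OF U(1)] by (auto dest: inj_onD)
    with U show "openin X {x \<in> topspace X. f x \<in> W}" by simp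
  qed (use top in auto)
  then show ?thesis
    using open_iff top inj by (intro bijective_open_imp_homeomorphic_map) (auto simp: open_map_def)
qed

lemma openin_prod_topologyE:
  assumes "openin (prod_topology X Y) W" "(x, y) \<in> W"
  obtains U V where "openin X U" "openin Y V" "x \<in> U" "y \<in> V" "U \<times> V \<subseteq> W"
  using assms unfolding openin_prod_topology_alt by meson

section \<open>The two groupoids\<close>

lemma quot_word_eq:
  assumes "set \<alpha> \<subseteq> alphabet S" "set \<beta> \<subseteq> alphabet S"
  shows "quot_word S \<alpha> \<beta> = free_reduce (map Gen \<alpha> @ rev (map GenInv \<beta>))"
  using assms by (simp add: quot_word_def inv_free_group map_Gen_free_group letter_inv_Gen)
    (simp add: free_group_def)

lemma exponent_sum_quot_word:
  assumes "set \<alpha> \<subseteq> alphabet S" "set \<beta> \<subseteq> alphabet S"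
  shows "exponent_sum (quot_word S \<alpha> \<beta>) = int (length \<alpha>) - int (length \<beta>)"
  using exponent_sum_inverse[of "map Gen \<beta>"] assms
  by (simp add: quot_word_eq exponent_sum_free_reduce exponent_sum_append exponent_sum_Gen letter_inv_Gen)

lemma quot_word_append_cancel:
  assumes "set \<alpha> \<subseteq> alphabet S" "set \<beta> \<subseteq> alphabet S" "set \<delta> \<subseteq> alphabet S"
  shows "quot_word S (\<alpha> @ \<delta>) (\<beta> @ \<delta>) = quot_word S \<alpha> \<beta>"
proof -
  have "free_reduce (map Gen \<delta> @ rev (map GenInv \<delta>)) = []"
    using free_reduce_inverse[of "rev (map GenInv \<delta>)"] by (simp add: rev_map letter_inv_Gen)
  then have "free_reduce (map Gen \<alpha> @ (map Gen \<delta> @ rev (map GenInv \<delta>)) @ rev (map GenInv \<beta>)) =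
      free_reduce (map Gen \<alpha> @ rev (map GenInv \<beta>))"
    by (metis append_Nil free_reduce_append_left free_reduce_append_right)
  then show ?thesis using assms by (simp add: quot_word_eq)
qed

lemma quot_word_carrier:
  assumes "set \<alpha> \<subseteq> alphabet S" "set \<beta> \<subseteq> alphabet S"
  shows "quot_word S \<alpha> \<beta> \<in> carrier (free S)"
proof -
  interpret group "free S" by (rule group_free_group)
  show ?thesis using assms by (simp add: quot_word_def map_Gen_free_group)
qed

text \<open>This is \<Theta>, defined through the group element instead of a decomposition
  \<alpha>\<beta>\<inverse>, so that independence of the decomposition holds by
  construction.\<close>

definition degree_map :: "'x \<times> 'a letter list \<times> 'y \<Rightarrow> 'x \<times> int \<times> 'y" where
  "degree_map = (\<lambda>(\<xi>, t, \<eta>). (\<xi>, exponent_sum t, \<eta>))"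

context weakly_left_resolving
begin

section \<open>The topological groupoid of the partial action\<close>

lemma action_arrows:
  "(\<xi>, t, \<eta>) \<in> arrows (action_groupoid S) \<longleftrightarrow>
     t \<in> carrier (free S) \<and> \<eta> \<in> phi_dom S t \<and> \<xi> = phi S t \<eta>"
  using phi_tight by (auto simp: action_groupoid_def Let_def)

lemma action_composable:
  "((\<xi>, s, \<eta>), (\<eta>', t, \<rho>)) \<in> composable (action_groupoid S) \<longleftrightarrow>
     (\<xi>, s, \<eta>) \<in> arrows (action_groupoid S) \<and> (\<eta>', t, \<rho>) \<in> arrows (action_groupoid S) \<and> \<eta> = \<eta>'"
  by (auto simp: action_groupoid_def Let_def)

lemma action_gmult:
  "gmult (action_groupoid S) (\<xi>, s, \<eta>) (\<eta>', t, \<rho>) = (\<xi>, s \<otimes>\<^bsub>free S\<^esub> t, \<rho>)"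
  by (simp add: action_groupoid_def Let_def)

lemma action_ginv: "ginv (action_groupoid S) (\<xi>, t, \<eta>) = (\<eta>, inv\<^bsub>free S\<^esub> t, \<xi>)"
  by (simp add: action_groupoid_def Let_def)

lemma action_gtop: "gtop (action_groupoid S) =
    subtopology (prod_topology (tight_space S)
      (prod_topology (discrete_topology (carrier (free S))) (tight_space S)))
    (arrows (action_groupoid S))"
  by (simp add: action_groupoid_def Let_def)

lemma phi_mult:
  assumes "\<eta> \<in> phi_dom S t" "phi S t \<eta> \<in> phi_dom S s"
  shows "\<eta> \<in> phi_dom S (s \<otimes>\<^bsub>free S\<^esub> t) \<and> phi S (s \<otimes>\<^bsub>free S\<^esub> t) \<eta> = phi S s (phi S t \<eta>)"
  using phi_free_reduce[of \<eta> "s @ t"] assms by (simp add: free_group_def phi_dom_append phi_append)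

lemma phi_group_inverse:
  assumes "t \<in> carrier (free S)" "\<eta> \<in> phi_dom S t"
  shows "phi S t \<eta> \<in> phi_dom S (inv\<^bsub>free S\<^esub> t) \<and> phi S (inv\<^bsub>free S\<^esub> t) (phi S t \<eta>) = \<eta>"
  using phi_inverse[OF assms(2)] assms(1) by (simp add: inv_free_group)

lemma topspace_action: "topspace (gtop (action_groupoid S)) = arrows (action_groupoid S)"
  using phi_tight by (auto simp: action_gtop action_arrows dest: subsetD[OF phi_dom_subset_tight])

lemma groupoid_action: "groupoid (action_groupoid S)" (is "groupoid ?G")
proof -
  interpret F: group "free S" by (rule group_free_group)
  show ?thesis
  proof
    show "composable ?G \<subseteq> arrows ?G \<times> arrows ?G"
      by (auto simp: action_composable)
    show "gmult ?G x y \<in> arrows ?G" if "(x, y) \<in> composable ?G" for x y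
      using that phi_mult by (cases x; cases y) (auto simp: action_composable action_gmult action_arrows)
    show "ginv ?G x \<in> arrows ?G" if "x \<in> arrows ?G" for x
      using that phi_group_inverse by (cases x) (auto simp: action_arrows action_ginv)
    show "ginv ?G (ginv ?G x) = x" if "x \<in> arrows ?G" for x
      using that by (cases x) (auto simp: action_arrows action_ginv)
    show "(gmult ?G x y, z) \<in> composable ?G \<and> (x, gmult ?G y z) \<in> composable ?G"
      if "(x, y) \<in> composable ?G" "(y, z) \<in> composable ?G" for x y z
      using that phi_mult
      by (cases x; cases y; cases z) (auto simp: action_composable action_gmult action_arrows)
    show "gmult ?G (gmult ?G x y) z = gmult ?G x (gmult ?G y z)"
      if "(x, y) \<in> composable ?G" "(y, z) \<in> composable ?G" for x y z
      using that
      by (cases x; cases y; cases z) (auto simp: action_composable action_gmult action_arrows F.m_assoc)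
    show "(ginv ?G x, x) \<in> composable ?G \<and> (x, ginv ?G x) \<in> composable ?G" if "x \<in> arrows ?G" for x
      using that phi_group_inverse
      by (cases x) (auto simp: action_composable action_ginv action_arrows)
    show "gmult ?G (ginv ?G x) (gmult ?G x y) = y" if "(x, y) \<in> composable ?G" for x y
      using that phi_group_inverse by (cases x; cases y)
        (auto simp: action_composable action_gmult action_ginv action_arrows F.m_assoc[symmetric])
    show "gmult ?G (gmult ?G x y) (ginv ?G y) = x" if "(x, y) \<in> composable ?G" for x y
      using that by (cases x; cases y)
        (auto simp: action_composable action_gmult action_ginv action_arrows F.m_assoc)
  qed
qed

lemma topological_groupoid_action: "topological_groupoid (action_groupoid S)"
proof -
  interpret F: group "free S" by (rule group_free_group)
  interpret G: groupoid "action_groupoid S" by (rule groupoid_action)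
  let ?G = "action_groupoid S" and ?T = "tight_space S" and ?D = "discrete_topology (carrier (free S))"
  let ?P = "prod_topology ?T (prod_topology ?D ?T)"
  let ?m = "\<lambda>(x, y). gmult ?G x y"
  note fst = continuous_map_fst_of and snd = continuous_map_snd_of
  \<comment> \<open>The formula makes sense for all pairs, so continuity is proved on the full
    product and then restricted to composable pairs.\<close>
  have m: "?m = (\<lambda>p. (fst (fst p),
      fst (snd (fst p)) \<otimes>\<^bsub>free S\<^esub> fst (snd (snd p)), snd (snd (snd p))))"
    by (auto simp: action_gmult)
  have id: "continuous_map (prod_topology ?P ?P) (prod_topology ?P ?P) id" by simp
  have p1: "continuous_map (prod_topology ?P ?P) ?T (\<lambda>p. fst (fst p))"
    using fst[OF fst[OF id]] by (simp add: o_def)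
  have p3: "continuous_map (prod_topology ?P ?P) ?T (\<lambda>p. snd (snd (snd p)))"
    using snd[OF snd[OF snd[OF id]]] by (simp add: o_def)
  have "continuous_map (prod_topology ?P ?P) (prod_topology ?D ?D)
      (\<lambda>p. (fst (snd (fst p)), fst (snd (snd p))))"
    using fst[OF snd[OF fst[OF id]]] fst[OF snd[OF snd[OF id]]]
    by (intro continuous_map_pairedI) (simp_all add: o_def)
  moreover have "continuous_map (prod_topology ?D ?D) ?D (\<lambda>(s, t). s \<otimes>\<^bsub>free S\<^esub> t)"
    by (auto simp flip: prod_topology_discrete_topology)
  ultimately have p2: "continuous_map (prod_topology ?P ?P) ?D
      (\<lambda>p. fst (snd (fst p)) \<otimes>\<^bsub>free S\<^esub> fst (snd (snd p)))"
    by (auto dest: continuous_map_compose simp: o_def)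
  have "continuous_map (prod_topology ?P ?P) ?P ?m"
    unfolding m by (intro continuous_map_pairedI p1 p2 p3)
  then have "continuous_map (subtopology (prod_topology (gtop ?G) (gtop ?G)) (composable ?G)) ?P ?m"
    by (simp add: action_gtop prod_topology_subtopology subtopology_subtopology
        continuous_map_from_subtopology)
  then have "continuous_map (subtopology (prod_topology (gtop ?G) (gtop ?G)) (composable ?G))
      (subtopology ?P (arrows ?G)) ?m"
    by (rule continuous_map_into_subtopology) (auto intro: G.mult_closed)
  moreover have "continuous_map (gtop ?G) (subtopology ?P (arrows ?G)) (ginv ?G)"
  proof (rule continuous_map_into_subtopology)
    have id: "continuous_map (gtop ?G) ?P id"
      by (simp add: action_gtop continuous_map_from_subtopology)
    have "continuous_map ?D ?D (\<lambda>t. inv\<^bsub>free S\<^esub> t)" by simp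
    from continuous_map_compose[OF fst[OF snd[OF id]] this]
    have "continuous_map (gtop ?G) ?D (\<lambda>x. inv\<^bsub>free S\<^esub> (fst (snd x)))"
      by (simp add: o_def)
    moreover have "continuous_map (gtop ?G) ?T (\<lambda>x. snd (snd x))" "continuous_map (gtop ?G) ?T fst"
      using snd[OF snd[OF id]] fst[OF id] by (simp_all add: o_def)
    ultimately have "continuous_map (gtop ?G) ?P (\<lambda>x. (snd (snd x), inv\<^bsub>free S\<^esub> (fst (snd x)), fst x))"
      by (intro continuous_map_pairedI)
    also have "(\<lambda>x. (snd (snd x), inv\<^bsub>free S\<^esub> (fst (snd x)), fst x)) = ginv ?G"
      by (auto simp: action_ginv)
    finally show "continuous_map (gtop ?G) ?P (ginv ?G)" .
  qed (use G.inv_closed topspace_action in auto)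
  ultimately show ?thesis
    by unfold_locales (simp_all add: topspace_action flip: action_gtop)
qed

section \<open>Decompositions of arrows\<close>

lemma tight_atD:
  assumes "\<xi> \<in> tight_at S \<gamma>" shows "\<xi> \<in> tight S" "idem_filter S \<xi>" "has_word S \<xi> \<gamma>"
  using assms tight_filter by (auto simp: tight_at_def)

lemma phi_inverse_eq_cut:
  assumes "\<alpha> \<in> labels S" "\<xi> \<in> tight_at S (\<alpha> \<cdot>\<^sub>w \<gamma>)"
  shows "\<xi> \<in> phi_dom S (inv\<^bsub>free S\<^esub> (map Gen \<alpha>)) \<and>
    phi S (inv\<^bsub>free S\<^esub> (map Gen \<alpha>)) \<xi> = cut S \<alpha> \<gamma> \<xi>"
  using phi_inverse_word[of \<xi> \<alpha>] has_word_contains[of \<xi> \<alpha> \<gamma>] cut_eq_filter_drop[of \<xi> \<alpha> \<gamma>]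
    tight_atD[OF assms(2)] labels_alphabet[OF assms(1)]
  by (simp add: inv_free_group map_Gen_free_group letter_inv_Gen)

text \<open>On filters with word \<alpha>\<gamma> the map of \<alpha>\<inverse> is defined and
  equals the cut, so the condition in terms of \<phi> is the one that defines \<Gamma>. One
  predicate can then describe the arrows of both groupoids.\<close>

lemma standard_form_iff:
  "standard_form S \<alpha> \<beta> \<gamma> \<xi> \<eta> \<longleftrightarrow>
     \<alpha> \<in> labels S \<and> \<beta> \<in> labels S \<and> \<gamma> \<in> fiwords S \<and>
     \<xi> \<in> tight_at S (\<alpha> \<cdot>\<^sub>w \<gamma>) \<and> \<eta> \<in> tight_at S (\<beta> \<cdot>\<^sub>w \<gamma>) \<and> cut S \<alpha> \<gamma> \<xi> = cut S \<beta> \<gamma> \<eta>"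
  unfolding standard_form_def using phi_inverse_eq_cut by auto

lemma standard_form_phi:
  assumes "standard_form S \<alpha> \<beta> \<gamma> \<xi> \<eta>"
  shows "\<eta> \<in> phi_dom S (map Gen \<alpha> @ rev (map GenInv \<beta>))"
    "\<xi> = phi S (map Gen \<alpha> @ rev (map GenInv \<beta>)) \<eta>"
proof -
  have \<alpha>: "set \<alpha> \<subseteq> alphabet S" and \<beta>: "set \<beta> \<subseteq> alphabet S"
    using assms labels_alphabet by (auto simp: standard_form_def)
  then have *: "\<xi> \<in> phi_dom S (rev (map GenInv \<alpha>))" "\<eta> \<in> phi_dom S (rev (map GenInv \<beta>))"
    "phi S (rev (map GenInv \<beta>)) \<eta> = phi S (rev (map GenInv \<alpha>)) \<xi>"
    using assms by (simp_all add: standard_form_def inv_free_group map_Gen_free_group letter_inv_Gen)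
  then show "\<eta> \<in> phi_dom S (map Gen \<alpha> @ rev (map GenInv \<beta>))"
    "\<xi> = phi S (map Gen \<alpha> @ rev (map GenInv \<beta>)) \<eta>"
    using phi_inverse[OF *(1)] by (simp_all add: phi_dom_append phi_append rev_map letter_inv_Gen)
qed

text \<open>The common ending \<gamma> is the word of the filter reached halfway, after \<beta> has
  been removed from \<eta> and before \<alpha> is prepended.\<close>

lemma phi_standard_form:
  assumes "\<eta> \<in> phi_dom S (map Gen \<alpha> @ rev (map GenInv \<beta>))"
    "\<xi> = phi S (map Gen \<alpha> @ rev (map GenInv \<beta>)) \<eta>"
  obtains \<gamma> where "standard_form S \<alpha> \<beta> \<gamma> \<xi> \<eta>"
proof -
  define \<zeta> where "\<zeta> = phi S (rev (map GenInv \<beta>)) \<eta>"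
  have \<eta>: "\<eta> \<in> phi_dom S (rev (map GenInv \<beta>))" and \<zeta>: "\<zeta> \<in> phi_dom S (map Gen \<alpha>)" "\<xi> = phi S (map Gen \<alpha>) \<zeta>"
    using assms by (simp_all add: phi_dom_append phi_append \<zeta>_def)
  have \<xi>: "\<xi> \<in> phi_dom S (rev (map GenInv \<alpha>))" "phi S (rev (map GenInv \<alpha>)) \<xi> = \<zeta>"
    using phi_inverse[OF \<zeta>(1)] \<zeta>(2) by (simp_all add: letter_inv_Gen)
  \<comment> \<open>Used for \<alpha> with \<xi> and for \<beta> with \<eta>. Both endings obtained
    are words of \<zeta> and therefore equal.\<close>
  have *: "\<alpha> \<in> labels S \<and> (\<exists>\<gamma>. \<theta> \<in> tight_at S (\<alpha> \<cdot>\<^sub>w \<gamma>) \<and> \<gamma> \<in> fiwords S \<and>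
      has_word S (phi S (rev (map GenInv \<alpha>)) \<theta>) \<gamma> \<and> phi S (rev (map GenInv \<alpha>)) \<theta> = cut S \<alpha> \<gamma> \<theta>)"
    if \<theta>: "\<theta> \<in> phi_dom S (rev (map GenInv \<alpha>))" for \<alpha> \<theta>
  proof -
    have tight: "\<theta> \<in> tight S" using \<theta> phi_dom_subset_tight by blast
    then have filter: "idem_filter S \<theta>" by (rule tight_filter)
    have mem: "Some (\<alpha>, word_range S \<alpha>) \<in> \<theta>" if "\<alpha> \<noteq> []"
      using phi_dom_inverse_word[OF \<theta> that] .
    obtain \<delta> where \<delta>: "has_word S \<theta> \<delta>" using filter_has_word[OF filter] .
    obtain \<gamma> where \<gamma>: "\<delta> = \<alpha> \<cdot>\<^sub>w \<gamma>"
    proof (cases "\<alpha> = []")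
      case False
      then show ?thesis using has_word_prefix[OF \<delta> mem] that by blast
    qed (use that in auto)
    with \<delta> have labels: "\<alpha> \<in> labels S" "\<gamma> \<in> fiwords S"
      using fiwords_wapp[of \<alpha> \<gamma>] by (auto simp: has_word_def)
    have "phi S (rev (map GenInv \<alpha>)) \<theta> = filter_drop S \<alpha> \<theta>"
      using phi_inverse_word[OF tight mem] by simp
    moreover have "\<theta> \<in> tight_at S (\<alpha> \<cdot>\<^sub>w \<gamma>)"
      using tight \<delta> \<gamma> by (simp add: tight_at_def)
    ultimately show ?thesis
      using labels cut_eq_filter_drop[OF filter, of \<alpha> \<gamma>] has_word_filter_drop[OF filter, of \<alpha> \<gamma>] \<delta> \<gamma>
      by auto
  qed
  obtain \<gamma> where \<gamma>: "\<alpha> \<in> labels S" "\<xi> \<in> tight_at S (\<alpha> \<cdot>\<^sub>w \<gamma>)" "\<gamma> \<in> fiwords S" "has_word S \<zeta> \<gamma>"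
    "\<zeta> = cut S \<alpha> \<gamma> \<xi>"
    using *[OF \<xi>(1)] \<xi>(2) by auto
  obtain \<gamma>' where \<gamma>': "\<beta> \<in> labels S" "\<eta> \<in> tight_at S (\<beta> \<cdot>\<^sub>w \<gamma>')" "has_word S \<zeta> \<gamma>'"
    "\<zeta> = cut S \<beta> \<gamma>' \<eta>"
    using *[OF \<eta>] \<zeta>_def by auto
  have "\<gamma>' = \<gamma>" using has_word_unique \<gamma> \<gamma>' by blast
  with \<gamma> \<gamma>' show ?thesis by (intro that[of \<gamma>]) (simp add: standard_form_iff)
qed

lemma action_arrow_cases:
  assumes "(\<xi>, t, \<eta>) \<in> arrows (action_groupoid S)"
  obtains \<alpha> \<beta> \<gamma> where "standard_form S \<alpha> \<beta> \<gamma> \<xi> \<eta>" "t = quot_word S \<alpha> \<beta>"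
proof -
  from assms have t: "reduced t" "\<eta> \<in> phi_dom S t" "\<xi> = phi S t \<eta>"
    by (auto simp: action_arrows) (simp add: free_group_def)
  obtain \<alpha> \<beta> where ab: "t = map Gen \<alpha> @ rev (map GenInv \<beta>)"
    using phi_dom_reduced_word[OF t(1,2)] .
  obtain \<gamma> where \<gamma>: "standard_form S \<alpha> \<beta> \<gamma> \<xi> \<eta>"
    using phi_standard_form[of \<eta> \<alpha> \<beta> \<xi>] t ab by blast
  then have "set \<alpha> \<subseteq> alphabet S" "set \<beta> \<subseteq> alphabet S"
    using labels_alphabet by (auto simp: standard_form_def)
  then have "t = quot_word S \<alpha> \<beta>"
    using ab t(1) by (simp add: quot_word_eq free_reduce_reduced)
  with \<gamma> show ?thesis by (rule that)
qed

lemma standard_form_labels: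
  assumes "standard_form S \<alpha> \<beta> \<gamma> \<xi> \<eta>"
  shows "set \<alpha> \<subseteq> alphabet S" "set \<beta> \<subseteq> alphabet S"
  using assms labels_alphabet by (auto simp: standard_form_def)

lemma standard_form_arrow:
  assumes "standard_form S \<alpha> \<beta> \<gamma> \<xi> \<eta>"
  shows "(\<xi>, quot_word S \<alpha> \<beta>, \<eta>) \<in> arrows (action_groupoid S)"
proof -
  note labels = standard_form_labels[OF assms]
  show ?thesis
    using phi_free_reduce[OF standard_form_phi(1)[OF assms]] standard_form_phi(2)[OF assms]
      quot_word_carrier[OF labels]
    by (simp add: action_arrows quot_word_eq[OF labels])
qed

text \<open>The filters \<open>\<xi>\<close>, \<open>\<eta>\<close> determine their words \<open>\<alpha>\<gamma>\<close>, \<open>\<beta>\<gamma>\<close>, so that two standard forms of the same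
  degree differ by moving a beginning of \<open>\<gamma>\<close> into both \<open>\<alpha>\<close> and \<open>\<beta>\<close>.\<close>

lemma standard_form_quot_word_unique:
  assumes "standard_form S \<alpha> \<beta> \<gamma> \<xi> \<eta>" "standard_form S \<alpha>' \<beta>' \<gamma>' \<xi> \<eta>"
    and len: "int (length \<alpha>) - int (length \<beta>) = int (length \<alpha>') - int (length \<beta>')"
  shows "quot_word S \<alpha> \<beta> = quot_word S \<alpha>' \<beta>'"
proof -
  have main: "quot_word S \<alpha> \<beta> = quot_word S \<alpha>' \<beta>'"
    if forms: "standard_form S \<alpha> \<beta> \<gamma> \<xi> \<eta>" "standard_form S \<alpha>' \<beta>' \<gamma>' \<xi> \<eta>"
      and len: "int (length \<alpha>) - int (length \<beta>) = int (length \<alpha>') - int (length \<beta>')"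
      and le: "length \<alpha> \<le> length \<alpha>'" for \<alpha> \<beta> \<gamma> \<alpha>' \<beta>' \<gamma>'
  proof -
    have "has_word S \<xi> (\<alpha> \<cdot>\<^sub>w \<gamma>)" "has_word S \<xi> (\<alpha>' \<cdot>\<^sub>w \<gamma>')" "has_word S \<eta> (\<beta> \<cdot>\<^sub>w \<gamma>)" "has_word S \<eta> (\<beta>' \<cdot>\<^sub>w \<gamma>')"
      using forms tight_atD(3) by (simp_all add: standard_form_def)
    then have words: "\<alpha> \<cdot>\<^sub>w \<gamma> = \<alpha>' \<cdot>\<^sub>w \<gamma>'" "\<beta> \<cdot>\<^sub>w \<gamma> = \<beta>' \<cdot>\<^sub>w \<gamma>'"
      using has_word_unique by auto
    let ?n = "length \<alpha>' - length \<alpha>"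
    have len': "length \<beta>' - length \<beta> = ?n" "length \<beta> \<le> length \<beta>'"
      using len le by linarith+
    have "\<alpha>' = \<alpha> @ wtake ?n \<gamma>"
      using arg_cong[OF words(1), of "wtake (length \<alpha>')"] le by (simp add: wtake_wapp)
    moreover have "\<beta>' = \<beta> @ wtake ?n \<gamma>"
      using arg_cong[OF words(2), of "wtake (length \<beta>')"] len' by (simp add: wtake_wapp)
    ultimately show ?thesis
      using standard_form_labels[OF forms(1)] standard_form_labels[OF forms(2)]
        quot_word_append_cancel[of \<alpha> S \<beta> "wtake ?n \<gamma>"] by simp
  qed
  show ?thesis
    using main[OF assms(1,2) len] main[OF assms(2,1) len[symmetric]]
    by (cases "length \<alpha> \<le> length \<alpha>'") simp_all
qed

lemma degree_map_standard_form:
  assumes "standard_form S \<alpha> \<beta> \<gamma> \<xi> \<eta>"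
  shows "degree_map (\<xi>, quot_word S \<alpha> \<beta>, \<eta>) = (\<xi>, int (length \<alpha>) - int (length \<beta>), \<eta>)"
  using exponent_sum_quot_word[OF standard_form_labels[OF assms]] by (simp add: degree_map_def)

lemma inj_on_degree_map: "inj_on degree_map (arrows (action_groupoid S))"
proof (rule inj_onI)
  fix g h assume g: "g \<in> arrows (action_groupoid S)" and h: "h \<in> arrows (action_groupoid S)"
    and eq: "degree_map g = degree_map h"
  obtain \<xi> t \<eta> where gt: "g = (\<xi>, t, \<eta>)" by (cases g)
  with eq obtain t' where ht: "h = (\<xi>, t', \<eta>)" by (cases h) (auto simp: degree_map_def)
  obtain \<alpha> \<beta> \<gamma> where 1: "standard_form S \<alpha> \<beta> \<gamma> \<xi> \<eta>" "t = quot_word S \<alpha> \<beta>"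
    using action_arrow_cases g gt by blast
  obtain \<alpha>' \<beta>' \<gamma>' where 2: "standard_form S \<alpha>' \<beta>' \<gamma>' \<xi> \<eta>" "t' = quot_word S \<alpha>' \<beta>'"
    using action_arrow_cases h ht by blast
  have "int (length \<alpha>) - int (length \<beta>) = int (length \<alpha>') - int (length \<beta>')"
    using eq gt ht 1 2 degree_map_standard_form[OF 1(1)] degree_map_standard_form[OF 2(1)] by simp
  then show "g = h"
    using standard_form_quot_word_unique[OF 1(1) 2(1)] 1 2 gt ht by simp
qed

section \<open>\<Theta> and the groupoid operations\<close>

lemma labelled_arrows: "arrows (labelled_groupoid S) = degree_map ` arrows (action_groupoid S)"
proof -
  have "arrows (labelled_groupoid S) =
      {(\<xi>, int (length \<alpha>) - int (length \<beta>), \<eta>) | \<xi> \<eta> \<alpha> \<beta> \<gamma>. standard_form S \<alpha> \<beta> \<gamma> \<xi> \<eta>}"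
    by (simp add: labelled_groupoid_def Let_def standard_form_iff)
  also have "\<dots> = degree_map ` arrows (action_groupoid S)"
  proof (intro equalityI subsetI)
    fix h assume "h \<in> {(\<xi>, int (length \<alpha>) - int (length \<beta>), \<eta>) | \<xi> \<eta> \<alpha> \<beta> \<gamma>. standard_form S \<alpha> \<beta> \<gamma> \<xi> \<eta>}"
    then obtain \<xi> \<eta> \<alpha> \<beta> \<gamma> where sf: "standard_form S \<alpha> \<beta> \<gamma> \<xi> \<eta>"
      and h: "h = (\<xi>, int (length \<alpha>) - int (length \<beta>), \<eta>)" by blast
    from h have "h = degree_map (\<xi>, quot_word S \<alpha> \<beta>, \<eta>)"
      by (simp add: degree_map_standard_form[OF sf])
    then show "h \<in> degree_map ` arrows (action_groupoid S)"
      using standard_form_arrow[OF sf] by (rule image_eqI)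
  next
    fix h assume "h \<in> degree_map ` arrows (action_groupoid S)"
    then obtain g where g: "g \<in> arrows (action_groupoid S)" "h = degree_map g" by blast
    obtain \<xi> t \<eta> where gt: "g = (\<xi>, t, \<eta>)" by (cases g)
    obtain \<alpha> \<beta> \<gamma> where sf: "standard_form S \<alpha> \<beta> \<gamma> \<xi> \<eta>" "t = quot_word S \<alpha> \<beta>"
      using action_arrow_cases g(1) gt by blast
    then show "h \<in> {(\<xi>, int (length \<alpha>) - int (length \<beta>), \<eta>) | \<xi> \<eta> \<alpha> \<beta> \<gamma>. standard_form S \<alpha> \<beta> \<gamma> \<xi> \<eta>}"
      using g(2) gt degree_map_standard_form[OF sf(1)] by blast
  qed
  finally show ?thesis .
qed

lemma labelled_composable:
  "composable (labelled_groupoid S) =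
     map_prod degree_map degree_map ` composable (action_groupoid S)" (is "?L = ?R")
proof -
  let ?X = "arrows (action_groupoid S)"
  have "?L = {((\<xi>, m, \<eta>), (\<eta>', n, \<rho>)) | \<xi> m \<eta> \<eta>' n \<rho>.
      (\<xi>, m, \<eta>) \<in> degree_map ` ?X \<and> (\<eta>', n, \<rho>) \<in> degree_map ` ?X \<and> \<eta> = \<eta>'}"
    unfolding labelled_arrows[symmetric] by (simp add: labelled_groupoid_def Let_def)
  also have "\<dots> = ?R"
  proof (intro equalityI subsetI)
    fix p assume "p \<in> {((\<xi>, m, \<eta>), (\<eta>', n, \<rho>)) | \<xi> m \<eta> \<eta>' n \<rho>.
      (\<xi>, m, \<eta>) \<in> degree_map ` ?X \<and> (\<eta>', n, \<rho>) \<in> degree_map ` ?X \<and> \<eta> = \<eta>'}"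
    then obtain \<xi> m \<eta> n \<rho> where p: "p = ((\<xi>, m, \<eta>), (\<eta>, n, \<rho>))"
      "(\<xi>, m, \<eta>) \<in> degree_map ` ?X" "(\<eta>, n, \<rho>) \<in> degree_map ` ?X" by blast
    then obtain s t where st: "(\<xi>, s, \<eta>) \<in> ?X" "m = exponent_sum s" "(\<eta>, t, \<rho>) \<in> ?X" "n = exponent_sum t"
      by (auto simp: degree_map_def)
    then have "p = map_prod degree_map degree_map ((\<xi>, s, \<eta>), (\<eta>, t, \<rho>))"
      using p by (simp add: degree_map_def)
    moreover have "((\<xi>, s, \<eta>), (\<eta>, t, \<rho>)) \<in> composable (action_groupoid S)"
      using st by (simp add: action_composable)
    ultimately show "p \<in> ?R" by blast
  next
    fix p assume "p \<in> ?R"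
    then obtain g h where gh: "(g, h) \<in> composable (action_groupoid S)" "p = (degree_map g, degree_map h)"
      by auto
    obtain \<xi> s \<eta> where g: "g = (\<xi>, s, \<eta>)" by (cases g)
    obtain \<eta>' t \<rho> where h: "h = (\<eta>', t, \<rho>)" by (cases h)
    have "g \<in> ?X" "h \<in> ?X" "\<eta> = \<eta>'"
      using gh(1) g h by (auto simp: action_composable)
    moreover from this have "p = ((\<xi>, exponent_sum s, \<eta>), (\<eta>, exponent_sum t, \<rho>))"
      "(\<xi>, exponent_sum s, \<eta>) = degree_map g" "(\<eta>, exponent_sum t, \<rho>) = degree_map h"
      using gh(2) g h by (simp_all add: degree_map_def)
    ultimately show "p \<in> {((\<xi>, m, \<eta>), (\<eta>', n, \<rho>)) | \<xi> m \<eta> \<eta>' n \<rho>.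
      (\<xi>, m, \<eta>) \<in> degree_map ` ?X \<and> (\<eta>', n, \<rho>) \<in> degree_map ` ?X \<and> \<eta> = \<eta>'}"
      by blast
  qed
  finally show ?thesis .
qed

lemma degree_map_mult:
  "degree_map (gmult (action_groupoid S) x y) = gmult (labelled_groupoid S) (degree_map x) (degree_map y)"
  by (cases x; cases y) (simp add: action_gmult labelled_groupoid_def Let_def degree_map_def
      free_group_def exponent_sum_free_reduce exponent_sum_append)

lemma degree_map_inv:
  "x \<in> arrows (action_groupoid S) \<Longrightarrow>
    degree_map (ginv (action_groupoid S) x) = ginv (labelled_groupoid S) (degree_map x)"
  by (cases x) (simp add: action_ginv action_arrows labelled_groupoid_def Let_def degree_map_def
      inv_free_group exponent_sum_inverse)

text \<open>The group element alone only says that the map of the reduced word is defined at \<eta>.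
  That \<eta> begins with \<beta> and \<xi> with \<alpha>, with a common ending, is the domain
  condition for the unreduced word, hence the intersection.\<close>

lemma Z_basic_eq_image:
  assumes "\<alpha> \<in> labels S" "\<beta> \<in> labels S"
  shows "Z_basic S \<alpha> \<beta> e D = degree_map ` (arrows (action_groupoid S) \<inter>
    UNIV \<times> {quot_word S \<alpha> \<beta>} \<times> (phi_dom S (map Gen \<alpha> @ rev (map GenInv \<beta>)) \<inter> V_basic S e D))"
    (is "_ = degree_map ` ?U")
proof -
  have labels: "set \<alpha> \<subseteq> alphabet S" "set \<beta> \<subseteq> alphabet S"
    using assms labels_alphabet by auto
  have "Z_basic S \<alpha> \<beta> e D = {(\<xi>, int (length \<alpha>) - int (length \<beta>), \<eta>) | \<xi> \<eta> \<gamma>.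
      standard_form S \<alpha> \<beta> \<gamma> \<xi> \<eta> \<and> \<eta> \<in> V_basic S e D}"
    unfolding Z_basic_def standard_form_iff using assms by blast
  also have "\<dots> = degree_map ` ?U"
  proof (intro equalityI subsetI)
    fix h assume "h \<in> {(\<xi>, int (length \<alpha>) - int (length \<beta>), \<eta>) | \<xi> \<eta> \<gamma>.
      standard_form S \<alpha> \<beta> \<gamma> \<xi> \<eta> \<and> \<eta> \<in> V_basic S e D}"
    then obtain \<xi> \<eta> \<gamma> where sf: "standard_form S \<alpha> \<beta> \<gamma> \<xi> \<eta>" and \<eta>: "\<eta> \<in> V_basic S e D"
      and h: "h = (\<xi>, int (length \<alpha>) - int (length \<beta>), \<eta>)" by blast
    have "h = degree_map (\<xi>, quot_word S \<alpha> \<beta>, \<eta>)"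
      using h by (simp add: degree_map_standard_form[OF sf])
    moreover have "(\<xi>, quot_word S \<alpha> \<beta>, \<eta>) \<in> ?U"
      using standard_form_arrow[OF sf] standard_form_phi(1)[OF sf] \<eta> by simp
    ultimately show "h \<in> degree_map ` ?U" by blast
  next
    fix h assume "h \<in> degree_map ` ?U"
    then obtain \<xi> \<eta> where h: "h = degree_map (\<xi>, quot_word S \<alpha> \<beta>, \<eta>)"
      and arrow: "(\<xi>, quot_word S \<alpha> \<beta>, \<eta>) \<in> arrows (action_groupoid S)"
      and \<eta>: "\<eta> \<in> phi_dom S (map Gen \<alpha> @ rev (map GenInv \<beta>))" "\<eta> \<in> V_basic S e D"
      by auto
    \<comment> \<open>On the domain of the unreduced word its map agrees with that of the reduced
      word, so there is a decomposition with precisely these \<alpha> and \<beta>.\<close>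
    have "\<xi> = phi S (map Gen \<alpha> @ rev (map GenInv \<beta>)) \<eta>"
      using arrow phi_free_reduce[OF \<eta>(1)] by (simp add: action_arrows quot_word_eq[OF labels])
    then obtain \<gamma> where sf: "standard_form S \<alpha> \<beta> \<gamma> \<xi> \<eta>"
      using phi_standard_form[OF \<eta>(1)] by blast
    then show "h \<in> {(\<xi>, int (length \<alpha>) - int (length \<beta>), \<eta>) | \<xi> \<eta> \<gamma>.
      standard_form S \<alpha> \<beta> \<gamma> \<xi> \<eta> \<and> \<eta> \<in> V_basic S e D}"
      using \<eta>(2) h degree_map_standard_form[OF sf] by auto
  qed
  finally show ?thesis .
qed

lemma Z_basis_open_image:
  assumes "Z \<in> Z_basis S"
  obtains U where "openin (gtop (action_groupoid S)) U" "Z = degree_map ` U"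
proof -
  from assms obtain \<alpha> \<beta> e D where Z: "Z = Z_basic S \<alpha> \<beta> e D" "\<alpha> \<in> labels S" "\<beta> \<in> labels S" "finite D"
    by (auto simp: Z_basis_def)
  let ?N = "phi_dom S (map Gen \<alpha> @ rev (map GenInv \<beta>)) \<inter> V_basic S e D"
  let ?U = "arrows (action_groupoid S) \<inter> UNIV \<times> {quot_word S \<alpha> \<beta>} \<times> ?N"
  let ?P = "prod_topology (tight_space S)
      (prod_topology (discrete_topology (carrier (free S))) (tight_space S))"
  have "openin (tight_space S) ?N"
    using Z by (intro openin_Int openin_phi_dom openin_V_basic)
  moreover have "quot_word S \<alpha> \<beta> \<in> carrier (free S)"
    using Z labels_alphabet by (intro quot_word_carrier)
  moreover have "openin (tight_space S) (tight S)"
    by (metis openin_topspace topspace_tight_space)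
  ultimately have "openin ?P (tight S \<times> {quot_word S \<alpha> \<beta>} \<times> ?N)"
    by (simp add: openin_prod_Times_iff)
  moreover have "?U = (tight S \<times> {quot_word S \<alpha> \<beta>} \<times> ?N) \<inter> arrows (action_groupoid S)"
    using phi_tight by (auto simp: action_arrows)
  ultimately have "openin (gtop (action_groupoid S)) ?U"
    by (simp only: action_gtop openin_subtopology_Int)
  with Z Z_basic_eq_image show ?thesis by (intro that) auto
qed

text \<open>The basis admits only pairs \<alpha>, \<beta> with a common non-empty set, so every
  arrow must supply one. If both words are non-empty, r(\<alpha>) and r(\<beta>) lie at level
  \<omega> of the filter left after cutting and hence meet.\<close>

lemma standard_form_common_range:
  assumes "standard_form S \<alpha> \<beta> \<gamma> \<xi> \<eta>"
  shows "\<exists>A. A \<noteq> {} \<and> A \<in> family_at S \<alpha> \<inter> family_at S \<beta>"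
proof -
  define \<zeta> where "\<zeta> = filter_drop S \<alpha> \<xi>"
  have labels: "\<alpha> \<in> labels S" "\<beta> \<in> labels S"
    and \<xi>: "\<xi> \<in> tight_at S (\<alpha> \<cdot>\<^sub>w \<gamma>)" and \<eta>: "\<eta> \<in> tight_at S (\<beta> \<cdot>\<^sub>w \<gamma>)"
    using assms by (auto simp: standard_form_def)
  have "filter_drop S \<alpha> \<xi> = filter_drop S \<beta> \<eta>"
    using assms cut_eq_filter_drop tight_atD[OF \<xi>] tight_atD[OF \<eta>] by (auto simp: standard_form_iff)
  then have \<zeta>: "\<zeta> = filter_drop S \<beta> \<eta>" by (simp add: \<zeta>_def)
  have mem: "Some ([], word_range S \<alpha>) \<in> \<zeta>" if "\<alpha> \<noteq> []"
    using filter_drop_contains has_word_contains[OF _ _ that] tight_atD[OF \<xi>] by (simp add: \<zeta>_def)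
  have mem': "Some ([], word_range S \<beta>) \<in> \<zeta>" if "\<beta> \<noteq> []"
    using filter_drop_contains has_word_contains[OF _ _ that] tight_atD[OF \<eta>] by (simp add: \<zeta>)
  have range: "word_range S \<delta> \<in> family_at S \<delta> \<inter> family_at S []" "word_range S \<delta> \<noteq> {}"
    if "\<delta> \<in> labels S" "\<delta> \<noteq> []" for \<delta>
    using that by (auto simp: family_at_def word_range_in_family word_range_subset_verts word_range_nonempty_iff)
  \<comment> \<open>If both words are empty, any non-empty member of the family will do; the range
    of the label of some edge is one.\<close>
  obtain e where "e \<in> arcs (graph S)" using arcs_nonempty by blast
  then have "awalk (tail (graph S) e) [e] (head (graph S) e)"
    by (rule arc_implies_awalk)
  then have "map (label S) [e] \<in> labels S"
    unfolding labels_def labels1_def by blast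
  then have "[label S e] \<in> labels S" by simp
  then have a: "word_range S [label S e] \<noteq> {} \<and> word_range S [label S e] \<in> family_at S []"
    using range by auto
  have both: "word_range S \<alpha> \<inter> word_range S \<beta> \<noteq> {}" if "\<alpha> \<noteq> []" "\<beta> \<noteq> []"
  proof -
    have "idem_filter S \<zeta>"
      unfolding \<zeta>_def using idem_filter_drop has_word_contains tight_atD[OF \<xi>] that by blast
    then show ?thesis
      using filter_Int[OF _ mem[OF that(1)] mem'[OF that(2)]] filter_in_family(1) by blast
  qed
  show ?thesis
  proof (cases "\<alpha> = []")
    case True
    show ?thesis
    proof (cases "\<beta> = []")
      case True
      then show ?thesis using \<open>\<alpha> = []\<close> a by auto
    next
      case False
      then show ?thesis using \<open>\<alpha> = []\<close> range[OF labels(2)] by auto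
    qed
  next
    case \<alpha>: False
    show ?thesis
    proof (cases "\<beta> = []")
      case True
      then show ?thesis using range[OF labels(1) \<alpha>] by auto
    next
      case False
      have "word_range S \<alpha> \<inter> word_range S \<beta> \<in> family_at S \<alpha> \<inter> family_at S \<beta>"
        using word_range_in_family labels \<alpha> False by (auto simp: family_at_def family_Int)
      then show ?thesis using both[OF \<alpha> False] by (intro exI conjI)
    qed
  qed
qed

text \<open>A basic set V in the definition of Z restricts only the source, whereas a neighbourhood
  also restricts the target. Since the group element t is fixed, the target condition is pulled back
  along \<open>phi S t\<close>.\<close>

lemma open_image_Z_basis:
  assumes "openin (gtop (action_groupoid S)) U" "g \<in> U"
  obtains Z where "Z \<in> Z_basis S" "degree_map g \<in> Z" "Z \<subseteq> degree_map ` U"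
proof -
  let ?T = "tight_space S" and ?D = "discrete_topology (carrier (free S))"
  let ?X = "arrows (action_groupoid S)"
  obtain \<xi> t \<eta> where g: "g = (\<xi>, t, \<eta>)" by (cases g)
  from assms(1) obtain W where W: "openin (prod_topology ?T (prod_topology ?D ?T)) W" "U = W \<inter> ?X"
    by (auto simp: action_gtop openin_subtopology)
  have "(\<xi>, (t, \<eta>)) \<in> W" using W assms(2) g by simp
  with W(1) obtain O1 O2 where O: "openin ?T O1" "openin (prod_topology ?D ?T) O2" "\<xi> \<in> O1"
    "(t, \<eta>) \<in> O2" "O1 \<times> O2 \<subseteq> W"
    by (rule openin_prod_topologyE)
  from O(2,4) obtain O3 O4 where O': "openin ?T O4" "t \<in> O3" "\<eta> \<in> O4" "O3 \<times> O4 \<subseteq> O2"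
    by (rule openin_prod_topologyE)
  have sub: "O1 \<times> {t} \<times> O4 \<inter> ?X \<subseteq> U"
    using O O' W by blast
  have arrow: "(\<xi>, t, \<eta>) \<in> ?X" using W assms(2) g by auto
  obtain \<alpha> \<beta> \<gamma> where sf: "standard_form S \<alpha> \<beta> \<gamma> \<xi> \<eta>" and t: "t = quot_word S \<alpha> \<beta>"
    using action_arrow_cases[OF arrow] .
  define N where "N = {\<theta> \<in> topspace (subtopology ?T (phi_dom S t)). phi S t \<theta> \<in> O1} \<inter> O4"
  have "openin ?T {\<theta> \<in> topspace (subtopology ?T (phi_dom S t)). phi S t \<theta> \<in> O1}"
    using openin_continuous_map_preimage[OF continuous_phi O(1)] openin_phi_dom openin_trans_full by blast
  then have "openin ?T N" unfolding N_def using O'(1) by (rule openin_Int)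
  moreover have "\<eta> \<in> N"
    using arrow O(3) O'(3) by (auto simp: N_def action_arrows dest: subsetD[OF phi_dom_subset_tight])
  ultimately obtain e D where D: "e \<in> carrier (idems S)" "finite D" "D \<subseteq> carrier (idems S)"
    "\<eta> \<in> V_basic S e D" "V_basic S e D \<subseteq> N"
    by (rule tight_space_basis)
  have labels: "\<alpha> \<in> labels S" "\<beta> \<in> labels S"
    using sf by (auto simp: standard_form_def)
  obtain A where "A \<noteq> {}" "A \<in> family_at S \<alpha> \<inter> family_at S \<beta>"
    using standard_form_common_range[OF sf] by blast
  with labels D have "Z_basic S \<alpha> \<beta> e D \<in> Z_basis S"
    unfolding Z_basis_def by blast
  moreover have "degree_map g \<in> Z_basic S \<alpha> \<beta> e D"
    unfolding Z_basic_eq_image[OF labels]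
    using arrow standard_form_phi(1)[OF sf] D(4) g t by (intro imageI) simp
  moreover have "Z_basic S \<alpha> \<beta> e D \<subseteq> degree_map ` U"
    unfolding Z_basic_eq_image[OF labels]
  proof (rule image_mono, rule subsetI)
    fix h assume h: "h \<in> ?X \<inter> UNIV \<times> {quot_word S \<alpha> \<beta>} \<times>
      (phi_dom S (map Gen \<alpha> @ rev (map GenInv \<beta>)) \<inter> V_basic S e D)"
    then obtain \<xi>' \<eta>' where h': "h = (\<xi>', t, \<eta>')" "h \<in> ?X" "\<eta>' \<in> N"
      using D(5) t by auto
    then have "\<xi>' \<in> O1" "\<eta>' \<in> O4"
      by (auto simp: N_def action_arrows)
    with h' sub show "h \<in> U" by auto
  qed
  ultimately show ?thesis by (rule that)
qed

lemma homeomorphic_degree_map: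
  "homeomorphic_map (gtop (action_groupoid S)) (gtop (labelled_groupoid S)) degree_map"
proof -
  have "(arbitrary union_of (\<lambda>U. U \<in> Z_basis S)) W \<longleftrightarrow>
      (\<exists>U. openin (gtop (action_groupoid S)) U \<and> W = degree_map ` U)" for W
  proof
    assume "(arbitrary union_of (\<lambda>U. U \<in> Z_basis S)) W"
    then obtain \<Z> where Z: "\<Z> \<subseteq> Z_basis S" "W = \<Union>\<Z>"
      unfolding union_of_def arbitrary_def by auto
    let ?U = "\<Union>{U. openin (gtop (action_groupoid S)) U \<and> degree_map ` U \<in> \<Z>}"
    have "W = degree_map ` ?U"
    proof
      show "W \<subseteq> degree_map ` ?U"
      proof
        fix h assume "h \<in> W"
        then obtain Y where Y: "Y \<in> \<Z>" "h \<in> Y" using Z by blast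
        then obtain U where "openin (gtop (action_groupoid S)) U" "Y = degree_map ` U"
          using Z Z_basis_open_image by blast
        with Y show "h \<in> degree_map ` ?U" by blast
      qed
    qed (use Z in auto)
    moreover have "openin (gtop (action_groupoid S)) ?U" by auto
    ultimately show "\<exists>U. openin (gtop (action_groupoid S)) U \<and> W = degree_map ` U" by blast
  next
    assume "\<exists>U. openin (gtop (action_groupoid S)) U \<and> W = degree_map ` U"
    then obtain U where U: "openin (gtop (action_groupoid S)) U" "W = degree_map ` U" by blast
    show "(arbitrary union_of (\<lambda>U. U \<in> Z_basis S)) W"
      unfolding arbitrary_union_of_alt
    proof
      fix h assume "h \<in> W"
      then obtain g where g: "g \<in> U" "h = degree_map g" using U by blast
      show "\<exists>Z. Z \<in> Z_basis S \<and> h \<in> Z \<and> Z \<subseteq> W"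
        using open_image_Z_basis[OF U(1) g(1)] U(2) g(2) by metis
    qed
  qed
  moreover have "gtop (labelled_groupoid S) = topology (arbitrary union_of (\<lambda>U. U \<in> Z_basis S))"
    by (simp add: labelled_groupoid_def Let_def)
  ultimately show ?thesis
    using homeomorphic_map_image_topology[of degree_map "gtop (action_groupoid S)"] inj_on_degree_map
    by (simp add: topspace_action)
qed

lemma topological_groupoid_iso_degree_map:
  "topological_groupoid_iso (action_groupoid S) (labelled_groupoid S) degree_map"
  by (rule topological_groupoid_iso_transport[OF topological_groupoid_action homeomorphic_degree_map
        labelled_arrows labelled_composable degree_map_mult degree_map_inv])

end

theorem theorem5p5:
  fixes S :: "('v, 'e, 'a) lspace"
  assumes "normal_labelled_space S"
  shows "(\<forall>g \<in> arrows (action_groupoid S). \<exists>\<alpha> \<beta> \<gamma> \<xi> \<eta>.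
            standard_form S \<alpha> \<beta> \<gamma> \<xi> \<eta> \<and> g = (\<xi>, quot_word S \<alpha> \<beta>, \<eta>)) \<and>
         (\<exists>\<Theta>. (\<forall>\<alpha> \<beta> \<gamma> \<xi> \<eta>.
                 standard_form S \<alpha> \<beta> \<gamma> \<xi> \<eta> \<and>
                 (\<xi>, quot_word S \<alpha> \<beta>, \<eta>) \<in> arrows (action_groupoid S) \<longrightarrow>
                 \<Theta> (\<xi>, quot_word S \<alpha> \<beta>, \<eta>) = (\<xi>, int (length \<alpha>) - int (length \<beta>), \<eta>)) \<and>
              topological_groupoid_iso (action_groupoid S) (labelled_groupoid S) \<Theta>)"
proof -
  interpret normal_labelled_space S by (fact assms)
  show ?thesis
  proof (intro conjI ballI exI[of _ degree_map] allI impI)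
    fix g assume g: "g \<in> arrows (action_groupoid S)"
    obtain \<xi> t \<eta> where gt: "g = (\<xi>, t, \<eta>)" by (cases g)
    obtain \<alpha> \<beta> \<gamma> where "standard_form S \<alpha> \<beta> \<gamma> \<xi> \<eta>" "t = quot_word S \<alpha> \<beta>"
      using action_arrow_cases g gt by blast
    with gt show "\<exists>\<alpha> \<beta> \<gamma> \<xi> \<eta>. standard_form S \<alpha> \<beta> \<gamma> \<xi> \<eta> \<and> g = (\<xi>, quot_word S \<alpha> \<beta>, \<eta>)"
      by blast
  qed (auto simp: degree_map_standard_form topological_groupoid_iso_degree_map)
qed

end
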